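(* Let $P:\mathbb{R}^d\to\mathbb{R}^m$ be any non-zero affine map, and let $\mathrm{loss}\in C^0(\mathbb{R}^m\times\mathcal{Y};\mathbb{R}_+)$ be such that the empirical risk $\mathscr{E}$ attains its minimum $0$ on $\mathbb{R}^{d_x}$. Consider either the inside system, with $k=0$, or the outside system with $\sigma$ $1$-homogeneous, with $k=1$. Assume that the considered system interpolates the dataset $\{\vec{x}_i,\vec{y}_i\}_{i\in[N]}$ in time $1$. Fix $T>0$ and, for any $\lambda>0$, let $[w_\lambda,b_\lambda]\in H^k(0,T;\mathbb{R}^{d_u})$ be any pair of global minimizers of $$J_{\lambda,T}(w,b)=\mathscr{E}(\mathbf{x}(T))+\lambda\big\|[w,b]\big\|^2_{H^k(0,T;\mathbb{R}^{d_u})},$$ where $\mathbf{x}(\cdot)$ is the solution on $[0,T]$ of the considered system with parameters $[w,b]$ and initial datum $\mathbf{x}^0$, and let $\mathbf{x}_\lambda(\cdot)$ be the unique solution associated to $[w_\lambda,b_\lambda]$. Then: 1. There exists a constant $\mathfrak{C}=\mathfrak{C}(\{\vec{x}_i,\vec{y}_i\}_{i\in[N]},T)>0$ independent of $\lambda>0$ such that $\mathscr{E}(\mathbf{x}_\lambda(T))\leqslant\mathfrak{C}\,\lambda$. 2. There exist a sequence $\{\lambda_n\}_{n=1}^\infty$ with $\lambda_n>0$ and $\lambda_n\to0$ as $n\to\infty$, and some $\mathbf{x}_\circ\in\mathbb{R}^{d_x}$ with $\mathscr{E}(\mathbf{x}_\circ)=0$, such that, along a subsequence, $\mathbf{x}_{\lambda_n}(T)\to\mathbf{x}_\circ$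 as $n\to\infty$. 3. Moreover, along a subsequence, $$\big\|[w_{\lambda_n},b_{\lambda_n}]-[w^*,b^*]\big\|_{H^k(0,T;\mathbb{R}^{d_u})}\xrightarrow[n\to\infty]{}0,$$ where $[w^*,b^*]\in H^k(0,T;\mathbb{R}^{d_u})$ is a solution of the minimization problem $$\inf\Big\{\big\|[w,b]\big\|^2_{H^k(0,T;\mathbb{R}^{d_u})}\ :\ [w,b]\in H^k(0,T;\mathbb{R}^{d_u}),\ \mathbf{x}(\cdot)\text{ solves the considered system on }[0,T]\text{ with parameters }[w,b],\ \mathscr{E}(\mathbf{x}(T))=0\Big\}.$$
   Context: Write $[n]=\{1,\dots,n\}$. A dataset $\{\vec{x}_i,\vec{y}_i\}_{i\in[N]}\subset\mathcal{X}\times\mathcal{Y}$ is given, with $\mathcal{X}\subset\mathbb{R}^d$, $\vec{x}_i\neq\vec{x}_j$ for $i\neq j$, and $\mathcal{Y}\neq\varnothing$ ($\mathcal{Y}\subset\mathbb{R}^m$ for regression, $\mathcal{Y}=\{-1,1\}$ for binary classification, $\mathcal{Y}=[m]$ for multi-label classification). Set $d_x:=dN$ and $\mathbb{R}^{d_u}:=\mathbb{R}^{d\times(d+1)}$; elements of $\mathbb{R}^{d_u}$ are pairs $[w,b]$ with $w\in\mathbb{R}^{d\times d}$, $b\in\mathbb{R}^d$, with the Euclidean (Frobenius) norm. A vector $\mathbf{x}\in\mathbb{R}^{d_x}$ is viewed as a stack of $N$ sub-vectors $\mathbf{x}_i\in\mathbb{R}^d$, $i\in[N]$; $\mathbf{x}^0$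 denotes the stack with $\mathbf{x}^0_i=\vec{x}_i$. Given $[w,b]$, $\mathbf{w}\in\mathbb{R}^{d_x\times d_x}$ is the block-diagonal matrix with $N$ diagonal blocks equal to $w$, and $\mathbf{b}\in\mathbb{R}^{d_x}$ is the stack of $N$ copies of $b$. The activation $\sigma:\mathbb{R}\to\mathbb{R}$ is globally Lipschitz with $\sigma(0)=0$, applied componentwise to vectors. $\sigma$ is called $1$-homogeneous if $\sigma(cx)=c\,\sigma(x)$ for all $c>0$, $x\in\mathbb{R}$. Inside system: $\dot{\mathbf{x}}(t)=\mathbf{w}(t)\sigma(\mathbf{x}(t))+\mathbf{b}(t)$ on $(0,T)$, $\mathbf{x}(0)=\mathbf{x}^0$. Outside system: $\dot{\mathbf{x}}(t)=\sigma(\mathbf{w}(t)\mathbf{x}(t)+\mathbf{b}(t))$ on $(0,T)$, $\mathbf{x}(0)=\mathbf{x}^0$. $H^0:=L^2$ and $\|f\|_{H^1}^2=\|f\|_{L^2}^2+\|\dot f\|_{L^2}^2$. The empirical risk is $\mathscr{E}(\mathbf{x}):=\frac1N\sum_{i=1}^N\mathrm{loss}(P\mathbf{x}_i,\vec{y}_i)$ for $\mathbf{x}\in\mathbb{R}^{d_x}$. A system (inside with $k=0$, outside with $k=1$) interpolates the dataset in time $T$ if there exist parameters $[w,b]\in H^k(0,T;\mathbb{R}^{d_u})$ whose corresponding solution $\mathbf{x}(\cdot)$ satisfies $\mathscr{E}(\mathbf{x}(T))=0$. *)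

theory Defs
  imports "HOL-Analysis.Analysis"
begin

section \<open>Sobolev spaces on an interval\<close>

text \<open>
  Elements of \<open>L\<^sup>2(0,T)\<close> and \<open>H\<^sup>k(0,T)\<close> are represented by functions on the reals, of which only
  the values almost everywhere on \<open>(0,T)\<close> matter.
\<close>

definition L2_space :: "real \<Rightarrow> (real \<Rightarrow> 'a::euclidean_space) set" where
  "L2_space T = {u. u \<in> borel_measurable (lebesgue_on {0<..<T}) \<and>
     integrable (lebesgue_on {0<..<T}) (\<lambda>t. (norm (u t))\<^sup>2)}"

definition L2_norm :: "real \<Rightarrow> (real \<Rightarrow> 'a::euclidean_space) \<Rightarrow> real" where
  "L2_norm T u = sqrt (LINT t|lebesgue_on {0<..<T}. (norm (u t))\<^sup>2)"

text \<open>Test functions are the \<open>C\<^sup>1\<close> functions with compact support in \<open>(0,T)\<close>, extended by zero.\<close>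

definition test_functions :: "real \<Rightarrow> (real \<Rightarrow> real) set" where
  "test_functions T = {\<phi>. \<phi> C1_differentiable_on UNIV \<and> closure {t. \<phi> t \<noteq> 0} \<subseteq> {0<..<T}}"

definition has_weak_derivative ::
  "real \<Rightarrow> (real \<Rightarrow> 'a::euclidean_space) \<Rightarrow> (real \<Rightarrow> 'a) \<Rightarrow> bool" where
  "has_weak_derivative T u v \<longleftrightarrow>
     (\<forall>\<phi>\<in>test_functions T.
        (LINT t|lebesgue_on {0<..<T}. deriv \<phi> t *\<^sub>R u t) =
        - (LINT t|lebesgue_on {0<..<T}. \<phi> t *\<^sub>R v t))"

text \<open>The weak derivative is unique up to a null set, so the choice does not affect norms.\<close>

definition weak_derivative :: "real \<Rightarrow> (real \<Rightarrow> 'a::euclidean_space) \<Rightarrow> real \<Rightarrow> 'a" where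
  "weak_derivative T u = (SOME v. v \<in> L2_space T \<and> has_weak_derivative T u v)"

primrec H_space :: "nat \<Rightarrow> real \<Rightarrow> (real \<Rightarrow> 'a::euclidean_space) set" where
  "H_space 0 T = L2_space T"
| "H_space (Suc k) T = {u \<in> L2_space T. \<exists>v \<in> H_space k T. has_weak_derivative T u v}"

primrec H_norm :: "nat \<Rightarrow> real \<Rightarrow> (real \<Rightarrow> 'a::euclidean_space) \<Rightarrow> real" where
  "H_norm 0 T u = L2_norm T u"
| "H_norm (Suc k) T u = sqrt ((L2_norm T u)\<^sup>2 + (H_norm k T (weak_derivative T u))\<^sup>2)"

section \<open>Neural ordinary differential equations\<close>

text \<open>
  A parameter \<open>[w,b]\<close> is a pair of a \<open>d \<times> d\<close> matrix and a vector, with the library norm on products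
  and on \<open>real^'d^'d\<close>, i.e. the Euclidean (Frobenius) norm. A stack of \<open>N\<close> vectors of dimension
  \<open>d\<close> is an element of \<open>real^'d^'n\<close>, where \<open>N = CARD('n)\<close> and \<open>d = CARD('d)\<close>.
\<close>

type_synonym 'd param = "(real^'d^'d) \<times> (real^'d)"

definition componentwise :: "(real \<Rightarrow> real) \<Rightarrow> real^'d^'n \<Rightarrow> real^'d^'n" where
  "componentwise \<sigma> x = (\<chi> i j. \<sigma> (x $ i $ j))"

text \<open>The product of the block-diagonal matrix with \<open>N\<close> diagonal blocks \<open>w\<close> and a stack.\<close>

definition block_diag_mult :: "real^'d^'d \<Rightarrow> real^'d^'n \<Rightarrow> real^'d^'n" where
  "block_diag_mult w x = (\<chi> i. w *v (x $ i))"

definition copies :: "real^'d \<Rightarrow> real^'d^'n" where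
  "copies b = (\<chi> i. b)"

datatype nde = Inside | Outside

fun rhs :: "nde \<Rightarrow> (real \<Rightarrow> real) \<Rightarrow> 'd param \<Rightarrow> real^'d^'n \<Rightarrow> real^'d^'n" where
  "rhs Inside \<sigma> (w, b) x = block_diag_mult w (componentwise \<sigma> x) + copies b"
| "rhs Outside \<sigma> (w, b) x = componentwise \<sigma> (block_diag_mult w x + copies b)"

text \<open>
  Parameters are only defined almost everywhere, so solutions are taken in the sense of
  Caratheodory: \<open>x\<close> is an indefinite Lebesgue integral of the right-hand side along \<open>x\<close>.
\<close>

definition solves ::
  "nde \<Rightarrow> (real \<Rightarrow> real) \<Rightarrow> real^'d^'n \<Rightarrow> real \<Rightarrow> (real \<Rightarrow> 'd param) \<Rightarrow> (real \<Rightarrow> real^'d^'n) \<Rightarrow> bool"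
  where
  "solves sys \<sigma> x0 T u x \<longleftrightarrow>
     integrable (lebesgue_on {0..T}) (\<lambda>s. rhs sys \<sigma> (u s) (x s)) \<and>
     (\<forall>t\<in>{0..T}. x t = x0 + (LINT s|lebesgue_on {0..t}. rhs sys \<sigma> (u s) (x s)))"

text \<open>A solution is determined on \<open>[0,T]\<close> only; \<open>extensional\<close> fixes the irrelevant values elsewhere.\<close>

definition solution ::
  "nde \<Rightarrow> (real \<Rightarrow> real) \<Rightarrow> real^'d^'n \<Rightarrow> real \<Rightarrow> (real \<Rightarrow> 'd param) \<Rightarrow> real \<Rightarrow> real^'d^'n" where
  "solution sys \<sigma> x0 T u = (THE x. x \<in> extensional {0..T} \<and> solves sys \<sigma> x0 T u x)"

section \<open>Empirical risk and regularized training\<close>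

definition initial_stack :: "('n \<Rightarrow> real^'d) \<Rightarrow> real^'d^'n" where
  "initial_stack xdat = (\<chi> i. xdat i)"

definition empirical_risk ::
  "((real^'m) \<times> 'y \<Rightarrow> real) \<Rightarrow> (real^'d \<Rightarrow> real^'m) \<Rightarrow> ('n \<Rightarrow> 'y) \<Rightarrow> real^'d^'n \<Rightarrow> real" where
  "empirical_risk loss P ydat x = (1 / real CARD('n)) * (\<Sum>i\<in>UNIV. loss (P (x $ i), ydat i))"

definition affine_map :: "(real^'d \<Rightarrow> real^'m) \<Rightarrow> bool" where
  "affine_map P \<longleftrightarrow> (\<exists>A p. \<forall>x. P x = A *v x + p)"

definition one_homogeneous :: "(real \<Rightarrow> real) \<Rightarrow> bool" where
  "one_homogeneous \<sigma> \<longleftrightarrow> (\<forall>c>0. \<forall>x. \<sigma> (c * x) = c * \<sigma> x)"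

text \<open>
  In the following, \<open>E\<close> is the risk as a function of the stack and \<open>k\<close> the Sobolev order of the
  parameters.
\<close>

definition interpolating_params ::
  "(real^'d^'n \<Rightarrow> real) \<Rightarrow> nde \<Rightarrow> (real \<Rightarrow> real) \<Rightarrow> real^'d^'n \<Rightarrow> nat \<Rightarrow> real \<Rightarrow> (real \<Rightarrow> 'd param) \<Rightarrow> bool"
  where
  "interpolating_params E sys \<sigma> x0 k T u \<longleftrightarrow>
     u \<in> H_space k T \<and> (\<exists>x. solves sys \<sigma> x0 T u x \<and> E (x T) = 0)"

definition cost ::
  "(real^'d^'n \<Rightarrow> real) \<Rightarrow> nde \<Rightarrow> (real \<Rightarrow> real) \<Rightarrow> real^'d^'n \<Rightarrow> nat \<Rightarrow> real \<Rightarrow> real \<Rightarrow> (real \<Rightarrow> 'd param) \<Rightarrow> real"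
  where
  "cost E sys \<sigma> x0 k T l u = E (solution sys \<sigma> x0 T u T) + l * (H_norm k T u)\<^sup>2"

end

theory Submission
  imports Defs "HOL-Complex_Analysis.Great_Picard"
begin

text \<open>
  Comparing a minimizer \<open>u\<^sub>\<lambda>\<close> with any interpolating parameter \<open>v\<close> gives
  \<open>E (x\<^sub>\<lambda> T) + \<lambda> \<parallel>u\<^sub>\<lambda>\<parallel>\<^sup>2 \<le> \<lambda> \<parallel>v\<parallel>\<^sup>2\<close>; interpolating parameters on \<open>[0,T]\<close> exist because \<open>u (t/T) / T\<close> drives
  \<open>x (t/T)\<close>. Hence the risk is \<open>O(\<lambda>)\<close> and \<open>\<parallel>u\<^sub>\<lambda>\<parallel>\<^sup>2\<close> is at most the infimum \<open>m\<close> of \<open>\<parallel>v\<parallel>\<^sup>2\<close>. The trajectories are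
  uniformly Holder continuous, so by Arzela-Ascoli they converge along a subsequence to some \<open>y\<close>.
  Instead of weak limits, near-minimal elements of the midpoint hulls of the tails of the sequence
  of parameters are used: by the parallelogram law they converge in norm to some \<open>v\<close>. That \<open>y\<close> solves the
  equation with parameter \<open>v\<close> follows in the inside case from linearity of the right-hand side in the parameter
  and in the outside case from the compact embedding of \<open>H\<^sup>1\<close> into \<open>L\<^sup>2\<close>. Thus \<open>v\<close> interpolates and
  \<open>\<parallel>v\<parallel>\<^sup>2 = m\<close>, and the parallelogram law turns this into strong convergence of the parameters.
\<close>

section \<open>Square-integrable functions\<close>

text \<open>A norm bound on the controls gives only weak compactness, and the outside field is
  nonlinear in its parameter: averaging parameters does not average the right-hand side, so the
  averaging argument of the inside case fails there and strong L^2 compactness has to come from the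
  H^1 bound. The Hilbert space step is nevertheless shared, since the parameters of order k = 0 and
  k = 1 are both turned into closed subspaces of one L^2 space of pairs. The minimal squared norms
  on the tail hulls increase to some D <= m, and the limit v has squared norm exactly D. The bound
  \<open>\<parallel>u\<^sub>\<lambda>\<parallel>\<^sup>2 \<le> m\<close> carries no error term
  because interpolating parameters have risk 0 and the risk is nonnegative. Hence, once v is known
  to interpolate, m <= D <= m, and the controls themselves are near-minimal in their hulls. The
  Gronwall and Picard estimates are for squared quantities: parameters are only L^2 in time, and
  Cauchy-Schwarz then replaces the time-dependent Lipschitz rate by a constant one.\<close>

definition L2_on :: "'s measure \<Rightarrow> ('s \<Rightarrow> 'a::euclidean_space) set" where
  "L2_on M = {u \<in> borel_measurable M. integrable M (\<lambda>t. (norm (u t))\<^sup>2)}"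

definition L2_norm_on :: "'s measure \<Rightarrow> ('s \<Rightarrow> 'a::euclidean_space) \<Rightarrow> real" where
  "L2_norm_on M u = sqrt (LINT t|M. (norm (u t))\<^sup>2)"

lemma L2_onD:
  assumes "u \<in> L2_on M"
  shows "u \<in> borel_measurable M" "integrable M (\<lambda>t. (norm (u t))\<^sup>2)"
  using assms by (auto simp: L2_on_def)

lemma L2_norm_on_nonneg [simp]: "0 \<le> L2_norm_on M u"
  by (simp add: L2_norm_on_def)

lemma L2_norm_on_square: "(L2_norm_on M u)\<^sup>2 = (LINT t|M. (norm (u t))\<^sup>2)"
  by (simp add: L2_norm_on_def)

lemma L2_on_dominated:
  fixes u :: "'s \<Rightarrow> 'a::euclidean_space"
  assumes "u \<in> borel_measurable M" "integrable M h" "\<And>t. (norm (u t))\<^sup>2 \<le> h t"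
  shows "u \<in> L2_on M"
  unfolding L2_on_def mem_Collect_eq
proof (intro conjI)
  show "integrable M (\<lambda>t. (norm (u t))\<^sup>2)"
    by (rule Bochner_Integration.integrable_bound[OF assms(2)])
       (use assms in \<open>auto intro!: always_eventually order_trans[OF assms(3) abs_ge_self]\<close>)
qed (use assms in auto)

lemma L2_on_scaleR: "u \<in> L2_on M \<Longrightarrow> (\<lambda>t. c *\<^sub>R u t) \<in> L2_on M"
  by (auto simp: L2_on_def power_mult_distrib)

lemma power2_norm_add_le: "(norm (x + y :: 'a::real_inner))\<^sup>2 \<le> 2 * (norm x)\<^sup>2 + 2 * (norm y)\<^sup>2"
proof -
  have "0 \<le> (norm (x - y))\<^sup>2" by simp
  then show ?thesis
    by (simp add: power2_norm_eq_inner inner_add_left inner_add_right inner_diff_left inner_diff_right inner_commute)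
qed

lemma L2_on_add:
  assumes "u \<in> L2_on M" "v \<in> L2_on M"
  shows "(\<lambda>t. u t + v t) \<in> L2_on M"
proof (rule L2_on_dominated)
  show "integrable M (\<lambda>t. 2 * (norm (u t))\<^sup>2 + 2 * (norm (v t))\<^sup>2)"
    using assms by (auto simp: L2_on_def)
qed (use assms in \<open>auto simp: L2_on_def intro: power2_norm_add_le\<close>)

lemma L2_on_diff:
  assumes "u \<in> L2_on M" "v \<in> L2_on M"
  shows "(\<lambda>t. u t - v t) \<in> L2_on M"
  using L2_on_add[OF assms(1) L2_on_scaleR[OF assms(2), of "-1"]] by simp

lemma L2_norm_on_scaleR: "L2_norm_on M (\<lambda>t. c *\<^sub>R u t) = \<bar>c\<bar> * L2_norm_on M u"
  by (simp add: L2_norm_on_def power_mult_distrib real_sqrt_mult)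

lemma L2_norm_on_minus_commute: "L2_norm_on M (\<lambda>t. u t - v t) = L2_norm_on M (\<lambda>t. v t - u t)"
  by (simp add: L2_norm_on_def norm_minus_commute)

lemma integrable_norm_mult_L2:
  assumes "u \<in> L2_on M" "v \<in> L2_on M"
  shows "integrable M (\<lambda>t. norm (u t) * norm (v t))"
proof (rule Bochner_Integration.integrable_bound)
  show "integrable M (\<lambda>t. (norm (u t))\<^sup>2 + (norm (v t))\<^sup>2)"
    using assms by (auto simp: L2_on_def)
  have "norm (u t) * norm (v t) \<le> (norm (u t))\<^sup>2 + (norm (v t))\<^sup>2" for t
    using sum_squares_bound[of "norm (u t)" "norm (v t)"] zero_le_power2[of "norm (u t)"]
      zero_le_power2[of "norm (v t)"] mult_nonneg_nonneg[OF norm_ge_zero norm_ge_zero, of "u t" "v t"]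
    by linarith
  then show "AE t in M. norm (norm (u t) * norm (v t)) \<le> norm ((norm (u t))\<^sup>2 + (norm (v t))\<^sup>2)"
    by auto
qed (use assms in \<open>auto simp: L2_on_def\<close>)

text \<open>The extended-real inequality is transferred to real integrals;
  \<open>integrable_norm_mult_L2\<close> makes the left side finite and equal to a real
  integral.\<close>

lemma Cauchy_Schwarz_L2:
  assumes "u \<in> L2_on M" "v \<in> L2_on M"
  shows "(LINT t|M. norm (u t) * norm (v t)) \<le> L2_norm_on M u * L2_norm_on M v"
proof -
  have [measurable]: "u \<in> borel_measurable M" "v \<in> borel_measurable M"
    using assms by (auto simp: L2_on_def)
  let ?C = "LINT t|M. norm (u t) * norm (v t)"
  have C: "0 \<le> ?C" by simp
  have "(\<integral>\<^sup>+t. ennreal (norm (u t)) * ennreal (norm (v t)) \<partial>M)\<^sup>2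
      \<le> (\<integral>\<^sup>+t. ennreal (norm (u t)) ^ 2 \<partial>M) * (\<integral>\<^sup>+t. ennreal (norm (v t)) ^ 2 \<partial>M)"
    by (rule Cauchy_Schwarz_nn_integral) auto
  also have "(\<integral>\<^sup>+t. ennreal (norm (u t)) * ennreal (norm (v t)) \<partial>M) = ennreal ?C"
    using integrable_norm_mult_L2[OF assms] by (simp flip: ennreal_mult add: nn_integral_eq_integral)
  also have "(\<integral>\<^sup>+t. ennreal (norm (u t)) ^ 2 \<partial>M) = ennreal ((L2_norm_on M u)\<^sup>2)"
    using assms by (simp add: ennreal_power L2_norm_on_square L2_on_def nn_integral_eq_integral)
  also have "(\<integral>\<^sup>+t. ennreal (norm (v t)) ^ 2 \<partial>M) = ennreal ((L2_norm_on M v)\<^sup>2)"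
    using assms by (simp add: ennreal_power L2_norm_on_square L2_on_def nn_integral_eq_integral)
  finally have "?C\<^sup>2 \<le> (L2_norm_on M u * L2_norm_on M v)\<^sup>2"
    using C by (simp add: ennreal_power power_mult_distrib flip: ennreal_mult)
  then show ?thesis
    by (rule power2_le_imp_le) simp
qed

lemma L2_norm_on_triangle:
  assumes "u \<in> L2_on M" "v \<in> L2_on M"
  shows "L2_norm_on M (\<lambda>t. u t + v t) \<le> L2_norm_on M u + L2_norm_on M v"
proof (rule power2_le_imp_le)
  have "(L2_norm_on M (\<lambda>t. u t + v t))\<^sup>2
      \<le> (LINT t|M. (norm (u t))\<^sup>2 + 2 * (norm (u t) * norm (v t)) + (norm (v t))\<^sup>2)"
    unfolding L2_norm_on_square
  proof (rule integral_mono)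
    show "(norm (u t + v t))\<^sup>2 \<le> (norm (u t))\<^sup>2 + 2 * (norm (u t) * norm (v t)) + (norm (v t))\<^sup>2" for t
      using power_mono[OF norm_triangle_ineq, of "u t" "v t" 2] by (simp add: power2_sum)
  qed (use assms L2_onD[OF L2_on_add[OF assms]] integrable_norm_mult_L2[OF assms]
        in \<open>auto simp: L2_on_def\<close>)
  also have "\<dots> = (L2_norm_on M u)\<^sup>2 + 2 * (LINT t|M. norm (u t) * norm (v t)) + (L2_norm_on M v)\<^sup>2"
    using assms integrable_norm_mult_L2[OF assms] by (simp add: L2_on_def L2_norm_on_square)
  also have "\<dots> \<le> (L2_norm_on M u + L2_norm_on M v)\<^sup>2"
    using Cauchy_Schwarz_L2[OF assms] by (simp add: power2_sum)
  finally show "(L2_norm_on M (\<lambda>t. u t + v t))\<^sup>2 \<le> (L2_norm_on M u + L2_norm_on M v)\<^sup>2" .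
qed simp

lemma L2_norm_on_triangle_diff:
  assumes "u \<in> L2_on M" "v \<in> L2_on M"
  shows "\<bar>L2_norm_on M u - L2_norm_on M v\<bar> \<le> L2_norm_on M (\<lambda>t. u t - v t)"
  using L2_norm_on_triangle[OF L2_on_diff[OF assms] assms(2)]
    L2_norm_on_triangle[OF L2_on_diff[OF assms(2,1)] assms(1)]
    L2_norm_on_minus_commute[of M u v]
  by simp

text \<open>Written with the midpoint instead of the sum, because the midpoint is what stays in a
  \<open>midpoint_hull\<close> and can be compared with an infimum over it.\<close>

lemma L2_norm_on_parallelogram:
  fixes u v :: "'s \<Rightarrow> 'a::euclidean_space"
  assumes "u \<in> L2_on M" "v \<in> L2_on M"
  shows "(L2_norm_on M (\<lambda>t. u t - v t))\<^sup>2 =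
    2 * (L2_norm_on M u)\<^sup>2 + 2 * (L2_norm_on M v)\<^sup>2 - 4 * (L2_norm_on M (\<lambda>t. (1/2) *\<^sub>R (u t + v t)))\<^sup>2"
proof -
  have *: "(norm (x - y))\<^sup>2 = 2 * (norm x)\<^sup>2 + 2 * (norm y)\<^sup>2 - 4 * (norm ((1/2) *\<^sub>R (x + y)))\<^sup>2" for x y :: 'a
    by (simp add: power_mult_distrib power2_norm_eq_inner inner_add_left inner_add_right
          inner_diff_left inner_diff_right inner_commute field_simps)
  have "integrable M (\<lambda>t. (norm ((1/2) *\<^sub>R (u t + v t)))\<^sup>2)"
    by (rule L2_onD(2)[OF L2_on_scaleR[OF L2_on_add[OF assms]]])
  then show ?thesis
    unfolding L2_norm_on_square * using L2_onD(2)[OF assms(1)] L2_onD(2)[OF assms(2)] by simp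
qed

section \<open>Completeness of L^2 and a midpoint version of Mazur's lemma\<close>

lemma (in finite_measure) integrable_norm_L2:
  assumes "u \<in> L2_on M"
  shows "integrable M (\<lambda>t. norm (u t))"
    and "(LINT t|M. norm (u t)) \<le> L2_norm_on M u * sqrt (measure M (space M))"
proof -
  have 1: "(\<lambda>_. 1::real) \<in> L2_on M" by (auto simp: L2_on_def)
  show "integrable M (\<lambda>t. norm (u t))"
    using integrable_norm_mult_L2[OF assms 1] by simp
  show "(LINT t|M. norm (u t)) \<le> L2_norm_on M u * sqrt (measure M (space M))"
    using Cauchy_Schwarz_L2[OF assms 1] by (simp add: L2_norm_on_def)
qed

text \<open>Riesz-Fischer. Along indices whose increments are below \<open>(1/2)^k\<close> in L^2,
  finiteness of the measure makes the increments summable in L^1, hence absolutely summable almost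
  everywhere. Fatou's lemma turns the resulting pointwise limit into an L^2 limit of the whole
  sequence.\<close>

lemma (in finite_measure) L2_on_complete:
  fixes u :: "nat \<Rightarrow> 'a \<Rightarrow> 'b::euclidean_space"
  assumes u: "\<And>n. u n \<in> L2_on M"
    and Cauchy: "\<And>e. 0 < e \<Longrightarrow> \<exists>N. \<forall>m\<ge>N. \<forall>n\<ge>N. L2_norm_on M (\<lambda>t. u m t - u n t) < e"
  obtains g where "g \<in> L2_on M" "(\<lambda>n. L2_norm_on M (\<lambda>t. u n t - g t)) \<longlonglongrightarrow> 0"
proof -
  have [measurable]: "u n \<in> borel_measurable M" for n using u L2_onD by blast
  have "\<forall>k::nat. \<exists>N. \<forall>m\<ge>N. \<forall>n\<ge>N. L2_norm_on M (\<lambda>t. u m t - u n t) < (1/2)^k"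
    using Cauchy by simp
  then obtain N where N: "\<And>k m n. m \<ge> N k \<Longrightarrow> n \<ge> N k \<Longrightarrow> L2_norm_on M (\<lambda>t. u m t - u n t) < (1/2)^k"
    by metis
  \<comment> \<open>Partial sums of the thresholds dominate each earlier \<open>N k\<close>, so both
    \<open>r k\<close> and \<open>r (Suc k)\<close> are at least \<open>N k\<close>;
    \<open>r\<close> need not be strictly increasing.\<close>
  define r where "r k = (\<Sum>i\<le>k. N i)" for k
  have r: "N k \<le> r j" if "k \<le> j" for k j
    unfolding r_def by (rule member_le_sum) (use that in auto)
  define d where "d k t = u (r (Suc k)) t - u (r k) t" for k t
  have d: "d k \<in> L2_on M" for k unfolding d_def by (intro L2_on_diff u)
  have [measurable]: "d k \<in> borel_measurable M" for k using d L2_onD by blast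
  define c where "c = sqrt (measure M (space M))"
  have "(LINT t|M. norm (d k t)) \<le> (1/2)^k * c" for k
  proof -
    have "(LINT t|M. norm (d k t)) \<le> L2_norm_on M (d k) * c"
      unfolding c_def by (rule integrable_norm_L2(2)[OF d])
    also have "\<dots> \<le> (1/2)^k * c"
      by (intro mult_right_mono)
         (use N[of k "r (Suc k)" "r k"] r[of k] in \<open>auto simp: c_def d_def[abs_def] intro: less_imp_le\<close>)
    finally show ?thesis .
  qed
  then have d1: "(\<integral>\<^sup>+t. ennreal (norm (d k t)) \<partial>M) \<le> ennreal ((1/2)^k * c)" for k
    by (subst nn_integral_eq_integral) (auto intro: integrable_norm_L2 d ennreal_leI)
  have "(\<integral>\<^sup>+t. (\<Sum>k. ennreal (norm (d k t))) \<partial>M) = (\<Sum>k. \<integral>\<^sup>+t. ennreal (norm (d k t)) \<partial>M)"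
    by (rule nn_integral_suminf) auto
  also have "\<dots> \<le> (\<Sum>k. ennreal ((1/2)^k * c))"
    by (intro suminf_le d1) auto
  also have "\<dots> = ennreal (\<Sum>k. (1/2)^k * c)"
    by (intro suminf_ennreal2 summable_mult2 summable_geometric) (auto simp: c_def)
  finally have "(\<integral>\<^sup>+t. (\<Sum>k. ennreal (norm (d k t))) \<partial>M) \<noteq> \<infinity>"
    by (metis ennreal_less_top infinity_ennreal_def leD)
  then have "AE t in M. (\<Sum>k. ennreal (norm (d k t))) \<noteq> \<infinity>"
    by (intro nn_integral_PInf_AE) auto
  then have conv: "AE t in M. convergent (\<lambda>k. u (r k) t)"
  proof eventually_elim
    case (elim t)
    then have "summable (\<lambda>k. norm (d k t))"
      by (intro summable_suminf_not_top) (auto simp: top_ennreal_def)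
    then have "summable (\<lambda>k. d k t)" by (rule summable_norm_cancel)
    then have "convergent (\<lambda>n. \<Sum>k<n. d k t)" by (simp add: summable_iff_convergent)
    then have "convergent (\<lambda>n. (\<Sum>k<n. d k t) + u (r 0) t)"
      by (intro convergent_add convergent_const)
    moreover have "(\<Sum>k<n. d k t) + u (r 0) t = u (r n) t" for n
      using sum_lessThan_telescope[of "\<lambda>k. u (r k) t" n] by (simp add: d_def)
    ultimately show ?case by simp
  qed
  \<comment> \<open>\<open>lim\<close> yields a measurable function on the whole space; its value is
    meaningful only on the full-measure set given by \<open>conv\<close>.\<close>
  define g where "g t = lim (\<lambda>k. u (r k) t)" for t
  have [measurable]: "g \<in> borel_measurable M" unfolding g_def by measurable
  \<comment> \<open>Fatou in \<open>j\<close> with \<open>n\<close> held fixed, so the bound holds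
    for every \<open>n \<ge> N k\<close> and not merely along \<open>r\<close>.\<close>
  have est: "(\<integral>\<^sup>+t. ennreal ((norm (u n t - g t))\<^sup>2) \<partial>M) \<le> ennreal (((1/2)^k)\<^sup>2)" if n: "n \<ge> N k" for n k
  proof -
    have "(\<integral>\<^sup>+t. ennreal ((norm (u n t - g t))\<^sup>2) \<partial>M)
        = (\<integral>\<^sup>+t. liminf (\<lambda>j. ennreal ((norm (u n t - u (r j) t))\<^sup>2)) \<partial>M)"
    proof (rule nn_integral_cong_AE, use conv in eventually_elim)
      case (elim t)
      then have "(\<lambda>k. u (r k) t) \<longlonglongrightarrow> g t" by (simp add: g_def convergent_LIMSEQ_iff)
      then have "(\<lambda>j. ennreal ((norm (u n t - u (r j) t))\<^sup>2)) \<longlonglongrightarrow> ennreal ((norm (u n t - g t))\<^sup>2)"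
        by (intro tendsto_intros)
      then show ?case by (intro lim_imp_Liminf[symmetric]) auto
    qed
    also have "\<dots> \<le> liminf (\<lambda>j. \<integral>\<^sup>+t. ennreal ((norm (u n t - u (r j) t))\<^sup>2) \<partial>M)"
      by (rule nn_integral_liminf) auto
    also have "\<dots> \<le> liminf (\<lambda>j. ennreal (((1/2)^k)\<^sup>2))"
    proof (rule Liminf_mono, rule eventually_sequentiallyI[of k])
      fix j assume "k \<le> j"
      then have "L2_norm_on M (\<lambda>t. u n t - u (r j) t) < (1/2)^k" using N n r by blast
      then have "(L2_norm_on M (\<lambda>t. u n t - u (r j) t))\<^sup>2 \<le> ((1/2)^k)\<^sup>2"
        by (intro power_mono) auto
      then show "(\<integral>\<^sup>+t. ennreal ((norm (u n t - u (r j) t))\<^sup>2) \<partial>M) \<le> ennreal (((1/2)^k)\<^sup>2)"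
        unfolding L2_norm_on_square
        using L2_onD(2)[OF L2_on_diff[OF u u]]
        by (subst nn_integral_eq_integral) (auto intro: ennreal_leI)
    qed
    finally show ?thesis by (simp add: Liminf_const)
  qed
  have diff: "(\<lambda>t. u n t - g t) \<in> L2_on M" if n: "n \<ge> N k" for n k
    unfolding L2_on_def mem_Collect_eq
  proof (intro conjI integrableI_bounded)
    show "(\<integral>\<^sup>+t. ennreal (norm ((norm (u n t - g t))\<^sup>2)) \<partial>M) < \<infinity>"
      using order.strict_trans1[OF est[OF n] ennreal_less_top] by simp
  qed auto
  have est': "L2_norm_on M (\<lambda>t. u n t - g t) \<le> (1/2)^k" if n: "n \<ge> N k" for n k
  proof (rule power2_le_imp_le)
    show "(L2_norm_on M (\<lambda>t. u n t - g t))\<^sup>2 \<le> ((1/2)^k)\<^sup>2"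
      unfolding L2_norm_on_square
      using est[OF n] L2_onD(2)[OF diff[OF n]] by (subst (asm) nn_integral_eq_integral) auto
  qed simp
  \<comment> \<open>\<open>g\<close> is the difference of \<open>u (N 0)\<close> and
    \<open>u (N 0) - g\<close>, both square integrable.\<close>
  have "g \<in> L2_on M"
    using L2_on_diff[OF u diff[OF order_refl], of "N 0" 0] by simp
  moreover have "(\<lambda>n. L2_norm_on M (\<lambda>t. u n t - g t)) \<longlonglongrightarrow> 0"
  proof (rule LIMSEQ_I)
    fix e :: real assume "0 < e"
    then obtain k where k: "(1/2)^k < e" using real_arch_pow_inv[of e "1/2"] by auto
    show "\<exists>n0. \<forall>n\<ge>n0. norm (L2_norm_on M (\<lambda>t. u n t - g t) - 0) < e"
      using est' k by (intro exI[of _ "N k"]) (auto intro: order.strict_trans1)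
  qed
  ultimately show ?thesis using that by blast
qed

text \<open>Closure under midpoints is all that the parallelogram argument for Mazur's lemma needs, so
  general convex combinations can be avoided.\<close>

inductive_set midpoint_hull :: "('s \<Rightarrow> 'a::real_vector) set \<Rightarrow> ('s \<Rightarrow> 'a) set" for S where
  base: "v \<in> S \<Longrightarrow> v \<in> midpoint_hull S"
| mid: "v \<in> midpoint_hull S \<Longrightarrow> w \<in> midpoint_hull S \<Longrightarrow> (\<lambda>t. (1/2) *\<^sub>R (v t + w t)) \<in> midpoint_hull S"

lemma midpoint_hull_mono:
  assumes "S \<subseteq> S'" shows "midpoint_hull S \<subseteq> midpoint_hull S'"
proof
  show "v \<in> midpoint_hull S'" if "v \<in> midpoint_hull S" for v
    using that by induction (use assms in \<open>auto intro: midpoint_hull.intros\<close>)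
qed

lemma midpoint_hull_L2: "v \<in> midpoint_hull S \<Longrightarrow> S \<subseteq> L2_on M \<Longrightarrow> v \<in> L2_on M"
  by (induction rule: midpoint_hull.induct) (auto intro!: L2_on_scaleR L2_on_add)

text \<open>Let \<open>d n\<close> be the infimum of the squared norms over the hull of the n-th
  tail. It increases to some \<open>D \<le> m\<close>, and near-minimizers \<open>V n\<close> form a
  Cauchy sequence, since the midpoint of two of them is again in the hull and cannot lie below the
  infimum. The last conclusion replaces the argument from weak convergence plus convergence of
  norms: when \<open>g\<close> has the largest norm allowed, the \<open>G n\<close> are near-minimal
  as well.\<close>

lemma (in finite_measure) Mazur_L2:
  fixes G :: "nat \<Rightarrow> 'a \<Rightarrow> 'b::euclidean_space"
  assumes G: "\<And>n. G n \<in> L2_on M" and bound: "\<And>n. (L2_norm_on M (G n))\<^sup>2 \<le> m"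
  obtains V g where "\<And>n. V n \<in> midpoint_hull (G ` {n..})" "g \<in> L2_on M"
    "(\<lambda>n. L2_norm_on M (\<lambda>t. V n t - g t)) \<longlonglongrightarrow> 0" "(L2_norm_on M g)\<^sup>2 \<le> m"
    "m \<le> (L2_norm_on M g)\<^sup>2 \<longrightarrow> (\<lambda>n. L2_norm_on M (\<lambda>t. G n t - g t)) \<longlonglongrightarrow> 0"
proof -
  define C where "C n = midpoint_hull (G ` {n..})" for n
  have CL: "v \<in> C n \<Longrightarrow> v \<in> L2_on M" for v n
    unfolding C_def using midpoint_hull_L2 G by blast
  have GC: "G n \<in> C n" for n unfolding C_def by (auto intro: midpoint_hull.base)
  have Cmono: "C j \<subseteq> C i" if "i \<le> j" for i j
    unfolding C_def by (rule midpoint_hull_mono) (use that in auto)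
  define d where "d n = (INF v\<in>C n. (L2_norm_on M v)\<^sup>2)" for n
  have bdd: "bdd_below ((\<lambda>v. (L2_norm_on M v)\<^sup>2) ` C n)" for n
    by (rule bdd_belowI[of _ 0]) auto
  have d_le: "d n \<le> (L2_norm_on M v)\<^sup>2" if "v \<in> C n" for n v
    unfolding d_def by (rule cINF_lower[OF bdd that])
  have "\<exists>v\<in>C n. (L2_norm_on M v)\<^sup>2 < d n + 1 / real (Suc n)" for n
  proof -
    have "(\<lambda>v. (L2_norm_on M v)\<^sup>2) ` C n \<noteq> {}" using GC by blast
    from cInf_lessD[OF this, of "d n + 1 / real (Suc n)"] show ?thesis by (auto simp: d_def)
  qed
  then obtain V where V: "\<And>n. V n \<in> C n" and Vd: "\<And>n. (L2_norm_on M (V n))\<^sup>2 < d n + 1 / real (Suc n)"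
    by metis
  have "incseq d"
  proof (rule incseq_SucI)
    show "d n \<le> d (Suc n)" for n
      unfolding d_def by (rule cINF_superset_mono[OF _ bdd]) (use GC Cmono[of n "Suc n"] in auto)
  qed
  moreover have "d n \<le> m" for n using d_le[OF GC] bound[of n] by (rule order_trans)
  ultimately obtain D where D: "d \<longlonglongrightarrow> D" and dD: "\<And>n. d n \<le> D"
    using incseq_convergent[of d m] by blast
  have Dm: "D \<le> m" using D by (rule LIMSEQ_le_const2) (use \<open>\<And>n. d n \<le> m\<close> in auto)
  have inv: "(\<lambda>n. 1 / real (Suc n)) \<longlonglongrightarrow> 0" using LIMSEQ_inverse_real_of_nat by (simp add: inverse_eq_divide)
  \<comment> \<open>The midpoint belongs to \<open>C n\<close>, so \<open>d n\<close> bounds its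
    squared norm from below.\<close>
  have par: "(L2_norm_on M (\<lambda>t. v t - w t))\<^sup>2 \<le> 2 * (L2_norm_on M v)\<^sup>2 + 2 * (L2_norm_on M w)\<^sup>2 - 4 * d n"
    if "v \<in> C n" "w \<in> C n" for v w n
  proof -
    have "(\<lambda>t. (1/2) *\<^sub>R (v t + w t)) \<in> C n" using that unfolding C_def by (rule midpoint_hull.mid)
    from d_le[OF this] show ?thesis
      using L2_norm_on_parallelogram[OF CL[OF that(1)] CL[OF that(2)]] by simp
  qed
  \<comment> \<open>For \<open>i, j \<ge> n\<close> both functions lie in \<open>C n\<close> by
    \<open>Cmono\<close>, and both squared norms are at most \<open>D + 1 / Suc n\<close>;
    \<open>par\<close> then gives the right-hand side.\<close>
  have VV: "(L2_norm_on M (\<lambda>t. V i t - V j t))\<^sup>2 \<le> 4 * (D - d n) + 4 * (1 / real (Suc n))"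
    if "n \<le> i" "n \<le> j" for i j n
  proof -
    have "(L2_norm_on M (V i))\<^sup>2 \<le> D + 1 / real (Suc n)" if "n \<le> i" for i
    proof -
      have "1 / real (Suc i) \<le> 1 / real (Suc n)" using that by (intro frac_le) auto
      then show ?thesis using Vd[of i] dD[of i] by linarith
    qed
    from this[OF that(1)] this[OF that(2)] show ?thesis
      using par[of "V i" n "V j"] V[of i] V[of j] Cmono[of n i] Cmono[of n j] that by (auto simp: subset_iff)
  qed
  have small: "(\<lambda>n. 4 * (D - d n) + 4 * (1 / real (Suc n))) \<longlonglongrightarrow> 4 * (D - D) + 4 * 0"
    by (intro tendsto_intros D inv)
  have VL: "V n \<in> L2_on M" for n using CL V by blast
  obtain g where g: "g \<in> L2_on M" and Vg: "(\<lambda>n. L2_norm_on M (\<lambda>t. V n t - g t)) \<longlonglongrightarrow> 0"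
  proof (rule L2_on_complete[OF VL])
    fix e :: real assume e: "0 < e"
    then have "\<forall>\<^sub>F n in sequentially. 4 * (D - d n) + 4 * (1 / real (Suc n)) < e\<^sup>2"
      using order_tendstoD(2)[OF small, of "e\<^sup>2"] by simp
    then obtain N where N: "4 * (D - d N) + 4 * (1 / real (Suc N)) < e\<^sup>2"
      by (auto simp: eventually_sequentially)
    show "\<exists>N. \<forall>i\<ge>N. \<forall>j\<ge>N. L2_norm_on M (\<lambda>t. V i t - V j t) < e"
    proof (intro exI[of _ N] allI impI)
      fix i j assume "N \<le> i" "N \<le> j"
      then have "(L2_norm_on M (\<lambda>t. V i t - V j t))\<^sup>2 < e\<^sup>2" using VV N by (meson order.strict_trans1)
      then show "L2_norm_on M (\<lambda>t. V i t - V j t) < e" using e by (simp add: power2_less_imp_less)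
    qed
  qed
  have Vn: "(\<lambda>n. L2_norm_on M (V n)) \<longlonglongrightarrow> L2_norm_on M g"
  proof (rule LIM_zero_cancel, rule tendsto_rabs_zero_cancel, rule tendsto_sandwich[OF _ _ tendsto_const Vg])
    show "\<forall>\<^sub>F n in sequentially. \<bar>L2_norm_on M (V n) - L2_norm_on M g\<bar> \<le> L2_norm_on M (\<lambda>t. V n t - g t)"
      using L2_norm_on_triangle_diff[OF VL g] by auto
  qed auto
  have "(\<lambda>n. (L2_norm_on M (V n))\<^sup>2) \<longlonglongrightarrow> D"
  proof (rule tendsto_sandwich[OF _ _ D])
    have "(\<lambda>n. d n + 1 / real (Suc n)) \<longlonglongrightarrow> D + 0" by (intro tendsto_intros D inv)
    then show "(\<lambda>n. d n + 1 / real (Suc n)) \<longlonglongrightarrow> D" by simp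
    show "\<forall>\<^sub>F n in sequentially. d n \<le> (L2_norm_on M (V n))\<^sup>2" using d_le[OF V] by auto
    show "\<forall>\<^sub>F n in sequentially. (L2_norm_on M (V n))\<^sup>2 \<le> d n + 1 / real (Suc n)"
      using Vd by (intro always_eventually allI less_imp_le)
  qed
  moreover have "(\<lambda>n. (L2_norm_on M (V n))\<^sup>2) \<longlonglongrightarrow> (L2_norm_on M g)\<^sup>2"
    by (intro tendsto_intros Vn)
  ultimately have gD: "(L2_norm_on M g)\<^sup>2 = D" by (metis LIMSEQ_unique)
  show ?thesis
  proof (rule that[OF _ g Vg])
    show "V n \<in> midpoint_hull (G ` {n..})" for n using V by (simp add: C_def)
    show "(L2_norm_on M g)\<^sup>2 \<le> m" using gD Dm by simp
    show "m \<le> (L2_norm_on M g)\<^sup>2 \<longrightarrow> (\<lambda>n. L2_norm_on M (\<lambda>t. G n t - g t)) \<longlonglongrightarrow> 0"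
    proof
      assume "m \<le> (L2_norm_on M g)\<^sup>2"
      then have mD: "m = D" using gD Dm by simp
      \<comment> \<open>This is the bound \<open>2 * D + 2 * (d n + 1 / Suc n) - 4 * d n\<close>
        that \<open>par\<close> gives for \<open>G n\<close> and \<open>V n\<close>, since here the
        squared norm of \<open>G n\<close> is at most \<open>m = D\<close>.\<close>
      have "(\<lambda>n. 4 * D + 2 * (1 / real (Suc n)) - 2 * d n - 2 * D) \<longlonglongrightarrow> 4 * D + 2 * 0 - 2 * D - 2 * D"
        by (intro tendsto_intros D inv)
      then have lim0: "(\<lambda>n. 4 * D + 2 * (1 / real (Suc n)) - 2 * d n - 2 * D) \<longlonglongrightarrow> 0" by simp
      have "(\<lambda>n. (L2_norm_on M (\<lambda>t. G n t - V n t))\<^sup>2) \<longlonglongrightarrow> 0"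
      proof (rule tendsto_sandwich[OF _ _ tendsto_const lim0])
        have "(L2_norm_on M (\<lambda>t. G n t - V n t))\<^sup>2 \<le> 4 * D + 2 * (1 / real (Suc n)) - 2 * d n - 2 * D" for n
          using par[OF GC V, of n] bound[of n] Vd[of n] unfolding mD by linarith
        then show "\<forall>\<^sub>F n in sequentially. (L2_norm_on M (\<lambda>t. G n t - V n t))\<^sup>2
            \<le> 4 * D + 2 * (1 / real (Suc n)) - 2 * d n - 2 * D" by simp
      qed auto
      then have GV: "(\<lambda>n. L2_norm_on M (\<lambda>t. G n t - V n t)) \<longlonglongrightarrow> 0"
        by simp
      have sum0: "(\<lambda>n. L2_norm_on M (\<lambda>t. G n t - V n t) + L2_norm_on M (\<lambda>t. V n t - g t)) \<longlonglongrightarrow> 0"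
        using tendsto_add[OF GV Vg] by simp
      show "(\<lambda>n. L2_norm_on M (\<lambda>t. G n t - g t)) \<longlonglongrightarrow> 0"
      proof (rule tendsto_sandwich[OF _ _ tendsto_const sum0])
        have "L2_norm_on M (\<lambda>t. G n t - g t) \<le> L2_norm_on M (\<lambda>t. G n t - V n t) + L2_norm_on M (\<lambda>t. V n t - g t)" for n
          using L2_norm_on_triangle[OF L2_on_diff[OF G[of n] VL[of n]] L2_on_diff[OF VL[of n] g]] by simp
        then show "\<forall>\<^sub>F n in sequentially. L2_norm_on M (\<lambda>t. G n t - g t)
            \<le> L2_norm_on M (\<lambda>t. G n t - V n t) + L2_norm_on M (\<lambda>t. V n t - g t)" by simp
      qed auto
    qed
  qed
qed

section \<open>Integrals over an initial segment\<close>

text \<open>Completeness of \<open>lebesgue\<close> carries measurability across equality almost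
  everywhere. If neither function is measurable, neither is integrable and both integrals take the
  default value 0.\<close>

lemma lebesgue_cong_AE:
  fixes f g :: "'a::euclidean_space \<Rightarrow> 'b::euclidean_space"
  assumes "AE x in lebesgue. f x = g x"
  shows "integrable lebesgue f \<longleftrightarrow> integrable lebesgue g"
    and "integral\<^sup>L lebesgue f = integral\<^sup>L lebesgue g"
proof -
  have sym: "AE x in lebesgue. g x = f x" using assms by eventually_elim auto
  have meas: "f \<in> borel_measurable lebesgue \<longleftrightarrow> g \<in> borel_measurable lebesgue"
    using borel_measurable_AE assms sym by blast
  show 1: "integrable lebesgue f \<longleftrightarrow> integrable lebesgue g"
  proof (cases "f \<in> borel_measurable lebesgue")
    case True
    with meas assms show ?thesis by (intro integrable_cong_AE) auto
  next
    case False
    with meas show ?thesis using borel_measurable_integrable by blast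
  qed
  show "integral\<^sup>L lebesgue f = integral\<^sup>L lebesgue g"
  proof (cases "f \<in> borel_measurable lebesgue")
    case True
    with meas assms show ?thesis by (intro integral_cong_AE) auto
  next
    case False
    with 1 show ?thesis
      using borel_measurable_integrable not_integrable_integral_eq by metis
  qed
qed

text \<open>\<open>solves\<close> integrates over closed intervals \<open>{0..t}\<close>, the
  Sobolev norms over the open interval \<open>{0<..<T}\<close>. The endpoints are null, so every
  integral over \<open>{0..t}\<close> becomes an integral over one fixed measure with an
  indicator.\<close>

lemma initial_segment:
  fixes f :: "real \<Rightarrow> 'b::euclidean_space"
  assumes "t \<le> T"
  shows "integrable (lebesgue_on {0..t}) f \<longleftrightarrow> integrable (lebesgue_on {0<..<T}) (\<lambda>s. indicator {..t} s *\<^sub>R f s)"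
    and "integral\<^sup>L (lebesgue_on {0..t}) f = (LINT s|lebesgue_on {0<..<T}. indicator {..t} s *\<^sub>R f s)"
proof -
  have "AE s in lebesgue. s \<noteq> 0 \<and> s \<noteq> t"
    by (intro AE_conjI AE_completion AE_lborel_singleton)
  then have AE: "AE s in lebesgue. indicator {0..t} s *\<^sub>R f s = indicator {0<..<T} s *\<^sub>R indicator {..t} s *\<^sub>R f s"
    by eventually_elim (use assms in \<open>auto simp: indicator_def\<close>)
  show "integrable (lebesgue_on {0..t}) f \<longleftrightarrow> integrable (lebesgue_on {0<..<T}) (\<lambda>s. indicator {..t} s *\<^sub>R f s)"
    using lebesgue_cong_AE(1)[OF AE] by (simp add: integrable_restrict_space)
  show "integral\<^sup>L (lebesgue_on {0..t}) f = (LINT s|lebesgue_on {0<..<T}. indicator {..t} s *\<^sub>R f s)"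
    using lebesgue_cong_AE(2)[OF AE] by (simp add: integral_restrict_space)
qed

abbreviation open_interval_measure :: "real \<Rightarrow> real measure" ("\<mu>\<^bsub>_\<^esub>") where
  "\<mu>\<^bsub>T\<^esub> \<equiv> lebesgue_on {0<..<T}"

text \<open>Keeping the measure fixed and moving only the indicator lets all times \<open>t\<close>
  share the same L^2 space; for \<open>t \<ge> T\<close> the value is the full integral.\<close>

definition primitive :: "real \<Rightarrow> (real \<Rightarrow> 'a::euclidean_space) \<Rightarrow> real \<Rightarrow> 'a" where
  "primitive T g t = (LINT s|\<mu>\<^bsub>T\<^esub>. indicator {..t} s *\<^sub>R g s)"

lemma finite_open_interval_measure: "finite_measure \<mu>\<^bsub>T\<^esub>"
  by (rule finite_measure_lebesgue_on) simp

lemma indicator_measurable_open_interval [measurable]: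
  "A \<in> sets borel \<Longrightarrow> indicator A \<in> borel_measurable \<mu>\<^bsub>T\<^esub>"
  by (intro measurable_restrict_space1 borel_measurable_indicator) auto

lemma integrable_indicator_scaleR:
  fixes g :: "real \<Rightarrow> 'a::euclidean_space"
  assumes "integrable \<mu>\<^bsub>T\<^esub> g" "A \<in> sets borel"
  shows "integrable \<mu>\<^bsub>T\<^esub> (\<lambda>s. indicator A s *\<^sub>R g s)"
proof (rule Bochner_Integration.integrable_bound[OF assms(1)])
  have [measurable]: "g \<in> borel_measurable \<mu>\<^bsub>T\<^esub>" using assms by auto
  have [measurable]: "(indicator A :: real \<Rightarrow> real) \<in> borel_measurable \<mu>\<^bsub>T\<^esub>" using assms by measurable
  show "(\<lambda>s. indicator A s *\<^sub>R g s) \<in> borel_measurable \<mu>\<^bsub>T\<^esub>" by measurable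
qed (auto simp: indicator_def intro!: always_eventually)

lemma continuous_imp_measurable_open_interval:
  fixes x :: "real \<Rightarrow> 'a::euclidean_space"
  assumes "continuous_on {0..T} x"
  shows "x \<in> borel_measurable \<mu>\<^bsub>T\<^esub>"
  by (rule continuous_imp_measurable_on_sets_lebesgue[OF continuous_on_subset[OF assms]]) auto

lemma continuous_on_norm_bounded:
  fixes x :: "real \<Rightarrow> 'a::euclidean_space"
  assumes "continuous_on {0..T} x"
  obtains B where "0 \<le> B" "\<And>t. t \<in> {0..T} \<Longrightarrow> norm (x t) \<le> B"
proof -
  have "bounded (x ` {0..T})"
    by (intro compact_imp_bounded compact_continuous_image assms) auto
  then obtain B where "\<forall>t\<in>{0..T}. norm (x t) \<le> B" by (auto simp: bounded_iff)
  then show ?thesis by (intro that[of "max 0 B"]) (auto simp: le_max_iff_disj)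
qed

lemma L2_on_bounded_mult:
  fixes u :: "real \<Rightarrow> 'a::euclidean_space" and w :: "real \<Rightarrow> 'b::euclidean_space"
  assumes "w \<in> borel_measurable \<mu>\<^bsub>T\<^esub>" "u \<in> L2_on \<mu>\<^bsub>T\<^esub>" "\<And>t. t \<in> {0<..<T} \<Longrightarrow> norm (w t) \<le> c * norm (u t)"
  shows "w \<in> L2_on \<mu>\<^bsub>T\<^esub>" "0 \<le> c \<Longrightarrow> L2_norm_on \<mu>\<^bsub>T\<^esub> w \<le> c * L2_norm_on \<mu>\<^bsub>T\<^esub> u"
proof -
  have le: "(norm (w t))\<^sup>2 \<le> c\<^sup>2 * (norm (u t))\<^sup>2" if "t \<in> {0<..<T}" for t
    using power_mono[OF assms(3)[OF that] norm_ge_zero, of 2] by (simp add: power_mult_distrib)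
  have int: "integrable \<mu>\<^bsub>T\<^esub> (\<lambda>t. c\<^sup>2 * (norm (u t))\<^sup>2)" using L2_onD(2)[OF assms(2)] by simp
  have "integrable \<mu>\<^bsub>T\<^esub> (\<lambda>t. (norm (w t))\<^sup>2)"
    by (rule Bochner_Integration.integrable_bound[OF int]) (use assms(1) le in \<open>auto intro!: AE_I2\<close>)
  then show w: "w \<in> L2_on \<mu>\<^bsub>T\<^esub>" using assms(1) by (simp add: L2_on_def)
  assume c: "0 \<le> c"
  have "(L2_norm_on \<mu>\<^bsub>T\<^esub> w)\<^sup>2 \<le> (c * L2_norm_on \<mu>\<^bsub>T\<^esub> u)\<^sup>2"
    unfolding L2_norm_on_square power_mult_distrib
    using integral_mono_AE[OF L2_onD(2)[OF w] int AE_I2] le by simp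
  then show "L2_norm_on \<mu>\<^bsub>T\<^esub> w \<le> c * L2_norm_on \<mu>\<^bsub>T\<^esub> u"
    by (rule power2_le_imp_le) (use c in simp)
qed

lemma L2_on_bounded:
  fixes w :: "real \<Rightarrow> 'b::euclidean_space"
  assumes "w \<in> borel_measurable \<mu>\<^bsub>T\<^esub>" "0 \<le> T" "0 \<le> c" "\<And>t. t \<in> {0<..<T} \<Longrightarrow> norm (w t) \<le> c"
  shows "w \<in> L2_on \<mu>\<^bsub>T\<^esub>" "L2_norm_on \<mu>\<^bsub>T\<^esub> w \<le> c * sqrt T"
proof -
  interpret finite_measure "\<mu>\<^bsub>T\<^esub>" by (rule finite_open_interval_measure)
  have 1: "(\<lambda>_. 1::real) \<in> L2_on \<mu>\<^bsub>T\<^esub>" by (auto simp: L2_on_def)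
  have "L2_norm_on \<mu>\<^bsub>T\<^esub> (\<lambda>_. 1::real) = sqrt T"
    using assms(2) by (simp add: L2_norm_on_def measure_restrict_space)
  then show "w \<in> L2_on \<mu>\<^bsub>T\<^esub>" "L2_norm_on \<mu>\<^bsub>T\<^esub> w \<le> c * sqrt T"
    using L2_on_bounded_mult[OF assms(1) 1, of c] assms by auto
qed

lemma continuous_imp_L2:
  fixes x :: "real \<Rightarrow> 'a::euclidean_space"
  assumes "continuous_on {0..T} x" "0 \<le> T"
  shows "x \<in> L2_on \<mu>\<^bsub>T\<^esub>"
proof -
  obtain B where "0 \<le> B" "\<And>t. t \<in> {0..T} \<Longrightarrow> norm (x t) \<le> B"
    using continuous_on_norm_bounded[OF assms(1)] by blast
  then show ?thesis
    by (intro L2_on_bounded(1)[of _ _ B] continuous_imp_measurable_open_interval assms) auto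
qed

lemma L2_on_indicator:
  fixes u :: "real \<Rightarrow> 'a::euclidean_space"
  assumes "u \<in> L2_on \<mu>\<^bsub>T\<^esub>" "A \<in> sets borel"
  shows "(\<lambda>s. indicator A s *\<^sub>R u s) \<in> L2_on \<mu>\<^bsub>T\<^esub>"
proof (rule L2_on_bounded_mult(1)[OF _ assms(1), of _ 1])
  have [measurable]: "u \<in> borel_measurable \<mu>\<^bsub>T\<^esub>" using assms L2_onD by auto
  have [measurable]: "(indicator A :: real \<Rightarrow> real) \<in> borel_measurable \<mu>\<^bsub>T\<^esub>" using assms by measurable
  show "(\<lambda>s. indicator A s *\<^sub>R u s) \<in> borel_measurable \<mu>\<^bsub>T\<^esub>" by measurable
qed (auto simp: indicator_def)

lemma L2_norm_on_indicator_square: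
  fixes u :: "real \<Rightarrow> 'a::euclidean_space"
  shows "(L2_norm_on \<mu>\<^bsub>T\<^esub> (\<lambda>s. indicator {..t} s *\<^sub>R u s))\<^sup>2 = primitive T (\<lambda>s. (norm (u s))\<^sup>2) t"
  unfolding L2_norm_on_square primitive_def
  by (intro Bochner_Integration.integral_cong) (auto simp: indicator_def)

lemma integrable_L2:
  fixes u :: "real \<Rightarrow> 'a::euclidean_space"
  assumes "u \<in> L2_on \<mu>\<^bsub>T\<^esub>" shows "integrable \<mu>\<^bsub>T\<^esub> u"
  by (rule integrable_norm_cancel[OF finite_measure.integrable_norm_L2(1)[OF finite_open_interval_measure assms]
        L2_onD(1)[OF assms]])

text \<open>The bridge to the gauge integral, from which continuity of primitives and the
  fundamental theorem of calculus are taken.\<close>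

lemma primitive_eq:
  fixes g :: "real \<Rightarrow> 'a::euclidean_space"
  assumes "integrable \<mu>\<^bsub>T\<^esub> g" "t \<in> {0..T}"
  shows "primitive T g t = integral {0..t} g"
proof -
  have "integrable (lebesgue_on {0..t}) g"
    using initial_segment(1)[of t T g] integrable_indicator_scaleR[OF assms(1), of "{..t}"] assms(2) by simp
  then have "integral\<^sup>L (lebesgue_on {0..t}) g = integral {0..t} g"
    by (intro lebesgue_integral_eq_integral) auto
  then show ?thesis using initial_segment(2)[of t T g] assms(2) by (simp add: primitive_def)
qed

lemma continuous_on_primitive:
  fixes g :: "real \<Rightarrow> 'a::euclidean_space"
  assumes "integrable \<mu>\<^bsub>T\<^esub> g"
  shows "continuous_on {0..T} (primitive T g)"
proof (cases "0 \<le> T")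
  case True
  have "integrable (lebesgue_on {0..T}) g"
    using initial_segment(1)[of T T g] integrable_indicator_scaleR[OF assms(1), of "{..T}"] by simp
  then have "g integrable_on {0..T}" by (rule integrable_on_lebesgue_on) auto
  then have "continuous_on {0..T} (\<lambda>t. integral {0..t} g)" by (rule indefinite_integral_continuous_1)
  then show ?thesis by (rule continuous_on_eq) (simp add: primitive_eq[OF assms])
qed auto

section \<open>Linearity and inequalities for primitives\<close>

lemma primitive_mono:
  assumes "integrable \<mu>\<^bsub>T\<^esub> f" "integrable \<mu>\<^bsub>T\<^esub> g" "\<And>s. s \<in> {0<..<T} \<Longrightarrow> s \<le> t \<Longrightarrow> f s \<le> g s"
  shows "primitive T f t \<le> (primitive T g t :: real)"
  unfolding primitive_def
  by (intro integral_mono_AE integrable_indicator_scaleR assms AE_I2) (auto simp: indicator_def assms)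

lemma primitive_norm_le:
  fixes g :: "real \<Rightarrow> 'a::euclidean_space"
  shows "norm (primitive T g t) \<le> primitive T (\<lambda>s. norm (g s)) t"
proof -
  have "norm (primitive T g t) \<le> (LINT s|\<mu>\<^bsub>T\<^esub>. norm (indicator {..t} s *\<^sub>R g s))"
    unfolding primitive_def by (rule integral_norm_bound)
  also have "\<dots> = primitive T (\<lambda>s. norm (g s)) t" by (simp add: primitive_def)
  finally show ?thesis .
qed

lemma primitive_nonneg: "(\<And>s. 0 \<le> g s) \<Longrightarrow> 0 \<le> (primitive T g t :: real)"
  unfolding primitive_def by (rule Bochner_Integration.integral_nonneg) (auto simp: indicator_def)

lemma primitive_diff:
  assumes "integrable \<mu>\<^bsub>T\<^esub> f" "integrable \<mu>\<^bsub>T\<^esub> g"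
  shows "primitive T (\<lambda>s. f s - g s) t = primitive T f t - primitive T g t"
  unfolding primitive_def scaleR_diff_right
  by (intro Bochner_Integration.integral_diff integrable_indicator_scaleR assms) auto

lemma primitive_add:
  assumes "integrable \<mu>\<^bsub>T\<^esub> f" "integrable \<mu>\<^bsub>T\<^esub> g"
  shows "primitive T (\<lambda>s. f s + g s) t = primitive T f t + primitive T g t"
  unfolding primitive_def scaleR_add_right
  by (intro Bochner_Integration.integral_add integrable_indicator_scaleR assms) auto

lemma primitive_scaleR: "primitive T (\<lambda>s. c *\<^sub>R f s) t = c *\<^sub>R primitive T f t"
  unfolding primitive_def scaleR_left_commute[of _ c] by (rule integral_scaleR_right)

lemma primitive_mult: "primitive T (\<lambda>s. c * f s :: real) t = c * primitive T f t"
  using primitive_scaleR[of T c f t] by simp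

text \<open>The indicator is attached to \<open>w\<close> alone: \<open>u\<close> contributes a
  constant and \<open>w\<close> remains under a primitive, which is the form that
  \<open>Gronwall\<close> accepts.\<close>

lemma primitive_Cauchy_Schwarz:
  fixes u :: "real \<Rightarrow> 'a::euclidean_space" and w :: "real \<Rightarrow> 'b::euclidean_space"
  assumes "u \<in> L2_on \<mu>\<^bsub>T\<^esub>" "w \<in> L2_on \<mu>\<^bsub>T\<^esub>"
  shows "(primitive T (\<lambda>s. norm (u s) * norm (w s)) t)\<^sup>2 \<le> (L2_norm_on \<mu>\<^bsub>T\<^esub> u)\<^sup>2 * primitive T (\<lambda>s. (norm (w s))\<^sup>2) t"
proof -
  have "primitive T (\<lambda>s. norm (u s) * norm (w s)) t = (LINT s|\<mu>\<^bsub>T\<^esub>. norm (u s) * norm (indicator {..t} s *\<^sub>R w s))"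
    by (simp add: primitive_def mult_ac)
  also have "\<dots> \<le> L2_norm_on \<mu>\<^bsub>T\<^esub> u * L2_norm_on \<mu>\<^bsub>T\<^esub> (\<lambda>s. indicator {..t} s *\<^sub>R w s)"
    by (intro Cauchy_Schwarz_L2 L2_on_indicator assms) auto
  finally have "(primitive T (\<lambda>s. norm (u s) * norm (w s)) t)\<^sup>2 \<le> (L2_norm_on \<mu>\<^bsub>T\<^esub> u * L2_norm_on \<mu>\<^bsub>T\<^esub> (\<lambda>s. indicator {..t} s *\<^sub>R w s))\<^sup>2"
    by (intro power_mono primitive_nonneg) auto
  then show ?thesis by (simp add: power_mult_distrib L2_norm_on_indicator_square)
qed

lemma primitive_exp_le:
  assumes "0 < c" "t \<in> {0..T}"
  shows "primitive T (\<lambda>s. exp (c * s)) t \<le> exp (c * t) / c"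
proof -
  have "primitive T (\<lambda>s. exp (c * s)) t = integral {0..t} (\<lambda>s. exp (c * s))"
    using assms by (intro primitive_eq integrable_L2 continuous_imp_L2 continuous_intros) auto
  also have "((\<lambda>s. exp (c * s)) has_integral exp (c * t) / c - exp (c * 0) / c) {0..t}"
    using assms by (intro fundamental_theorem_of_calculus)
      (auto intro!: derivative_eq_intros simp flip: has_real_derivative_iff_has_vector_derivative)
  then have "integral {0..t} (\<lambda>s. exp (c * s)) = exp (c * t) / c - exp (c * 0) / c"
    by (rule integral_unique)
  finally show ?thesis using assms by simp
qed

text \<open>The supremum of \<open>exp (- c * t) * \<delta> t\<close> is attained, and at that point the integral inequality
  bounds it by \<open>a\<close> plus half of itself.\<close>

lemma Gronwall:
  assumes cont: "continuous_on {0..T} \<delta>" and nonneg: "\<And>t. 0 \<le> \<delta> t" and "0 \<le> a" "0 \<le> A"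
    and ineq: "\<And>t. t \<in> {0..T} \<Longrightarrow> \<delta> t \<le> a + A * primitive T \<delta> t" and t: "t \<in> {0..T}"
  shows "\<delta> t \<le> 2 * a * exp ((2 * A + 1) * t)"
proof -
  \<comment> \<open>Chosen so that \<open>A / c \<le> 1 / 2\<close>, the half that is absorbed
    below; the \<open>+ 1\<close> keeps \<open>c\<close> positive when \<open>A = 0\<close>.\<close>
  define c where "c = 2 * A + 1"
  have c: "0 < c" "A / c \<le> 1 / 2" using \<open>0 \<le> A\<close> by (auto simp: c_def field_simps)
  have T: "0 \<le> T" using t by auto
  have "continuous_on {0..T} (\<lambda>t. exp (- (c * t)) * \<delta> t)" by (intro continuous_intros cont)
  then obtain t0 where t0: "t0 \<in> {0..T}"
    and max: "\<And>s. s \<in> {0..T} \<Longrightarrow> exp (- (c * s)) * \<delta> s \<le> exp (- (c * t0)) * \<delta> t0"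
    using continuous_attains_sup[of "{0..T}" "\<lambda>t. exp (- (c * t)) * \<delta> t"] T by auto
  define m where "m = exp (- (c * t0)) * \<delta> t0"
  have m: "0 \<le> m" using nonneg by (simp add: m_def)
  have le: "\<delta> s \<le> m * exp (c * s)" if "s \<in> {0..T}" for s
    using max[OF that] by (simp add: m_def exp_minus field_simps)
  have eq: "\<delta> t0 = m * exp (c * t0)" by (simp add: m_def exp_minus)
  have "primitive T \<delta> t0 \<le> primitive T (\<lambda>s. m * exp (c * s)) t0"
    using le by (intro primitive_mono integrable_L2 continuous_imp_L2 cont continuous_intros T) auto
  also have "\<dots> \<le> m * (exp (c * t0) / c)"
    unfolding primitive_mult by (intro mult_left_mono primitive_exp_le m c t0)
  finally have "A * primitive T \<delta> t0 \<le> A * (m * (exp (c * t0) / c))"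
    using \<open>0 \<le> A\<close> by (rule mult_left_mono)
  also have "\<dots> = (A / c) * (m * exp (c * t0))" by simp
  also have "\<dots> \<le> 1 / 2 * (m * exp (c * t0))" using c m by (intro mult_right_mono) auto
  finally have "m * exp (c * t0) \<le> a + 1 / 2 * (m * exp (c * t0))"
    using ineq[OF t0] eq by linarith
  then have "m * exp (c * t0) \<le> 2 * a" by simp
  moreover have "m \<le> m * exp (c * t0)" using m c t0 by (simp add: mult_le_cancel_left1)
  ultimately have "m \<le> 2 * a" by linarith
  then have "m * exp (c * t) \<le> 2 * a * exp (c * t)" by (intro mult_right_mono) auto
  then show ?thesis using le[OF t] unfolding c_def by linarith
qed

text \<open>The exponent 1/2 comes from Cauchy-Schwarz against the indicator of
  \<open>{s<..t}\<close>, whose L^2 norm is at most \<open>sqrt (t - s)\<close>.\<close>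

lemma primitive_Holder:
  fixes w :: "real \<Rightarrow> 'a::euclidean_space"
  assumes "w \<in> L2_on \<mu>\<^bsub>T\<^esub>" "s \<in> {0..T}" "t \<in> {0..T}"
  shows "norm (primitive T w t - primitive T w s) \<le> L2_norm_on \<mu>\<^bsub>T\<^esub> w * sqrt \<bar>t - s\<bar>"
  using assms(2,3)
proof (induction s t rule: linorder_wlog)
  case (le s t)
  interpret finite_measure "\<mu>\<^bsub>T\<^esub>" by (rule finite_open_interval_measure)
  let ?i = "\<lambda>r. indicator {s<..t} r :: real"
  have i: "?i \<in> L2_on \<mu>\<^bsub>T\<^esub>"
    by (rule L2_on_bounded(1)[where c = 1]) (use le in \<open>auto split: split_indicator\<close>)
  have "(LINT r|\<mu>\<^bsub>T\<^esub>. (norm (?i r))\<^sup>2) = (LINT r|\<mu>\<^bsub>T\<^esub>. ?i r)"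
    by (intro Bochner_Integration.integral_cong) (auto simp: indicator_def)
  also have "\<dots> = measure \<mu>\<^bsub>T\<^esub> ({s<..t} \<inter> {0<..<T})"
    by simp
  also have "\<dots> = measure lebesgue ({s<..t} \<inter> {0<..<T})"
    by (rule measure_restrict_space) auto
  also have "\<dots> \<le> measure lebesgue {s..t}"
    by (rule measure_mono_fmeasurable) auto
  also have "\<dots> = t - s" using le(1) by simp
  finally have n: "L2_norm_on \<mu>\<^bsub>T\<^esub> ?i \<le> sqrt (t - s)"
    unfolding L2_norm_on_def by (rule real_sqrt_le_mono)
  have "primitive T w t - primitive T w s = (LINT r|\<mu>\<^bsub>T\<^esub>. indicator {..t} r *\<^sub>R w r - indicator {..s} r *\<^sub>R w r)"
    unfolding primitive_def
    by (intro Bochner_Integration.integral_diff[symmetric] integrable_indicator_scaleR integrable_L2 assms) auto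
  also have "norm \<dots> \<le> (LINT r|\<mu>\<^bsub>T\<^esub>. norm (indicator {..t} r *\<^sub>R w r - indicator {..s} r *\<^sub>R w r))"
    by (rule integral_norm_bound)
  also have "\<dots> = (LINT r|\<mu>\<^bsub>T\<^esub>. norm (w r) * norm (?i r))"
    by (intro Bochner_Integration.integral_cong) (use le in \<open>auto simp: indicator_def\<close>)
  also have "\<dots> \<le> L2_norm_on \<mu>\<^bsub>T\<^esub> w * L2_norm_on \<mu>\<^bsub>T\<^esub> ?i"
    by (rule Cauchy_Schwarz_L2[OF assms(1) i])
  also have "\<dots> \<le> L2_norm_on \<mu>\<^bsub>T\<^esub> w * sqrt (t - s)"
    by (intro mult_left_mono n) auto
  finally show ?case using le(1) by simp
next
  case (sym s t)
  then show ?case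
    by (subst norm_minus_commute, subst abs_minus_commute)
qed

section \<open>Caratheodory equations with square-integrable parameters\<close>

lemma primitive_const_le:
  assumes "t \<in> {0..T}" "0 \<le> c"
  shows "primitive T (\<lambda>_. c) t \<le> c * T"
proof -
  have "primitive T (\<lambda>_. c) t = integral {0..t} (\<lambda>_. c)"
    using assms by (intro primitive_eq integrable_L2 continuous_imp_L2 continuous_intros) auto
  also have "\<dots> = c * t" using assms by simp
  also have "\<dots> \<le> c * T" using assms by (intro mult_left_mono) auto
  finally show ?thesis .
qed

lemma Holder_family_compact:
  fixes x :: "nat \<Rightarrow> real \<Rightarrow> 'a::euclidean_space"
  assumes bound: "\<And>n t. t \<in> {0..T} \<Longrightarrow> norm (x n t) \<le> B"
    and Holder: "\<And>n s t. s \<in> {0..T} \<Longrightarrow> t \<in> {0..T} \<Longrightarrow> norm (x n t - x n s) \<le> H * sqrt \<bar>t - s\<bar>"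
    and H: "0 \<le> H"
  obtains r y where "strict_mono (r :: nat \<Rightarrow> nat)" "continuous_on {0..T} y"
    "uniform_limit {0..T} (\<lambda>n. x (r n)) y sequentially"
proof -
  obtain y r where y: "continuous_on {0..T} y" and r: "strict_mono (r :: nat \<Rightarrow> nat)"
    and lim: "\<And>e. 0 < e \<Longrightarrow> \<exists>N. \<forall>n t. n \<ge> N \<and> t \<in> {0..T} \<longrightarrow> norm (x (r n) t - y t) < e"
  proof (rule Arzela_Ascoli[of "{0..T}" x B])
    show "\<exists>d>0. \<forall>n s. s \<in> {0..T} \<and> norm (t - s) < d \<longrightarrow> norm (x n t - x n s) < e"
      if t: "t \<in> {0..T}" and e: "0 < e" for t e
    \<comment> \<open>The square inverts the square-root modulus of continuity, and
      \<open>H + 1\<close> avoids division by zero when \<open>H = 0\<close>.\<close>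
    proof (intro exI[of _ "(e / (H + 1))\<^sup>2"] conjI allI impI)
      show "0 < (e / (H + 1))\<^sup>2" using e H by simp
      fix n s assume s: "s \<in> {0..T} \<and> norm (t - s) < (e / (H + 1))\<^sup>2"
      then have "sqrt \<bar>t - s\<bar> < e / (H + 1)"
        using e H by (intro real_less_lsqrt) auto
      then have "H * sqrt \<bar>t - s\<bar> \<le> H * (e / (H + 1))" using H by (intro mult_left_mono) auto
      also have "\<dots> < e" using e H by (simp add: field_simps)
      finally show "norm (x n t - x n s) < e"
        using Holder[of s t n] s t by (meson order.strict_trans1)
    qed
  qed (use bound in auto)
  have "uniform_limit {0..T} (\<lambda>n. x (r n)) y sequentially"
    unfolding uniform_limit_sequentially_iff dist_norm using lim by meson
  with r y show ?thesis by (rule that)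
qed

text \<open>\<open>solves\<close> rewritten on the open interval and for a general field
  \<open>f\<close>; \<open>solves_iff\<close> shows that the two agree.\<close>

definition caratheodory_solution ::
  "('p::euclidean_space \<Rightarrow> 'x::euclidean_space \<Rightarrow> 'x) \<Rightarrow> 'x \<Rightarrow> real \<Rightarrow> (real \<Rightarrow> 'p) \<Rightarrow> (real \<Rightarrow> 'x) \<Rightarrow> bool"
  where
  "caratheodory_solution f x0 T u x \<longleftrightarrow>
     integrable \<mu>\<^bsub>T\<^esub> (\<lambda>s. f (u s) (x s)) \<and> (\<forall>t\<in>{0..T}. x t = x0 + primitive T (\<lambda>s. f (u s) (x s)) t)"

text \<open>What the two neural right-hand sides have in common: the Lipschitz rate in the state is
  proportional to the size of the parameter, hence only square integrable in time, and the
  dependence on the parameter is Lipschitz with linear growth in the state. Comparison with the zero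
  parameter yields the growth bound \<open>f_growth\<close>.\<close>

locale controlled_field =
  fixes f :: "'p::euclidean_space \<Rightarrow> 'x::euclidean_space \<Rightarrow> 'x" and K :: real
  assumes K: "0 \<le> K"
    and f_zero: "f 0 x = 0"
    and f_lipschitz: "norm (f u x - f v y) \<le> K * (norm u * norm (x - y) + norm (u - v) * (1 + norm y))"
begin

lemma f_growth: "norm (f u x) \<le> K * (norm u * (1 + norm x))"
  using f_lipschitz[of u x 0 x] by (simp add: f_zero)

text \<open>Joint continuity is what makes the field measurable in time along a measurable parameter
  and a measurable state.\<close>

lemma f_continuous: "continuous_on UNIV (\<lambda>p. f (fst p) (snd p))"
  unfolding continuous_on_def
proof
  fix p :: "'p \<times> 'x"
  let ?b = "\<lambda>q. K * (norm (fst q) * norm (snd q - snd p) + norm (fst q - fst p) * (1 + norm (snd p)))"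
  have "(?b \<longlongrightarrow> K * (norm (fst p) * norm (snd p - snd p) + norm (fst p - fst p) * (1 + norm (snd p)))) (at p)"
    by (intro tendsto_intros)
  then have "(?b \<longlongrightarrow> 0) (at p)" by simp
  then have "((\<lambda>q. f (fst q) (snd q) - f (fst p) (snd p)) \<longlongrightarrow> 0) (at p)"
    by (rule Lim_null_comparison[rotated]) (use f_lipschitz in auto)
  then show "((\<lambda>q. f (fst q) (snd q)) \<longlongrightarrow> f (fst p) (snd p)) (at p within UNIV)"
    by (rule LIM_zero_cancel)
qed

lemma f_measurable:
  assumes "u \<in> borel_measurable \<mu>\<^bsub>T\<^esub>" "x \<in> borel_measurable \<mu>\<^bsub>T\<^esub>"
  shows "(\<lambda>s. f (u s) (x s)) \<in> borel_measurable \<mu>\<^bsub>T\<^esub>"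
  by (rule borel_measurable_continuous_Pair[OF assms f_continuous])

lemma f_L2:
  assumes u: "u \<in> L2_on \<mu>\<^bsub>T\<^esub>" and x: "continuous_on {0..T} x" and B: "0 \<le> B" "\<And>t. t \<in> {0..T} \<Longrightarrow> norm (x t) \<le> B"
  shows "(\<lambda>s. f (u s) (x s)) \<in> L2_on \<mu>\<^bsub>T\<^esub>"
    "L2_norm_on \<mu>\<^bsub>T\<^esub> (\<lambda>s. f (u s) (x s)) \<le> K * (1 + B) * L2_norm_on \<mu>\<^bsub>T\<^esub> u"
proof -
  have le: "norm (f (u t) (x t)) \<le> K * (1 + B) * norm (u t)" if "t \<in> {0<..<T}" for t
  proof -
    have "norm (f (u t) (x t)) \<le> K * (norm (u t) * (1 + norm (x t)))" by (rule f_growth)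
    also have "\<dots> \<le> K * (norm (u t) * (1 + B))"
      using B(2)[of t] that K by (intro mult_left_mono) auto
    finally show ?thesis by (simp add: mult_ac)
  qed
  note m = f_measurable[OF L2_onD(1)[OF u] continuous_imp_measurable_open_interval[OF x]]
  show "(\<lambda>s. f (u s) (x s)) \<in> L2_on \<mu>\<^bsub>T\<^esub>"
    by (rule L2_on_bounded_mult(1)[OF m u le])
  show "L2_norm_on \<mu>\<^bsub>T\<^esub> (\<lambda>s. f (u s) (x s)) \<le> K * (1 + B) * L2_norm_on \<mu>\<^bsub>T\<^esub> u"
    by (rule L2_on_bounded_mult(2)[OF m u le]) (use K B in auto)
qed

lemma f_integrable:
  assumes u: "u \<in> L2_on \<mu>\<^bsub>T\<^esub>" and x: "continuous_on {0..T} x"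
  shows "integrable \<mu>\<^bsub>T\<^esub> (\<lambda>s. f (u s) (x s))"
  using continuous_on_norm_bounded[OF x] f_L2(1)[OF u x] integrable_L2 by metis

lemma solution_continuous:
  assumes "caratheodory_solution f x0 T u x"
  shows "continuous_on {0..T} x"
proof -
  have "continuous_on {0..T} (\<lambda>t. x0 + primitive T (\<lambda>s. f (u s) (x s)) t)"
    using assms by (intro continuous_intros continuous_on_primitive) (auto simp: caratheodory_solution_def)
  then show ?thesis
    by (rule continuous_on_eq) (use assms in \<open>auto simp: caratheodory_solution_def\<close>)
qed

text \<open>Squaring lets Cauchy-Schwarz collect the possibly unbounded rate
  \<open>norm (u s)\<close> into its L^2 norm, which leaves an integral inequality with a constant
  coefficient. It drives uniqueness, the Picard contraction and the perturbation bound.\<close>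

lemma primitive_difference:
  assumes u: "u \<in> L2_on \<mu>\<^bsub>T\<^esub>" and x: "continuous_on {0..T} x" and y: "continuous_on {0..T} y" and T: "0 \<le> T"
  shows "(norm (primitive T (\<lambda>s. f (u s) (x s)) t - primitive T (\<lambda>s. f (u s) (y s)) t))\<^sup>2
    \<le> (K * L2_norm_on \<mu>\<^bsub>T\<^esub> u)\<^sup>2 * primitive T (\<lambda>s. (norm (x s - y s))\<^sup>2) t"
proof -
  have xy: "(\<lambda>s. x s - y s) \<in> L2_on \<mu>\<^bsub>T\<^esub>" by (intro continuous_imp_L2 continuous_intros x y T)
  have fi: "integrable \<mu>\<^bsub>T\<^esub> (\<lambda>s. f (u s) (x s))" "integrable \<mu>\<^bsub>T\<^esub> (\<lambda>s. f (u s) (y s))"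
    by (intro f_integrable u x y)+
  have "norm (primitive T (\<lambda>s. f (u s) (x s)) t - primitive T (\<lambda>s. f (u s) (y s)) t)
      = norm (primitive T (\<lambda>s. f (u s) (x s) - f (u s) (y s)) t)"
    by (simp add: primitive_diff fi)
  also have "\<dots> \<le> primitive T (\<lambda>s. norm (f (u s) (x s) - f (u s) (y s))) t"
    by (rule primitive_norm_le)
  also have "\<dots> \<le> primitive T (\<lambda>s. K * (norm (u s) * norm (x s - y s))) t"
  proof (rule primitive_mono)
    show "integrable \<mu>\<^bsub>T\<^esub> (\<lambda>s. K * (norm (u s) * norm (x s - y s)))"
      by (intro Bochner_Integration.integrable_mult_right integrable_norm_mult_L2 u xy)
    show "norm (f (u s) (x s) - f (u s) (y s)) \<le> K * (norm (u s) * norm (x s - y s))" for s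
      using f_lipschitz[of "u s" "x s" "u s" "y s"] by simp
  qed (intro integrable_norm Bochner_Integration.integrable_diff fi)
  finally have "norm (primitive T (\<lambda>s. f (u s) (x s)) t - primitive T (\<lambda>s. f (u s) (y s)) t)
      \<le> K * primitive T (\<lambda>s. norm (u s) * norm (x s - y s)) t"
    by (simp add: primitive_mult)
  then have "(norm (primitive T (\<lambda>s. f (u s) (x s)) t - primitive T (\<lambda>s. f (u s) (y s)) t))\<^sup>2
      \<le> (K * primitive T (\<lambda>s. norm (u s) * norm (x s - y s)) t)\<^sup>2"
    by (rule power_mono) simp
  also have "\<dots> \<le> K\<^sup>2 * ((L2_norm_on \<mu>\<^bsub>T\<^esub> u)\<^sup>2 * primitive T (\<lambda>s. (norm (x s - y s))\<^sup>2) t)"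
    unfolding power_mult_distrib by (intro mult_left_mono primitive_Cauchy_Schwarz u xy) auto
  finally show ?thesis by (simp add: power_mult_distrib mult_ac)
qed

lemma primitive_perturbation:
  assumes u: "u \<in> L2_on \<mu>\<^bsub>T\<^esub>" and x: "continuous_on {0..T} x" and y: "continuous_on {0..T} y"
    and t: "t \<in> {0..T}" and e: "\<And>s. s \<in> {0..T} \<Longrightarrow> norm (x s - y s) \<le> e" "0 \<le> e"
  shows "norm (primitive T (\<lambda>s. f (u s) (x s)) t - primitive T (\<lambda>s. f (u s) (y s)) t)
    \<le> K * L2_norm_on \<mu>\<^bsub>T\<^esub> u * sqrt T * e"
proof (rule power2_le_imp_le)
  have T: "0 \<le> T" using t by auto
  have "primitive T (\<lambda>s. (norm (x s - y s))\<^sup>2) t \<le> primitive T (\<lambda>s. e\<^sup>2) t"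
    by (intro primitive_mono integrable_L2 continuous_imp_L2 continuous_intros x y T power_mono e) auto
  also have "\<dots> \<le> e\<^sup>2 * T" by (rule primitive_const_le[OF t]) simp
  finally have "(K * L2_norm_on \<mu>\<^bsub>T\<^esub> u)\<^sup>2 * primitive T (\<lambda>s. (norm (x s - y s))\<^sup>2) t
      \<le> (K * L2_norm_on \<mu>\<^bsub>T\<^esub> u)\<^sup>2 * (e\<^sup>2 * T)"
    by (rule mult_left_mono) simp
  then show "(norm (primitive T (\<lambda>s. f (u s) (x s)) t - primitive T (\<lambda>s. f (u s) (y s)) t))\<^sup>2
      \<le> (K * L2_norm_on \<mu>\<^bsub>T\<^esub> u * sqrt T * e)\<^sup>2"
    using primitive_difference[OF u x y T, of t] T by (simp add: power_mult_distrib mult_ac)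
qed (use K e t in auto)

text \<open>Gronwall for the squared distance of two solutions, with initial term 0.\<close>

lemma solution_unique:
  assumes u: "u \<in> L2_on \<mu>\<^bsub>T\<^esub>" and x: "caratheodory_solution f x0 T u x" and y: "caratheodory_solution f x0 T u y"
    and t: "t \<in> {0..T}"
  shows "x t = y t"
proof -
  have T: "0 \<le> T" using t by auto
  note c = solution_continuous[OF x] solution_continuous[OF y]
  have "(norm (x t - y t))\<^sup>2 \<le> 2 * 0 * exp ((2 * (K * L2_norm_on \<mu>\<^bsub>T\<^esub> u)\<^sup>2 + 1) * t)"
  proof (rule Gronwall[OF _ _ _ _ _ t])
    show "continuous_on {0..T} (\<lambda>t. (norm (x t - y t))\<^sup>2)" by (intro continuous_intros c)
    show "(norm (x t - y t))\<^sup>2 \<le> 0 + (K * L2_norm_on \<mu>\<^bsub>T\<^esub> u)\<^sup>2 * primitive T (\<lambda>t. (norm (x t - y t))\<^sup>2) t"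
      if "t \<in> {0..T}" for t
      using primitive_difference[OF u c T, of t] x y that by (simp add: caratheodory_solution_def)
  qed auto
  then show ?thesis by simp
qed

text \<open>The root of the bound that \<open>Gronwall\<close> gives for
  \<open>(1 + norm (x t))\<^sup>2\<close> with \<open>a = 2 * (1 + norm x0)\<^sup>2\<close> and
  \<open>A = 2 * (K * m)\<^sup>2\<close>, taken at the final time. The summand 1 absorbs the affine
  growth of the field, and the factors 2 come from squaring a sum.\<close>

definition solution_bound :: "real \<Rightarrow> 'x \<Rightarrow> real \<Rightarrow> real" where
  "solution_bound m x0 T = sqrt (4 * (1 + norm x0)\<^sup>2 * exp ((4 * (K * m)\<^sup>2 + 1) * T))"

lemma solution_bounded:
  assumes u: "u \<in> L2_on \<mu>\<^bsub>T\<^esub>" and m: "L2_norm_on \<mu>\<^bsub>T\<^esub> u \<le> m" and x: "caratheodory_solution f x0 T u x"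
    and t: "t \<in> {0..T}"
  shows "norm (x t) \<le> solution_bound m x0 T"
proof -
  have T: "0 \<le> T" using t by auto
  note c = solution_continuous[OF x]
  have xL: "(\<lambda>s. 1 + norm (x s)) \<in> L2_on \<mu>\<^bsub>T\<^esub>" by (intro continuous_imp_L2 continuous_intros c T)
  have "(1 + norm (x t))\<^sup>2 \<le> 2 * (2 * (1 + norm x0)\<^sup>2) * exp ((2 * (2 * (K * m)\<^sup>2) + 1) * t)"
  proof (rule Gronwall[OF _ _ _ _ _ t])
    show "continuous_on {0..T} (\<lambda>t. (1 + norm (x t))\<^sup>2)" by (intro continuous_intros c)
    show "(1 + norm (x t))\<^sup>2 \<le> 2 * (1 + norm x0)\<^sup>2 + 2 * (K * m)\<^sup>2 * primitive T (\<lambda>t. (1 + norm (x t))\<^sup>2) t"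
      if t: "t \<in> {0..T}" for t
    proof -
      let ?p = "primitive T (\<lambda>s. norm (u s) * norm (1 + norm (x s))) t"
      have p0: "0 \<le> ?p" by (rule primitive_nonneg) auto
      have "norm (primitive T (\<lambda>s. f (u s) (x s)) t) \<le> primitive T (\<lambda>s. norm (f (u s) (x s))) t"
        by (rule primitive_norm_le)
      also have "\<dots> \<le> primitive T (\<lambda>s. K * (norm (u s) * norm (1 + norm (x s)))) t"
      proof (rule primitive_mono)
        show "integrable \<mu>\<^bsub>T\<^esub> (\<lambda>s. K * (norm (u s) * norm (1 + norm (x s))))"
          by (intro Bochner_Integration.integrable_mult_right integrable_norm_mult_L2 u xL)
        show "norm (f (u s) (x s)) \<le> K * (norm (u s) * norm (1 + norm (x s)))" for s
          using f_growth[of "u s" "x s"] by simp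
      qed (intro integrable_norm f_integrable u c)
      also have "\<dots> = K * ?p" by (rule primitive_mult)
      finally have n: "norm (primitive T (\<lambda>s. f (u s) (x s)) t) \<le> K * ?p" .
      have "x t = x0 + primitive T (\<lambda>s. f (u s) (x s)) t"
        using x t unfolding caratheodory_solution_def by blast
      then have "norm (x t) \<le> norm x0 + norm (primitive T (\<lambda>s. f (u s) (x s)) t)"
        using norm_triangle_ineq[of x0] by metis
      with n have "1 + norm (x t) \<le> (1 + norm x0) + K * ?p" by linarith
      then have "(1 + norm (x t))\<^sup>2 \<le> ((1 + norm x0) + K * ?p)\<^sup>2"
        by (rule power_mono) simp
      also have "\<dots> \<le> 2 * (1 + norm x0)\<^sup>2 + 2 * (K * ?p)\<^sup>2"
        using power2_norm_add_le[of "1 + norm x0" "K * ?p"] by simp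
      also have "(K * ?p)\<^sup>2 \<le> (K * m)\<^sup>2 * primitive T (\<lambda>t. (1 + norm (x t))\<^sup>2) t"
      proof -
        have "?p\<^sup>2 \<le> (L2_norm_on \<mu>\<^bsub>T\<^esub> u)\<^sup>2 * primitive T (\<lambda>s. (norm (1 + norm (x s)))\<^sup>2) t"
          by (rule primitive_Cauchy_Schwarz[OF u xL])
        also have "\<dots> \<le> m\<^sup>2 * primitive T (\<lambda>s. (norm (1 + norm (x s)))\<^sup>2) t"
          by (intro mult_right_mono power_mono m primitive_nonneg) auto
        finally have "K\<^sup>2 * ?p\<^sup>2 \<le> K\<^sup>2 * (m\<^sup>2 * primitive T (\<lambda>s. (norm (1 + norm (x s)))\<^sup>2) t)"
          by (rule mult_left_mono) simp
        then show ?thesis by (simp add: power_mult_distrib mult_ac)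
      qed
      finally show ?thesis by simp
    qed
  qed auto
  also have "\<dots> \<le> 4 * (1 + norm x0)\<^sup>2 * exp ((4 * (K * m)\<^sup>2 + 1) * T)"
    using t by (auto intro!: mult_left_mono)
  finally have "(1 + norm (x t))\<^sup>2 \<le> (solution_bound m x0 T)\<^sup>2" by (simp add: solution_bound_def)
  then have "1 + norm (x t) \<le> solution_bound m x0 T"
    by (rule power2_le_imp_le) (simp add: solution_bound_def)
  then show ?thesis by simp
qed

lemma solution_bound_nonneg: "0 \<le> solution_bound m x0 T"
  by (simp add: solution_bound_def)

text \<open>The state bound makes the velocity bounded in L^2 by a constant depending only on
  \<open>K\<close>, \<open>m\<close>, \<open>x0\<close> and \<open>T\<close>, so the estimate is
  uniform over a bounded family of parameters.\<close>

lemma solution_Holder: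
  assumes u: "u \<in> L2_on \<mu>\<^bsub>T\<^esub>" and m: "L2_norm_on \<mu>\<^bsub>T\<^esub> u \<le> m" and x: "caratheodory_solution f x0 T u x"
    and s: "s \<in> {0..T}" and t: "t \<in> {0..T}"
  shows "norm (x t - x s) \<le> K * (1 + solution_bound m x0 T) * m * sqrt \<bar>t - s\<bar>"
proof -
  note b = f_L2[OF u solution_continuous[OF x] solution_bound_nonneg solution_bounded[OF u m x]]
  have "norm (x t - x s) = norm (primitive T (\<lambda>s. f (u s) (x s)) t - primitive T (\<lambda>s. f (u s) (x s)) s)"
    using x s t by (simp add: caratheodory_solution_def)
  also have "\<dots> \<le> L2_norm_on \<mu>\<^bsub>T\<^esub> (\<lambda>s. f (u s) (x s)) * sqrt \<bar>t - s\<bar>"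
    by (rule primitive_Holder[OF b(1) s t])
  also have "\<dots> \<le> K * (1 + solution_bound m x0 T) * m * sqrt \<bar>t - s\<bar>"
  proof (intro mult_right_mono order_trans[OF b(2)])
    show "K * (1 + solution_bound m x0 T) * L2_norm_on \<mu>\<^bsub>T\<^esub> u \<le> K * (1 + solution_bound m x0 T) * m"
      using K solution_bound_nonneg[of m x0 T] m by (intro mult_left_mono) auto
  qed auto
  finally show ?thesis .
qed

section \<open>Existence by Picard iteration\<close>

fun picard :: "'x \<Rightarrow> real \<Rightarrow> (real \<Rightarrow> 'p) \<Rightarrow> nat \<Rightarrow> real \<Rightarrow> 'x" where
  "picard x0 T u 0 t = x0"
| "picard x0 T u (Suc n) t = x0 + primitive T (\<lambda>s. f (u s) (picard x0 T u n s)) t"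

lemma picard_continuous:
  assumes "u \<in> L2_on \<mu>\<^bsub>T\<^esub>"
  shows "continuous_on {0..T} (picard x0 T u n)"
proof (induction n)
  case (Suc n)
  show ?case
    unfolding picard.simps by (intro continuous_intros continuous_on_primitive f_integrable assms Suc)
qed simp

text \<open>With the weight \<open>exp (c * t)\<close> the squared Picard increments shrink by a factor of four.\<close>

lemma solution_exists:
  assumes u: "u \<in> L2_on \<mu>\<^bsub>T\<^esub>" and T: "0 \<le> T"
  shows "\<exists>x. caratheodory_solution f x0 T u x"
proof -
  let ?y = "picard x0 T u"
  define A where "A = (K * L2_norm_on \<mu>\<^bsub>T\<^esub> u)\<^sup>2"
  \<comment> \<open>A larger weight than in \<open>Gronwall\<close>:
    \<open>A / c \<le> 1 / 4\<close> is the contraction factor for the squares.\<close>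
  define c where "c = 4 * A + 1"
  have A: "0 \<le> A" by (simp add: A_def)
  then have c: "0 < c" "A / c \<le> 1 / 4" by (auto simp: c_def field_simps)
  note yc = picard_continuous[OF u]
  obtain B where B: "0 \<le> B" "\<And>t. t \<in> {0..T} \<Longrightarrow> norm (?y (Suc 0) t - ?y 0 t) \<le> B"
    using continuous_on_norm_bounded[OF continuous_on_diff[OF yc yc]] by blast
  have inc: "(norm (?y (Suc n) t - ?y n t))\<^sup>2 \<le> B\<^sup>2 * exp (c * t) * (1/4)^n" if "t \<in> {0..T}" for n t
    using that
  proof (induction n arbitrary: t)
    case 0
    have "(norm (?y (Suc 0) t - ?y 0 t))\<^sup>2 \<le> B\<^sup>2 * 1"
      using power_mono[OF B(2)[OF 0] norm_ge_zero, of 2] by simp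
    also have "\<dots> \<le> B\<^sup>2 * exp (c * t)" using c 0 by (intro mult_left_mono) auto
    finally show ?case by simp
  next
    case (Suc n)
    have "(norm (?y (Suc (Suc n)) t - ?y (Suc n) t))\<^sup>2 \<le> A * primitive T (\<lambda>s. (norm (?y (Suc n) s - ?y n s))\<^sup>2) t"
      using primitive_difference[OF u yc yc T, of x0 "Suc n" t x0 n] by (simp add: A_def)
    also have "\<dots> \<le> A * primitive T (\<lambda>s. (B\<^sup>2 * (1/4)^n) * exp (c * s)) t"
    proof (intro mult_left_mono A primitive_mono integrable_L2 continuous_imp_L2 continuous_intros yc T)
      show "(norm (?y (Suc n) s - ?y n s))\<^sup>2 \<le> (B\<^sup>2 * (1/4)^n) * exp (c * s)" if "s \<in> {0<..<T}" for s
        using Suc.IH[of s] that by (simp add: mult_ac)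
    qed
    also have "\<dots> = A * (B\<^sup>2 * (1/4)^n * primitive T (\<lambda>s. exp (c * s)) t)"
      by (simp only: primitive_mult)
    also have "\<dots> \<le> A * (B\<^sup>2 * (1/4)^n * (exp (c * t) / c))"
      by (intro mult_left_mono A primitive_exp_le c Suc.prems) auto
    also have "\<dots> = (A / c) * (B\<^sup>2 * exp (c * t) * (1/4)^n)" by simp
    also have "\<dots> \<le> (1/4) * (B\<^sup>2 * exp (c * t) * (1/4)^n)"
      using c by (intro mult_right_mono) auto
    finally show ?case by simp
  qed
  \<comment> \<open>Taking roots turns the factor 1/4 into 1/2; replacing \<open>t\<close> by
    \<open>T\<close> in the weight makes the majorant independent of \<open>t\<close>, as the
    Weierstrass test requires.\<close>
  define D where "D = sqrt (B\<^sup>2 * exp (c * T))"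
  have inc': "norm (?y (Suc n) t - ?y n t) \<le> D * (1/2)^n" if t: "t \<in> {0..T}" for n t
  proof (rule power2_le_imp_le)
    have "(norm (?y (Suc n) t - ?y n t))\<^sup>2 \<le> B\<^sup>2 * exp (c * t) * (1/4)^n" by (rule inc[OF t])
    also have "\<dots> \<le> B\<^sup>2 * exp (c * T) * (1/4)^n"
      using t c by (intro mult_right_mono mult_left_mono) auto
    also have "\<dots> = (D * (1/2)^n)\<^sup>2"
      by (simp add: D_def power_mult_distrib power2_eq_square[of "(1/2)^n"] flip: power_mult_distrib[of "1/2" "1/2" n])
    finally show "(norm (?y (Suc n) t - ?y n t))\<^sup>2 \<le> (D * (1/2)^n)\<^sup>2" .
  qed (simp add: D_def)
  \<comment> \<open>The telescoping series whose partial sums are the Picard iterates.\<close>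
  define x where "x t = x0 + (\<Sum>n. ?y (Suc n) t - ?y n t)" for t
  have "uniform_limit {0..T} (\<lambda>n t. \<Sum>i<n. ?y (Suc i) t - ?y i t) (\<lambda>t. \<Sum>n. ?y (Suc n) t - ?y n t) sequentially"
    by (rule Weierstrass_m_test[OF inc']) (auto intro!: summable_mult summable_geometric)
  from uniform_limit_add[OF uniform_limit_const this, of "\<lambda>_. x0"]
  have "uniform_limit {0..T} (\<lambda>n t. x0 + (\<Sum>i<n. ?y (Suc i) t - ?y i t)) x sequentially"
    by (simp add: x_def[abs_def])
  moreover have "x0 + (\<Sum>i<n. ?y (Suc i) t - ?y i t) = ?y n t" for n t
    using sum_lessThan_telescope[of "\<lambda>i. ?y i t" n] by (simp only: picard.simps) simp
  ultimately have lim: "uniform_limit {0..T} ?y x sequentially" by simp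
  have xc: "continuous_on {0..T} x"
    by (rule uniform_limit_theorem[OF _ lim]) (use yc in auto)
  have "x t = x0 + primitive T (\<lambda>s. f (u s) (x s)) t" if t: "t \<in> {0..T}" for t
  proof (rule LIMSEQ_unique)
    show "(\<lambda>n. ?y (Suc n) t) \<longlonglongrightarrow> x t"
      using tendsto_uniform_limitI[OF lim t] by (rule LIMSEQ_Suc)
    have "(\<lambda>n. primitive T (\<lambda>s. f (u s) (?y n s)) t) \<longlonglongrightarrow> primitive T (\<lambda>s. f (u s) (x s)) t"
    proof (rule LIMSEQ_I)
      fix e :: real assume "0 < e"
      let ?k = "K * L2_norm_on \<mu>\<^bsub>T\<^esub> u * sqrt T"
      have k: "0 \<le> ?k" using K T by simp
      \<comment> \<open>The denominator is \<open>?k + 1\<close> because \<open>?k\<close> may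
        vanish.\<close>
      define e' where "e' = e / (?k + 1)"
      have e': "0 < e'" "?k * e' < e" using k \<open>0 < e\<close> by (auto simp: e'_def field_simps)
      from lim e' obtain N where N: "\<And>n s. n \<ge> N \<Longrightarrow> s \<in> {0..T} \<Longrightarrow> dist (?y n s) (x s) < e'"
        unfolding uniform_limit_sequentially_iff by blast
      show "\<exists>N. \<forall>n\<ge>N. norm (primitive T (\<lambda>s. f (u s) (?y n s)) t - primitive T (\<lambda>s. f (u s) (x s)) t) < e"
      proof (intro exI[of _ N] allI impI)
        fix n assume n: "N \<le> n"
        have "norm (primitive T (\<lambda>s. f (u s) (?y n s)) t - primitive T (\<lambda>s. f (u s) (x s)) t) \<le> ?k * e'"
          by (rule primitive_perturbation[OF u yc xc t]) (use N[OF n] e' in \<open>auto simp: dist_norm intro: less_imp_le\<close>)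
        then show "norm (primitive T (\<lambda>s. f (u s) (?y n s)) t - primitive T (\<lambda>s. f (u s) (x s)) t) < e"
          using e' by linarith
      qed
    qed
    then show "(\<lambda>n. ?y (Suc n) t) \<longlonglongrightarrow> x0 + primitive T (\<lambda>s. f (u s) (x s)) t"
      unfolding picard.simps by (intro tendsto_intros)
  qed
  then show ?thesis
    using f_integrable[OF u xc] unfolding caratheodory_solution_def by blast
qed

section \<open>Compactness and limits of solutions\<close>

lemma solutions_compact:
  assumes u: "\<And>n. u n \<in> L2_on \<mu>\<^bsub>T\<^esub>" and m: "\<And>n. L2_norm_on \<mu>\<^bsub>T\<^esub> (u n) \<le> m"
    and x: "\<And>n. caratheodory_solution f x0 T (u n) (x n)"
  obtains r y where "strict_mono (r :: nat \<Rightarrow> nat)" "continuous_on {0..T} y"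
    "uniform_limit {0..T} (\<lambda>n. x (r n)) y sequentially"
proof -
  let ?H = "K * (1 + solution_bound m x0 T) * m"
  have m0: "0 \<le> m" using order_trans[OF L2_norm_on_nonneg m[of 0]] .
  have H: "0 \<le> ?H" using K m0 solution_bound_nonneg[of m x0 T] by simp
  show ?thesis
  proof (rule Holder_family_compact)
    show "norm (x n t) \<le> solution_bound m x0 T" if "t \<in> {0..T}" for n t
      by (rule solution_bounded[OF u m x that])
    show "norm (x n t - x n s) \<le> ?H * sqrt \<bar>t - s\<bar>" if "s \<in> {0..T}" "t \<in> {0..T}" for n s t
      by (rule solution_Holder[OF u m x that])
  qed (rule H, rule that)
qed

lemma limit_residual:
  assumes u: "\<And>n. u n \<in> L2_on \<mu>\<^bsub>T\<^esub>" and m: "\<And>n. L2_norm_on \<mu>\<^bsub>T\<^esub> (u n) \<le> m"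
    and x: "\<And>n. caratheodory_solution f x0 T (u n) (x n)"
    and y: "continuous_on {0..T} y" and lim: "uniform_limit {0..T} x y sequentially"
    and t: "t \<in> {0..T}"
  shows "(\<lambda>n. x0 + primitive T (\<lambda>s. f (u n s) (y s)) t) \<longlonglongrightarrow> y t"
proof -
  let ?k = "K * m * sqrt T"
  have m0: "0 \<le> m" using order_trans[OF L2_norm_on_nonneg m[of 0]] .
  have k: "0 \<le> ?k" using K m0 t by simp
  have "(\<lambda>n. x n t - (x0 + primitive T (\<lambda>s. f (u n s) (y s)) t)) \<longlonglongrightarrow> 0"
  proof (rule LIMSEQ_I)
    fix e :: real assume "0 < e"
    define e' where "e' = e / (?k + 1)"
    have e': "0 < e'" "?k * e' < e" using k \<open>0 < e\<close> by (auto simp: e'_def field_simps)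
    from lim e' obtain N where N: "\<And>n s. n \<ge> N \<Longrightarrow> s \<in> {0..T} \<Longrightarrow> dist (x n s) (y s) < e'"
      unfolding uniform_limit_sequentially_iff by blast
    show "\<exists>N. \<forall>n\<ge>N. norm (x n t - (x0 + primitive T (\<lambda>s. f (u n s) (y s)) t) - 0) < e"
    proof (intro exI[of _ N] allI impI)
      fix n assume n: "N \<le> n"
      have "norm (x n t - (x0 + primitive T (\<lambda>s. f (u n s) (y s)) t) - 0)
          = norm (primitive T (\<lambda>s. f (u n s) (x n s)) t - primitive T (\<lambda>s. f (u n s) (y s)) t)"
        using x[of n] t by (simp add: caratheodory_solution_def)
      also have "\<dots> \<le> K * L2_norm_on \<mu>\<^bsub>T\<^esub> (u n) * sqrt T * e'"
        by (rule primitive_perturbation[OF u solution_continuous[OF x] y t])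
           (use N[OF n] e' in \<open>auto simp: dist_norm intro: less_imp_le\<close>)
      also have "\<dots> \<le> ?k * e'"
        using K m t e' by (intro mult_right_mono mult_left_mono) auto
      finally show "norm (x n t - (x0 + primitive T (\<lambda>s. f (u n s) (y s)) t) - 0) < e"
        using e' by linarith
    qed
  qed
  then have "(\<lambda>n. x n t - (x n t - (x0 + primitive T (\<lambda>s. f (u n s) (y s)) t))) \<longlonglongrightarrow> y t - 0"
    by (intro tendsto_diff tendsto_uniform_limitI[OF lim t])
  then show ?thesis by (simp add: add.commute)
qed

text \<open>The Lipschitz bound in the parameter is integrated against \<open>1 + norm (y s)\<close>
  by Cauchy-Schwarz. This asks for strong convergence of the parameters but allows a field that is
  nonlinear in them, so it serves both systems.\<close>

lemma primitive_tendsto_L2: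
  assumes v: "\<And>n. v n \<in> L2_on \<mu>\<^bsub>T\<^esub>" and u: "u \<in> L2_on \<mu>\<^bsub>T\<^esub>"
    and lim: "(\<lambda>n. L2_norm_on \<mu>\<^bsub>T\<^esub> (\<lambda>t. v n t - u t)) \<longlonglongrightarrow> 0"
    and y: "continuous_on {0..T} y" and t: "t \<in> {0..T}"
  shows "(\<lambda>n. primitive T (\<lambda>s. f (v n s) (y s)) t) \<longlonglongrightarrow> primitive T (\<lambda>s. f (u s) (y s)) t"
proof (rule LIM_zero_cancel, rule Lim_null_comparison)
  have T: "0 \<le> T" using t by auto
  have yL: "(\<lambda>s. 1 + norm (y s)) \<in> L2_on \<mu>\<^bsub>T\<^esub>" by (intro continuous_imp_L2 continuous_intros y T)
  let ?b = "\<lambda>n. K * (L2_norm_on \<mu>\<^bsub>T\<^esub> (\<lambda>t. v n t - u t) * L2_norm_on \<mu>\<^bsub>T\<^esub> (\<lambda>s. 1 + norm (y s)))"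
  have "norm (primitive T (\<lambda>s. f (v n s) (y s)) t - primitive T (\<lambda>s. f (u s) (y s)) t) \<le> ?b n" for n
  proof -
    have fi: "integrable \<mu>\<^bsub>T\<^esub> (\<lambda>s. f (v n s) (y s))" "integrable \<mu>\<^bsub>T\<^esub> (\<lambda>s. f (u s) (y s))"
      by (intro f_integrable u v y)+
    have d: "(\<lambda>t. v n t - u t) \<in> L2_on \<mu>\<^bsub>T\<^esub>" by (rule L2_on_diff[OF v u])
    have "norm (primitive T (\<lambda>s. f (v n s) (y s)) t - primitive T (\<lambda>s. f (u s) (y s)) t)
        = norm (LINT s|\<mu>\<^bsub>T\<^esub>. indicator {..t} s *\<^sub>R (f (v n s) (y s) - f (u s) (y s)))"
      by (subst primitive_diff[OF fi, symmetric]) (simp only: primitive_def)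
    also have "\<dots> \<le> (LINT s|\<mu>\<^bsub>T\<^esub>. norm (indicator {..t} s *\<^sub>R (f (v n s) (y s) - f (u s) (y s))))"
      by (rule integral_norm_bound)
    also have "\<dots> \<le> (LINT s|\<mu>\<^bsub>T\<^esub>. K * (norm (v n s - u s) * norm (1 + norm (y s))))"
    proof (rule integral_mono)
      show "integrable \<mu>\<^bsub>T\<^esub> (\<lambda>s. norm (indicator {..t} s *\<^sub>R (f (v n s) (y s) - f (u s) (y s))))"
        by (intro integrable_norm integrable_indicator_scaleR Bochner_Integration.integrable_diff fi) auto
      show "integrable \<mu>\<^bsub>T\<^esub> (\<lambda>s. K * (norm (v n s - u s) * norm (1 + norm (y s))))"
        by (intro Bochner_Integration.integrable_mult_right integrable_norm_mult_L2 d yL)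
      show "norm (indicator {..t} s *\<^sub>R (f (v n s) (y s) - f (u s) (y s))) \<le> K * (norm (v n s - u s) * norm (1 + norm (y s)))" for s
        using f_lipschitz[of "v n s" "y s" "u s" "y s"] K by (auto simp: indicator_def)
    qed
    also have "\<dots> \<le> ?b n"
      using mult_left_mono[OF Cauchy_Schwarz_L2[OF d yL] K] by simp
    finally show ?thesis .
  qed
  then show "\<forall>\<^sub>F n in sequentially. norm (primitive T (\<lambda>s. f (v n s) (y s)) t - primitive T (\<lambda>s. f (u s) (y s)) t) \<le> ?b n"
    by simp
  have "?b \<longlonglongrightarrow> K * (0 * L2_norm_on \<mu>\<^bsub>T\<^esub> (\<lambda>s. 1 + norm (y s)))"
    by (intro tendsto_intros lim)
  then show "?b \<longlonglongrightarrow> 0" by simp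
qed

end

section \<open>Weak derivatives\<close>

lemma test_functionD:
  assumes "\<phi> \<in> test_functions T"
  shows "(\<phi> has_real_derivative deriv \<phi> t) (at t)" "continuous_on A (deriv \<phi>)" "continuous_on A \<phi>"
    "t \<notin> {0<..<T} \<Longrightarrow> \<phi> t = 0"
proof -
  have C1: "\<phi> C1_differentiable_on UNIV" and supp: "closure {t. \<phi> t \<noteq> 0} \<subseteq> {0<..<T}"
    using assms by (auto simp: test_functions_def)
  have d: "\<phi> differentiable at t" for t using C1 by (simp add: C1_differentiable_on_eq)
  then show der: "(\<phi> has_real_derivative deriv \<phi> t) (at t)" for t
    using DERIV_deriv_iff_real_differentiable by blast
  have "continuous_on UNIV (deriv \<phi>)"
    using C1 unfolding C1_differentiable_on_eq by (simp add: field_derivative_eq_vector_derivative[abs_def])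
  then show "continuous_on A (deriv \<phi>)" by (rule continuous_on_subset) simp
  show "continuous_on A \<phi>"
    using DERIV_continuous[OF der] by (simp add: continuous_at_imp_continuous_on)
  show "t \<notin> {0<..<T} \<Longrightarrow> \<phi> t = 0"
    using supp closure_subset[of "{t. \<phi> t \<noteq> 0}"] by blast
qed

lemma test_functionI:
  assumes "\<And>t. (\<phi> has_real_derivative \<phi>' t) (at t)" "continuous_on UNIV \<phi>'"
    and "0 < a" "b < T" "\<And>t. t \<notin> {a..b} \<Longrightarrow> \<phi> t = 0"
  shows "\<phi> \<in> test_functions T" "deriv \<phi> = \<phi>'"
proof -
  have "\<phi> C1_differentiable_on UNIV"
    unfolding C1_differentiable_on_def
    using assms(1,2) by (auto simp: has_real_derivative_iff_has_vector_derivative)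
  moreover have "closure {t. \<phi> t \<noteq> 0} \<subseteq> {a..b}"
    by (rule closure_minimal) (use assms(5) in \<open>blast, simp\<close>)
  ultimately show "\<phi> \<in> test_functions T"
    using assms(3,4) by (fastforce simp: test_functions_def)
  show "deriv \<phi> = \<phi>'" using DERIV_imp_deriv[OF assms(1)] by auto
qed

lemma test_function_support:
  assumes "\<phi> \<in> test_functions T"
  obtains a b where "0 < a" "b < T" "\<And>t. t \<notin> {a..b} \<Longrightarrow> \<phi> t = 0"
proof (cases "{t. \<phi> t \<noteq> 0} = {}")
  case True
  \<comment> \<open>With empty support every pair with \<open>0 < a\<close> and \<open>b < T\<close>
    will do.\<close>
  then show ?thesis by (intro that[of 1 "T - 1"]) auto
next
  case False
  let ?S = "closure {t. \<phi> t \<noteq> 0}"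
  have S: "?S \<subseteq> {0<..<T}" using assms by (simp add: test_functions_def)
  have "bounded ?S" by (rule bounded_subset[of "{0..T}"]) (use S in auto)
  then have c: "compact ?S" by (simp add: compact_eq_bounded_closed)
  have ne: "?S \<noteq> {}" using False by simp
  obtain a where a: "a \<in> ?S" "\<And>t. t \<in> ?S \<Longrightarrow> a \<le> t" using compact_attains_inf[OF c ne] by auto
  obtain b where b: "b \<in> ?S" "\<And>t. t \<in> ?S \<Longrightarrow> t \<le> b" using compact_attains_sup[OF c ne] by auto
  show ?thesis
    by (rule that[of a b]) (use S a b closure_subset[of "{t. \<phi> t \<noteq> 0}"] in auto)
qed

text \<open>Test functions only have to be C^1, so the truncated square can replace the usual
  exponential bump as building block of the cutoffs.\<close>

definition positive_square :: "real \<Rightarrow> real" where "positive_square s = (max 0 s)\<^sup>2"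

lemma positive_square_derivative:
  "(positive_square has_real_derivative 2 * max 0 s) (at s)"
proof (cases s "0 :: real" rule: linorder_cases)
  case less
  have "(positive_square has_real_derivative 0) (at s)"
    by (rule has_field_derivative_transform_within_open[where f = "\<lambda>_. 0" and S = "{..<0}"])
       (use less in \<open>auto simp: positive_square_def\<close>)
  with less show ?thesis by simp
next
  case equal
  have "((\<lambda>h. (positive_square (0 + h) - positive_square 0) / h) \<longlongrightarrow> 0) (at 0)"
  proof (rule Lim_null_comparison)
    show "\<forall>\<^sub>F h in at 0. norm ((positive_square (0 + h) - positive_square 0) / h) \<le> \<bar>h\<bar>"
      by (auto simp: eventually_at_filter positive_square_def max_def power2_eq_square)
    show "((\<lambda>h::real. \<bar>h\<bar>) \<longlongrightarrow> 0) (at 0)" by (rule tendsto_eq_intros | simp)+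
  qed
  then have "(positive_square has_real_derivative 0) (at 0)" by (simp add: DERIV_def)
  with equal show ?thesis by simp
next
  case greater
  have "((\<lambda>s. s\<^sup>2) has_real_derivative 2 * s) (at s)" by (auto intro!: derivative_eq_intros)
  then have "(positive_square has_real_derivative 2 * s) (at s)"
    by (rule has_field_derivative_transform_within_open[of _ _ _ "{0<..}"])
       (use greater in \<open>auto simp: positive_square_def\<close>)
  with greater show ?thesis by simp
qed

text \<open>On \<open>{0..1}\<close> this is \<open>1 - (1 - s\<^sup>2)\<^sup>2\<close>: a C^1 step
  that is exactly 0 for \<open>s \<le> 0\<close> and exactly 1 for \<open>s \<ge> 1\<close>.\<close>

definition smooth_step :: "real \<Rightarrow> real" where
  "smooth_step s = 1 - positive_square (1 - positive_square s)"

lemma smooth_step_derivative: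
  "(smooth_step has_real_derivative 4 * max 0 (1 - positive_square s) * max 0 s) (at s)"
proof -
  have "((\<lambda>s. 1 - positive_square (1 - positive_square s)) has_real_derivative
      0 - (2 * max 0 (1 - positive_square s)) * (0 - 2 * max 0 s)) (at s)"
    by (intro DERIV_diff DERIV_const DERIV_chain2[OF positive_square_derivative] positive_square_derivative)
  then show ?thesis by (simp add: smooth_step_def[abs_def] mult_ac)
qed

lemma smooth_step_values:
  "s \<le> 0 \<Longrightarrow> smooth_step s = 0" "1 \<le> s \<Longrightarrow> smooth_step s = 1" "0 \<le> smooth_step s" "smooth_step s \<le> 1"
proof -
  show "s \<le> 0 \<Longrightarrow> smooth_step s = 0" by (simp add: smooth_step_def positive_square_def)
  show "smooth_step s = 1" if "1 \<le> s"
  proof -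
    have "1 \<le> s\<^sup>2" using that by (simp add: one_le_power)
    with that show ?thesis by (simp add: smooth_step_def positive_square_def)
  qed
  show "smooth_step s \<le> 1" by (simp add: smooth_step_def positive_square_def)
  have "(max 0 (1 - (max 0 s)\<^sup>2))\<^sup>2 \<le> 1\<^sup>2" by (intro power_mono) auto
  then show "0 \<le> smooth_step s" by (simp add: smooth_step_def positive_square_def)
qed

text \<open>The value is nonzero only where \<open>real n * ((t - a) * (b - t)) > 1\<close>. The
  shift by 1 thereby keeps the closed support away from \<open>a\<close> and \<open>b\<close>, while
  the factor \<open>n\<close> drives the value to 1 at every interior point.\<close>

definition cutoff :: "real \<Rightarrow> real \<Rightarrow> nat \<Rightarrow> real \<Rightarrow> real" where
  "cutoff a b n t = smooth_step (real n * ((t - a) * (b - t)) - 1)"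

lemma cutoff_test_function:
  assumes ab: "0 \<le> a" "a < b" "b \<le> T"
  shows "cutoff a b n \<in> test_functions T"
proof -
  let ?g = "\<lambda>t. real n * ((t - a) * (b - t)) - 1"
  let ?d = "\<lambda>t. 4 * max 0 (1 - positive_square (?g t)) * max 0 (?g t) * (real n * (b - t - (t - a)))"
  have der: "(cutoff a b n has_real_derivative ?d t) (at t)" for t
  proof -
    have "(?g has_real_derivative real n * (b - t - (t - a))) (at t)"
      by (auto intro!: derivative_eq_intros simp: algebra_simps)
    from DERIV_chain2[OF smooth_step_derivative this] show ?thesis
      by (simp add: cutoff_def[abs_def])
  qed
  have cont: "continuous_on UNIV ?d" unfolding positive_square_def by (intro continuous_intros)
  have "closure {t. cutoff a b n t \<noteq> 0} \<subseteq> {t. 1 \<le> real n * ((t - a) * (b - t))}"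
  proof (rule closure_minimal)
    show "{t. cutoff a b n t \<noteq> 0} \<subseteq> {t. 1 \<le> real n * ((t - a) * (b - t))}"
    proof (rule subsetI, rule ccontr)
      fix t assume "t \<in> {t. cutoff a b n t \<noteq> 0}" "t \<notin> {t. 1 \<le> real n * ((t - a) * (b - t))}"
      then show False using smooth_step_values(1)[of "real n * ((t - a) * (b - t)) - 1"] by (simp add: cutoff_def)
    qed
    show "closed {t. 1 \<le> real n * ((t - a) * (b - t))}" by (intro closed_Collect_le continuous_intros)
  qed
  also have "\<dots> \<subseteq> {a<..<b}"
  proof
    fix t assume "t \<in> {t. 1 \<le> real n * ((t - a) * (b - t))}"
    then have "0 < real n * ((t - a) * (b - t))" by auto
    then have "0 < (t - a) * (b - t)" by (simp add: zero_less_mult_iff)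
    then show "t \<in> {a<..<b}" using ab by (auto simp: zero_less_mult_iff)
  qed
  also have "\<dots> \<subseteq> {0<..<T}" using ab by auto
  finally have "closure {t. cutoff a b n t \<noteq> 0} \<subseteq> {0<..<T}" .
  moreover have "cutoff a b n C1_differentiable_on UNIV"
    unfolding C1_differentiable_on_def
    by (rule exI[of _ ?d]) (use der cont in \<open>simp only: has_real_derivative_iff_has_vector_derivative, blast\<close>)
  ultimately show ?thesis by (simp add: test_functions_def)
qed

lemma cutoff_bounds: "0 \<le> cutoff a b n t" "cutoff a b n t \<le> 1"
  by (simp_all add: cutoff_def smooth_step_values)

lemma cutoff_tendsto:
  assumes "a < b"
  shows "(\<lambda>n. cutoff a b n t) \<longlonglongrightarrow> indicator {a<..<b} t"
proof (cases "t \<in> {a<..<b}")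
  case True
  then have p: "0 < (t - a) * (b - t)" by simp
  \<comment> \<open>The 2 is needed because the argument of the step is shifted by 1 and has to
    reach 1 itself.\<close>
  obtain N where N: "2 < real N * ((t - a) * (b - t))"
    using reals_Archimedean3[OF p] by blast
  have "cutoff a b n t = 1" if "N \<le> n" for n
  proof -
    have "real N * ((t - a) * (b - t)) \<le> real n * ((t - a) * (b - t))"
      using that p by (intro mult_right_mono) auto
    with N show ?thesis by (simp add: cutoff_def smooth_step_values)
  qed
  then show ?thesis using True
    by (intro tendsto_eventually) (auto simp: eventually_sequentially)
next
  case False
  then have "(t - a) * (b - t) \<le> 0" using assms by (auto simp: mult_le_0_iff not_less)
  then have "real n * ((t - a) * (b - t)) \<le> 0" for n by (simp add: mult_nonneg_nonpos)
  then have "real n * ((t - a) * (b - t)) - 1 \<le> 0" for n by (meson diff_le_0_iff_le order_trans zero_le_one)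
  then have "cutoff a b n t = 0" for n unfolding cutoff_def by (rule smooth_step_values(1))
  with False show ?thesis by simp
qed

section \<open>Fundamental lemma of the calculus of variations\<close>

lemma integrable_bounded_scaleR:
  fixes g :: "real \<Rightarrow> 'a::euclidean_space" and \<psi> :: "real \<Rightarrow> real"
  assumes g: "integrable \<mu>\<^bsub>T\<^esub> g" and \<psi>: "\<psi> \<in> borel_measurable \<mu>\<^bsub>T\<^esub>"
    and B: "\<And>t. t \<in> {0<..<T} \<Longrightarrow> \<bar>\<psi> t\<bar> \<le> B"
  shows "integrable \<mu>\<^bsub>T\<^esub> (\<lambda>t. \<psi> t *\<^sub>R g t)"
proof (rule Bochner_Integration.integrable_bound)
  show "integrable \<mu>\<^bsub>T\<^esub> (\<lambda>t. B * norm (g t))" using g by simp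
  have [measurable]: "g \<in> borel_measurable \<mu>\<^bsub>T\<^esub>" "\<psi> \<in> borel_measurable \<mu>\<^bsub>T\<^esub>" using g \<psi> by auto
  show "(\<lambda>t. \<psi> t *\<^sub>R g t) \<in> borel_measurable \<mu>\<^bsub>T\<^esub>" by measurable
  have "norm (\<psi> t *\<^sub>R g t) \<le> norm (B * norm (g t))" if t: "t \<in> {0<..<T}" for t
    using mult_right_mono[OF order_trans[OF B[OF t] abs_ge_self] norm_ge_zero, of "g t"]
    by (simp add: abs_mult)
  then show "AE t in \<mu>\<^bsub>T\<^esub>. norm (\<psi> t *\<^sub>R g t) \<le> norm (B * norm (g t))" by (auto intro: AE_I2)
qed

lemma integrable_continuous_scaleR:
  fixes g :: "real \<Rightarrow> 'a::euclidean_space" and \<psi> :: "real \<Rightarrow> real"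
  assumes g: "integrable \<mu>\<^bsub>T\<^esub> g" and \<psi>: "continuous_on {0..T} \<psi>"
  shows "integrable \<mu>\<^bsub>T\<^esub> (\<lambda>t. \<psi> t *\<^sub>R g t)"
proof -
  obtain B where "\<And>t. t \<in> {0..T} \<Longrightarrow> norm (\<psi> t) \<le> B" using continuous_on_norm_bounded[OF \<psi>] by blast
  then show ?thesis
    by (intro integrable_bounded_scaleR[OF g continuous_imp_measurable_open_interval[OF \<psi>], of B]) auto
qed

lemma integral_continuous_scaleR_tendsto:
  fixes u :: "nat \<Rightarrow> real \<Rightarrow> 'a::euclidean_space" and \<psi> :: "real \<Rightarrow> real"
  assumes T: "0 \<le> T" and \<psi>: "continuous_on {0..T} \<psi>" and u: "\<And>n. u n \<in> L2_on \<mu>\<^bsub>T\<^esub>" and v: "v \<in> L2_on \<mu>\<^bsub>T\<^esub>"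
    and lim: "(\<lambda>n. L2_norm_on \<mu>\<^bsub>T\<^esub> (\<lambda>t. u n t - v t)) \<longlonglongrightarrow> 0"
  shows "(\<lambda>n. LINT t|\<mu>\<^bsub>T\<^esub>. \<psi> t *\<^sub>R u n t) \<longlonglongrightarrow> (LINT t|\<mu>\<^bsub>T\<^esub>. \<psi> t *\<^sub>R v t)"
proof (rule LIM_zero_cancel, rule Lim_null_comparison)
  have \<psi>L: "\<psi> \<in> L2_on \<mu>\<^bsub>T\<^esub>" by (intro continuous_imp_L2 \<psi> T)
  have "norm ((LINT t|\<mu>\<^bsub>T\<^esub>. \<psi> t *\<^sub>R u n t) - (LINT t|\<mu>\<^bsub>T\<^esub>. \<psi> t *\<^sub>R v t))
      \<le> L2_norm_on \<mu>\<^bsub>T\<^esub> \<psi> * L2_norm_on \<mu>\<^bsub>T\<^esub> (\<lambda>t. u n t - v t)" for n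
  proof -
    have "(LINT t|\<mu>\<^bsub>T\<^esub>. \<psi> t *\<^sub>R u n t) - (LINT t|\<mu>\<^bsub>T\<^esub>. \<psi> t *\<^sub>R v t) = (LINT t|\<mu>\<^bsub>T\<^esub>. \<psi> t *\<^sub>R (u n t - v t))"
      unfolding scaleR_diff_right
      by (intro Bochner_Integration.integral_diff[symmetric] integrable_continuous_scaleR integrable_L2 u v \<psi>)
    also have "norm \<dots> \<le> (LINT t|\<mu>\<^bsub>T\<^esub>. norm (\<psi> t *\<^sub>R (u n t - v t)))" by (rule integral_norm_bound)
    also have "\<dots> = (LINT t|\<mu>\<^bsub>T\<^esub>. norm (\<psi> t) * norm (u n t - v t))" by simp
    also have "\<dots> \<le> L2_norm_on \<mu>\<^bsub>T\<^esub> \<psi> * L2_norm_on \<mu>\<^bsub>T\<^esub> (\<lambda>t. u n t - v t)"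
      by (rule Cauchy_Schwarz_L2[OF \<psi>L L2_on_diff[OF u v]])
    finally show ?thesis .
  qed
  then show "\<forall>\<^sub>F n in sequentially. norm ((LINT t|\<mu>\<^bsub>T\<^esub>. \<psi> t *\<^sub>R u n t) - (LINT t|\<mu>\<^bsub>T\<^esub>. \<psi> t *\<^sub>R v t))
      \<le> L2_norm_on \<mu>\<^bsub>T\<^esub> \<psi> * L2_norm_on \<mu>\<^bsub>T\<^esub> (\<lambda>t. u n t - v t)" by simp
  show "(\<lambda>n. L2_norm_on \<mu>\<^bsub>T\<^esub> \<psi> * L2_norm_on \<mu>\<^bsub>T\<^esub> (\<lambda>t. u n t - v t)) \<longlonglongrightarrow> 0"
    using tendsto_mult[OF tendsto_const lim] by simp
qed

lemma cutoff_integral_tendsto: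
  fixes g :: "real \<Rightarrow> 'a::euclidean_space"
  assumes g: "integrable \<mu>\<^bsub>T\<^esub> g" and ab: "0 \<le> a" "a < b" "b \<le> T"
  shows "(\<lambda>n. LINT t|\<mu>\<^bsub>T\<^esub>. cutoff a b n t *\<^sub>R g t) \<longlonglongrightarrow> (LINT t|\<mu>\<^bsub>T\<^esub>. indicator {a<..<b} t *\<^sub>R g t)"
proof (rule integral_dominated_convergence[where w = "\<lambda>t. norm (g t)"])
  show "(\<lambda>t. indicator {a<..<b} t *\<^sub>R g t) \<in> borel_measurable \<mu>\<^bsub>T\<^esub>"
    by (rule borel_measurable_integrable[OF integrable_indicator_scaleR[OF g]]) simp
  show "(\<lambda>t. cutoff a b n t *\<^sub>R g t) \<in> borel_measurable \<mu>\<^bsub>T\<^esub>" for n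
    by (rule borel_measurable_integrable[OF integrable_continuous_scaleR[OF g
          test_functionD(3)[OF cutoff_test_function[OF ab]]]])
  show "AE t in \<mu>\<^bsub>T\<^esub>. (\<lambda>n. cutoff a b n t *\<^sub>R g t) \<longlonglongrightarrow> indicator {a<..<b} t *\<^sub>R g t"
    using ab by (intro AE_I2 tendsto_intros cutoff_tendsto)
  show "AE t in \<mu>\<^bsub>T\<^esub>. norm (cutoff a b n t *\<^sub>R g t) \<le> norm (g t)" for n
    using cutoff_bounds[of a b n] by (auto intro!: AE_I2 mult_left_le_one_le)
qed (use g in simp)

text \<open>Sets over which \<open>g\<close> integrates to zero form a Dynkin system, so
  \<open>borel_set_induct\<close> passes from intervals to Borel sets, and discarding a null set
  passes on to Lebesgue sets. Uniqueness of real densities, applied to each coordinate, then gives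
  \<open>g = 0\<close>.\<close>

lemma AE_zero_if_interval_integrals_zero:
  fixes g :: "real \<Rightarrow> 'a::euclidean_space"
  assumes g: "integrable \<mu>\<^bsub>T\<^esub> g" and T: "0 < T"
    and zero: "\<And>a b. 0 \<le> a \<Longrightarrow> a < b \<Longrightarrow> b \<le> T \<Longrightarrow> (LINT t|\<mu>\<^bsub>T\<^esub>. indicator {a<..<b} t *\<^sub>R g t) = 0"
  shows "AE t in \<mu>\<^bsub>T\<^esub>. g t = 0"
proof -
  define I where "I A = (LINT t|\<mu>\<^bsub>T\<^esub>. indicator A t *\<^sub>R g t)" for A :: "real set"
  have int: "integrable \<mu>\<^bsub>T\<^esub> (\<lambda>t. indicator A t *\<^sub>R g t)" if "A \<in> sets borel" for A
    by (rule integrable_indicator_scaleR[OF g that])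
  have gm[measurable]: "g \<in> borel_measurable \<mu>\<^bsub>T\<^esub>" using g by auto
  have total: "I UNIV = 0"
  proof -
    have "I UNIV = I {0<..<T}"
      unfolding I_def by (rule Bochner_Integration.integral_cong) auto
    then show ?thesis using zero[of 0 T] T by (simp add: I_def)
  qed
  have borel: "I A = 0" if "A \<in> sets borel" for A
    using that
  proof (induction rule: borel_set_induct)
    case (interval c d)
    have "AE t in lebesgue. t \<noteq> c \<and> t \<noteq> d"
      by (intro AE_conjI AE_completion AE_lborel_singleton)
    then have "AE t in \<mu>\<^bsub>T\<^esub>. t \<noteq> c \<and> t \<noteq> d" by (subst AE_restrict_space_iff) (auto elim: eventually_mono)
    \<comment> \<open>The induction supplies closed intervals of the whole line; up to two null
      points they agree on \<open>{0<..<T}\<close> with the clipped open interval.\<close>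
    then have "AE t in \<mu>\<^bsub>T\<^esub>. indicator {c..d} t *\<^sub>R g t = indicator {max c 0<..<min d T} t *\<^sub>R g t"
      using AE_space by eventually_elim (auto simp: indicator_def)
    then have "I {c..d} = I {max c 0<..<min d T}"
      unfolding I_def by (intro integral_cong_AE borel_measurable_integrable[OF int]) auto
    also have "\<dots> = 0"
    proof (cases "max c 0 < min d T")
      case True
      then show ?thesis unfolding I_def by (intro zero) auto
    next
      case False
      then have "{max c 0<..<min d T} = {}" by (simp only: greaterThanLessThan_empty not_less)
      then show ?thesis by (simp only: I_def) simp
    qed
    finally show ?case .
  next
    case (compl A)
    have "I (- A) = (LINT t|\<mu>\<^bsub>T\<^esub>. indicator UNIV t *\<^sub>R g t - indicator A t *\<^sub>R g t)"
      unfolding I_def by (rule Bochner_Integration.integral_cong) (auto simp: indicator_def)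
    also have "\<dots> = I UNIV - I A"
      unfolding I_def by (intro Bochner_Integration.integral_diff int compl) auto
    finally show ?case using compl total by simp
  next
    case (union A)
    have "(\<lambda>n. LINT t|\<mu>\<^bsub>T\<^esub>. indicator (\<Union>i<n. A i) t *\<^sub>R g t) \<longlonglongrightarrow> I (\<Union>i. A i)"
      unfolding I_def
    proof (rule integral_dominated_convergence[where w = "\<lambda>t. norm (g t)"])
      show "AE t in \<mu>\<^bsub>T\<^esub>. (\<lambda>n. indicator (\<Union>i<n. A i) t *\<^sub>R g t) \<longlonglongrightarrow> indicator (\<Union>i. A i) t *\<^sub>R g t"
        by (intro AE_I2 tendsto_intros LIMSEQ_indicator_UN)
      show "(\<lambda>t. indicator (\<Union>i. A i) t *\<^sub>R g t) \<in> borel_measurable \<mu>\<^bsub>T\<^esub>"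
        "(\<lambda>t. indicator (\<Union>i<n. A i) t *\<^sub>R g t) \<in> borel_measurable \<mu>\<^bsub>T\<^esub>" for n
        using union by (intro borel_measurable_integrable[OF int]; auto)+
    qed (use g in \<open>auto intro!: AE_I2 simp: indicator_def\<close>)
    moreover have "(LINT t|\<mu>\<^bsub>T\<^esub>. indicator (\<Union>i<n. A i) t *\<^sub>R g t) = 0" for n
    proof -
      have "(LINT t|\<mu>\<^bsub>T\<^esub>. indicator (\<Union>i<n. A i) t *\<^sub>R g t) = (LINT t|\<mu>\<^bsub>T\<^esub>. (\<Sum>i<n. indicator (A i) t *\<^sub>R g t))"
        using union(1) by (subst indicator_UN_disjoint)
          (auto simp: scaleR_sum_left intro: disjoint_family_on_mono)
      also have "\<dots> = (\<Sum>i<n. I (A i))"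
        unfolding I_def by (intro Bochner_Integration.integral_sum int union)
      finally show ?thesis using union by simp
    qed
    ultimately show ?case by (simp add: LIMSEQ_const_iff)
  qed (simp add: I_def)
  have all: "(LINT t|\<mu>\<^bsub>T\<^esub>. indicator A t *\<^sub>R g t) = 0" if A: "A \<in> sets \<mu>\<^bsub>T\<^esub>" for A
  proof -
    have "A \<in> sets lebesgue" using A by (auto simp: sets_restrict_space)
    then obtain S N N' where A': "A = S \<union> N" "N \<subseteq> N'" "N' \<in> null_sets lborel" "S \<in> sets lborel"
      by (rule sets_completionE)
    have "AE t in lebesgue. t \<notin> N'" using A'(3) by (intro AE_completion AE_not_in)
    then have AE: "AE t in \<mu>\<^bsub>T\<^esub>. indicator A t *\<^sub>R g t = indicator S t *\<^sub>R g t"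
      by (subst AE_restrict_space_iff) (use A' in \<open>auto elim!: eventually_mono simp: indicator_def\<close>)
    have "(LINT t|\<mu>\<^bsub>T\<^esub>. indicator A t *\<^sub>R g t) = I S"
      unfolding I_def
    proof (rule integral_cong_AE[OF _ _ AE])
      show "(\<lambda>t. indicator A t *\<^sub>R g t) \<in> borel_measurable \<mu>\<^bsub>T\<^esub>"
        using A by measurable
      show "(\<lambda>t. indicator S t *\<^sub>R g t) \<in> borel_measurable \<mu>\<^bsub>T\<^esub>"
        using A' by (intro borel_measurable_integrable[OF int]) auto
    qed
    then show ?thesis using borel A' by simp
  qed
  have "AE t in \<mu>\<^bsub>T\<^esub>. g t \<bullet> i = 0" for i
  proof (rule density_unique_real)
    fix A assume A: "A \<in> sets \<mu>\<^bsub>T\<^esub>"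
    have "integrable \<mu>\<^bsub>T\<^esub> (\<lambda>t. indicator A t *\<^sub>R g t)"
      using A g by (rule integrable_mult_indicator)
    then have "(LINT t|\<mu>\<^bsub>T\<^esub>. (indicator A t *\<^sub>R g t) \<bullet> i) = 0"
      by (subst integral_inner_left) (auto simp: all[OF A])
    then show "(LINT t:A|\<mu>\<^bsub>T\<^esub>. g t \<bullet> i) = (LINT t:A|\<mu>\<^bsub>T\<^esub>. 0)"
      by (simp add: set_lebesgue_integral_def)
  qed (use g in auto)
  then have "AE t in \<mu>\<^bsub>T\<^esub>. \<forall>i\<in>Basis. g t \<bullet> i = 0"
    by (intro AE_finite_allI) auto
  then show ?thesis by eventually_elim (auto intro: euclidean_eqI)
qed

lemma fundamental_lemma:
  fixes g :: "real \<Rightarrow> 'a::euclidean_space"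
  assumes g: "integrable \<mu>\<^bsub>T\<^esub> g" and T: "0 < T"
    and zero: "\<And>\<phi>. \<phi> \<in> test_functions T \<Longrightarrow> (LINT t|\<mu>\<^bsub>T\<^esub>. \<phi> t *\<^sub>R g t) = 0"
  shows "AE t in \<mu>\<^bsub>T\<^esub>. g t = 0"
proof (rule AE_zero_if_interval_integrals_zero[OF g T])
  fix a b :: real assume ab: "0 \<le> a" "a < b" "b \<le> T"
  show "(LINT t|\<mu>\<^bsub>T\<^esub>. indicator {a<..<b} t *\<^sub>R g t) = 0"
    using cutoff_integral_tendsto[OF g ab] zero[OF cutoff_test_function[OF ab]]
    by (simp add: LIMSEQ_const_iff)
qed

lemma primitive_at_end: "primitive T g T = (LINT t|\<mu>\<^bsub>T\<^esub>. g t)"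
  unfolding primitive_def by (rule Bochner_Integration.integral_cong) auto

text \<open>A test function with vanishing integral is the derivative of a test function.
  Subtracting from \<open>\<psi>\<close> a multiple of a fixed \<open>\<eta>\<close> with positive
  integral achieves this, and the hypothesis then says that \<open>f - c\<close> is orthogonal to
  every \<open>\<psi>\<close>, with \<open>c\<close> the \<open>\<eta>\<close>-weighted mean of
  \<open>f\<close>.\<close>

lemma du_Bois_Reymond:
  fixes f :: "real \<Rightarrow> 'a::euclidean_space"
  assumes f: "integrable \<mu>\<^bsub>T\<^esub> f" and T: "0 < T"
    and zero: "\<And>\<phi>. \<phi> \<in> test_functions T \<Longrightarrow> (LINT t|\<mu>\<^bsub>T\<^esub>. deriv \<phi> t *\<^sub>R f t) = 0"
  shows "\<exists>c. AE t in \<mu>\<^bsub>T\<^esub>. f t = c"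
proof -
  have T0: "0 \<le> T" using T by simp
  have int_test: "integrable \<mu>\<^bsub>T\<^esub> (\<lambda>t. \<phi> t *\<^sub>R g t)"
    if "integrable \<mu>\<^bsub>T\<^esub> g" "\<phi> \<in> test_functions T" for \<phi> and g :: "real \<Rightarrow> 'b::euclidean_space"
    by (rule integrable_continuous_scaleR[OF that(1) test_functionD(3)[OF that(2)]])
  have one: "integrable \<mu>\<^bsub>T\<^esub> (\<lambda>_. 1::real)"
    by (rule finite_measure.integrable_const[OF finite_open_interval_measure])
  have "(LINT t|\<mu>\<^bsub>T\<^esub>. indicator {0<..<T} t *\<^sub>R (1::real)) = T"
    using T by (simp add: measure_restrict_space)
  with cutoff_integral_tendsto[OF one order_refl T order_refl]
  have "(\<lambda>n. LINT t|\<mu>\<^bsub>T\<^esub>. cutoff 0 T n t *\<^sub>R (1::real)) \<longlonglongrightarrow> T" by simp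
  from order_tendstoD(1)[OF this T] obtain n where n: "0 < (LINT t|\<mu>\<^bsub>T\<^esub>. cutoff 0 T n t)"
    by (auto simp: eventually_sequentially)
  define \<eta> where "\<eta> = cutoff 0 T n"
  have \<eta>: "\<eta> \<in> test_functions T" unfolding \<eta>_def by (rule cutoff_test_function) (use T in auto)
  define s where "s = (LINT t|\<mu>\<^bsub>T\<^esub>. \<eta> t)"
  have s: "0 < s" using n by (simp add: s_def \<eta>_def)
  define c where "c = (LINT t|\<mu>\<^bsub>T\<^esub>. \<eta> t *\<^sub>R f t) /\<^sub>R s"
  have "AE t in \<mu>\<^bsub>T\<^esub>. f t - c = 0"
  proof (rule fundamental_lemma[OF _ T])
    show "integrable \<mu>\<^bsub>T\<^esub> (\<lambda>t. f t - c)"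
      by (intro Bochner_Integration.integrable_diff f finite_measure.integrable_const[OF finite_open_interval_measure])
    fix \<psi> assume \<psi>: "\<psi> \<in> test_functions T"
    \<comment> \<open>The multiple of \<open>\<eta>\<close> that makes \<open>\<theta>\<close>
      integrate to zero.\<close>
    define q where "q = (LINT t|\<mu>\<^bsub>T\<^esub>. \<psi> t) / s"
    define \<theta> where "\<theta> t = \<psi> t - q * \<eta> t" for t
    have \<theta>c: "continuous_on A \<theta>" for A
      unfolding \<theta>_def by (intro continuous_intros test_functionD(3)[OF \<psi>] test_functionD(3)[OF \<eta>])
    obtain a1 b1 where 1: "0 < a1" "b1 < T" "\<And>t. t \<notin> {a1..b1} \<Longrightarrow> \<psi> t = 0" using test_function_support[OF \<psi>] by blast
    obtain a2 b2 where 2: "0 < a2" "b2 < T" "\<And>t. t \<notin> {a2..b2} \<Longrightarrow> \<eta> t = 0" using test_function_support[OF \<eta>] by blast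
    define a where "a = min a1 a2"
    define b where "b = max b1 b2"
    have ab: "0 < a" "b < T" using 1 2 by (auto simp: a_def b_def)
    have \<theta>0: "\<theta> t = 0" if "t \<notin> {a..b}" for t
    proof -
      have "t \<notin> {a1..b1}" "t \<notin> {a2..b2}" using that by (auto simp: a_def b_def)
      then show ?thesis using 1(3) 2(3) by (simp add: \<theta>_def)
    qed
    have "\<exists>F. \<forall>x :: real. -\<infinity> < ereal x \<longrightarrow> ereal x < \<infinity> \<longrightarrow> (F has_vector_derivative \<theta> x) (at x)"
      by (rule einterval_antiderivative) (use \<theta>c[of UNIV] in \<open>auto simp: continuous_on_eq_continuous_at\<close>)
    then obtain F where F: "\<And>x. (F has_real_derivative \<theta> x) (at x)"
      by (auto simp: has_real_derivative_iff_has_vector_derivative)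
    define \<phi> where "\<phi> t = F t - F 0" for t
    have \<phi>': "(\<phi> has_real_derivative \<theta> t) (at t)" for t
      unfolding \<phi>_def using DERIV_diff[OF F DERIV_const] by simp
    have "F T - F 0 = integral {0..T} \<theta>"
    proof -
      have "(\<theta> has_integral F T - F 0) {0..T}"
        by (rule fundamental_theorem_of_calculus[OF T0])
           (use F in \<open>auto simp: has_real_derivative_iff_has_vector_derivative intro: has_vector_derivative_at_within\<close>)
      then show ?thesis by (simp add: integral_unique)
    qed
    also have "\<dots> = primitive T \<theta> T"
      using T0 by (intro primitive_eq[symmetric] integrable_L2 continuous_imp_L2 \<theta>c) auto
    also have "\<dots> = (LINT t|\<mu>\<^bsub>T\<^esub>. \<psi> t - q * \<eta> t)" unfolding primitive_at_end \<theta>_def ..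
    also have "\<dots> = (LINT t|\<mu>\<^bsub>T\<^esub>. \<psi> t) - q * s"
      using int_test[OF one \<psi>] int_test[OF one \<eta>] by (simp add: s_def)
    also have "\<dots> = 0" using s by (simp add: q_def)
    finally have FT: "F T = F 0" by simp
    \<comment> \<open>\<open>F\<close> is constant to the left of \<open>a\<close> and to the right
      of \<open>b\<close>; \<open>FT\<close> makes the two constants equal, so \<open>\<phi>\<close>
      vanishes on both sides.\<close>
    have const: "F x = F y" if "x \<in> S" "y \<in> S" "convex S" "S \<inter> {a..b} = {}" for x y S
    proof -
      have "\<exists>k. \<forall>x\<in>S. F x = k"
        by (rule has_field_derivative_zero_constant[OF that(3)])
           (use F \<theta>0 that(4) in \<open>metis (no_types) disjoint_iff has_field_derivative_at_within\<close>)
      with that show ?thesis by auto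
    qed
    have "\<phi> t = 0" if "t \<notin> {a..b}" for t
    proof (cases "t < a")
      case True
      then have "F t = F 0" by (intro const[of _ "{..<a}"]) (use ab in auto)
      then show ?thesis by (simp add: \<phi>_def)
    next
      case False
      with that have "F t = F T" by (intro const[of _ "{b<..}"]) (use ab in auto)
      then show ?thesis by (simp add: \<phi>_def FT)
    qed
    then have \<phi>: "\<phi> \<in> test_functions T" "deriv \<phi> = \<theta>"
      using test_functionI[OF \<phi>' \<theta>c ab] by auto
    have "0 = (LINT t|\<mu>\<^bsub>T\<^esub>. \<psi> t *\<^sub>R f t - q *\<^sub>R \<eta> t *\<^sub>R f t)"
      using zero[OF \<phi>(1)] by (simp add: \<phi>(2) \<theta>_def scaleR_diff_left)
    also have "\<dots> = (LINT t|\<mu>\<^bsub>T\<^esub>. \<psi> t *\<^sub>R f t) - q *\<^sub>R (LINT t|\<mu>\<^bsub>T\<^esub>. \<eta> t *\<^sub>R f t)"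
      using int_test[OF f \<psi>] int_test[OF f \<eta>]
      by (subst Bochner_Integration.integral_diff) (simp_all del: scaleR_scaleR)
    also have "q *\<^sub>R (LINT t|\<mu>\<^bsub>T\<^esub>. \<eta> t *\<^sub>R f t) = (LINT t|\<mu>\<^bsub>T\<^esub>. \<psi> t) *\<^sub>R c"
      by (simp add: q_def c_def divide_inverse)
    also have "\<dots> = (LINT t|\<mu>\<^bsub>T\<^esub>. \<psi> t *\<^sub>R c)"
      using int_test[OF one \<psi>] by simp
    also have "(LINT t|\<mu>\<^bsub>T\<^esub>. \<psi> t *\<^sub>R f t) - \<dots> = (LINT t|\<mu>\<^bsub>T\<^esub>. \<psi> t *\<^sub>R f t - \<psi> t *\<^sub>R c)"
      using int_test[OF f \<psi>] int_test[OF finite_measure.integrable_const[OF finite_open_interval_measure] \<psi>, of c]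
      by simp
    finally show "(LINT t|\<mu>\<^bsub>T\<^esub>. \<psi> t *\<^sub>R (f t - c)) = 0" by (simp add: scaleR_diff_right)
  qed
  then have "AE t in \<mu>\<^bsub>T\<^esub>. f t = c" by eventually_elim simp
  then show ?thesis ..
qed

section \<open>Calculus of weak derivatives\<close>

lemma has_weak_derivativeD:
  assumes "has_weak_derivative T u v" "\<phi> \<in> test_functions T"
  shows "(LINT t|\<mu>\<^bsub>T\<^esub>. deriv \<phi> t *\<^sub>R u t) = - (LINT t|\<mu>\<^bsub>T\<^esub>. \<phi> t *\<^sub>R v t)"
  using assms by (simp add: has_weak_derivative_def)

lemma integrable_test_scaleR:
  fixes u :: "real \<Rightarrow> 'a::euclidean_space"
  assumes "\<phi> \<in> test_functions T" "integrable \<mu>\<^bsub>T\<^esub> u"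
  shows "integrable \<mu>\<^bsub>T\<^esub> (\<lambda>t. \<phi> t *\<^sub>R u t)" "integrable \<mu>\<^bsub>T\<^esub> (\<lambda>t. deriv \<phi> t *\<^sub>R u t)"
  by (intro integrable_continuous_scaleR assms test_functionD(2,3)[OF assms(1)])+

lemma has_weak_derivative_add:
  fixes u v u' v' :: "real \<Rightarrow> 'a::euclidean_space"
  assumes "integrable \<mu>\<^bsub>T\<^esub> u" "integrable \<mu>\<^bsub>T\<^esub> u'" "integrable \<mu>\<^bsub>T\<^esub> v" "integrable \<mu>\<^bsub>T\<^esub> v'"
    and "has_weak_derivative T u u'" "has_weak_derivative T v v'"
  shows "has_weak_derivative T (\<lambda>t. u t + v t) (\<lambda>t. u' t + v' t)"
  unfolding has_weak_derivative_def
  by (simp add: scaleR_add_right integrable_test_scaleR assms(1-4) has_weak_derivativeD[OF assms(5)]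
      has_weak_derivativeD[OF assms(6)])

lemma has_weak_derivative_scaleR:
  fixes u u' :: "real \<Rightarrow> 'a::euclidean_space"
  assumes "has_weak_derivative T u u'"
  shows "has_weak_derivative T (\<lambda>t. c *\<^sub>R u t) (\<lambda>t. c *\<^sub>R u' t)"
  unfolding has_weak_derivative_def scaleR_left_commute[of _ c] integral_scaleR_right
  by (auto simp: has_weak_derivativeD[OF assms])

lemma has_weak_derivative_unique:
  fixes u v w :: "real \<Rightarrow> 'a::euclidean_space"
  assumes T: "0 < T" and v: "integrable \<mu>\<^bsub>T\<^esub> v" and w: "integrable \<mu>\<^bsub>T\<^esub> w"
    and "has_weak_derivative T u v" "has_weak_derivative T u w"
  shows "AE t in \<mu>\<^bsub>T\<^esub>. v t = w t"
proof -
  have "AE t in \<mu>\<^bsub>T\<^esub>. v t - w t = 0"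
  proof (rule fundamental_lemma[OF Bochner_Integration.integrable_diff[OF v w] T])
    fix \<phi> assume \<phi>: "\<phi> \<in> test_functions T"
    show "(LINT t|\<mu>\<^bsub>T\<^esub>. \<phi> t *\<^sub>R (v t - w t)) = 0"
      using has_weak_derivativeD[OF assms(4) \<phi>] has_weak_derivativeD[OF assms(5) \<phi>]
        integrable_test_scaleR(1)[OF \<phi> v] integrable_test_scaleR(1)[OF \<phi> w]
      by (simp add: scaleR_diff_right)
  qed
  then show ?thesis by eventually_elim simp
qed

lemma has_weak_derivative_limit:
  fixes u v :: "nat \<Rightarrow> real \<Rightarrow> 'a::euclidean_space"
  assumes T: "0 \<le> T"
    and u: "\<And>n. u n \<in> L2_on \<mu>\<^bsub>T\<^esub>" "u' \<in> L2_on \<mu>\<^bsub>T\<^esub>" "(\<lambda>n. L2_norm_on \<mu>\<^bsub>T\<^esub> (\<lambda>t. u n t - u' t)) \<longlonglongrightarrow> 0"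
    and v: "\<And>n. v n \<in> L2_on \<mu>\<^bsub>T\<^esub>" "v' \<in> L2_on \<mu>\<^bsub>T\<^esub>" "(\<lambda>n. L2_norm_on \<mu>\<^bsub>T\<^esub> (\<lambda>t. v n t - v' t)) \<longlonglongrightarrow> 0"
    and w: "\<And>n. has_weak_derivative T (u n) (v n)"
  shows "has_weak_derivative T u' v'"
  unfolding has_weak_derivative_def
proof
  fix \<phi> assume \<phi>: "\<phi> \<in> test_functions T"
  show "(LINT t|\<mu>\<^bsub>T\<^esub>. deriv \<phi> t *\<^sub>R u' t) = - (LINT t|\<mu>\<^bsub>T\<^esub>. \<phi> t *\<^sub>R v' t)"
  proof (rule LIMSEQ_unique)
    show "(\<lambda>n. LINT t|\<mu>\<^bsub>T\<^esub>. deriv \<phi> t *\<^sub>R u n t) \<longlonglongrightarrow> (LINT t|\<mu>\<^bsub>T\<^esub>. deriv \<phi> t *\<^sub>R u' t)"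
      by (rule integral_continuous_scaleR_tendsto[OF T test_functionD(2)[OF \<phi>] u])
    show "(\<lambda>n. LINT t|\<mu>\<^bsub>T\<^esub>. deriv \<phi> t *\<^sub>R u n t) \<longlonglongrightarrow> - (LINT t|\<mu>\<^bsub>T\<^esub>. \<phi> t *\<^sub>R v' t)"
      unfolding has_weak_derivativeD[OF w \<phi>]
      by (intro tendsto_minus integral_continuous_scaleR_tendsto[OF T test_functionD(3)[OF \<phi>] v])
  qed
qed

text \<open>Fubini on the triangle \<open>s \<le> t\<close>: the inner integral of
  \<open>deriv \<phi>\<close> from \<open>s\<close> to \<open>T\<close> is
  \<open>- \<phi> s\<close>, since \<open>\<phi>\<close> vanishes at \<open>T\<close>.\<close>

lemma primitive_weak_derivative:
  fixes v :: "real \<Rightarrow> 'a::euclidean_space"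
  assumes v: "integrable \<mu>\<^bsub>T\<^esub> v" and T: "0 < T"
  shows "has_weak_derivative T (primitive T v) v"
  unfolding has_weak_derivative_def
proof
  fix \<phi> assume \<phi>: "\<phi> \<in> test_functions T"
  interpret finite_measure "\<mu>\<^bsub>T\<^esub>" by (rule finite_open_interval_measure)
  interpret pair_sigma_finite "\<mu>\<^bsub>T\<^esub>" "\<mu>\<^bsub>T\<^esub>" ..
  define F where "F t s = (deriv \<phi> t * indicator {..t} s) *\<^sub>R v s" for t s
  have [measurable]: "v \<in> borel_measurable \<mu>\<^bsub>T\<^esub>" using v by simp
  have [measurable]: "deriv \<phi> \<in> borel_measurable \<mu>\<^bsub>T\<^esub>"
    by (rule continuous_imp_measurable_open_interval[OF test_functionD(2)[OF \<phi>]])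
  have [measurable]: "(\<lambda>t. t) \<in> borel_measurable \<mu>\<^bsub>T\<^esub>"
    by (rule continuous_imp_measurable_open_interval) simp
  obtain B where B: "0 \<le> B" "\<And>t. t \<in> {0..T} \<Longrightarrow> norm (deriv \<phi> t) \<le> B"
    using continuous_on_norm_bounded[OF test_functionD(2)[OF \<phi>]] by blast
  have "integrable (\<mu>\<^bsub>T\<^esub> \<Otimes>\<^sub>M \<mu>\<^bsub>T\<^esub>) (\<lambda>p. norm (v (snd p)))"
    by (rule Fubini_integrable) (use v in \<open>auto simp: integrable_norm\<close>)
  then have int: "integrable (\<mu>\<^bsub>T\<^esub> \<Otimes>\<^sub>M \<mu>\<^bsub>T\<^esub>) (\<lambda>p. B * norm (v (snd p)))" by simp
  have "integrable (\<mu>\<^bsub>T\<^esub> \<Otimes>\<^sub>M \<mu>\<^bsub>T\<^esub>) (case_prod F)"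
  proof (rule Bochner_Integration.integrable_bound[OF int])
    \<comment> \<open>Measurability becomes visible once the moving indicator is written as the
      comparison \<open>snd p \<le> fst p\<close>.\<close>
    have "case_prod F = (\<lambda>p. (if snd p \<le> fst p then deriv \<phi> (fst p) else 0) *\<^sub>R v (snd p))"
      by (auto simp: F_def fun_eq_iff indicator_def)
    also have "\<dots> \<in> borel_measurable (\<mu>\<^bsub>T\<^esub> \<Otimes>\<^sub>M \<mu>\<^bsub>T\<^esub>)" by measurable
    finally show "case_prod F \<in> borel_measurable (\<mu>\<^bsub>T\<^esub> \<Otimes>\<^sub>M \<mu>\<^bsub>T\<^esub>)" .
    have "norm (case_prod F p) \<le> B * norm (v (snd p))" if "p \<in> space (\<mu>\<^bsub>T\<^esub> \<Otimes>\<^sub>M \<mu>\<^bsub>T\<^esub>)" for p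
    proof -
      have "norm (deriv \<phi> (fst p)) \<le> B" using that B by (auto simp: space_pair_measure)
      then have "norm (deriv \<phi> (fst p)) * norm (v (snd p)) \<le> B * norm (v (snd p))"
        by (rule mult_right_mono) simp
      then show ?thesis using B(1) by (auto simp: F_def split_beta indicator_def)
    qed
    then show "AE p in \<mu>\<^bsub>T\<^esub> \<Otimes>\<^sub>M \<mu>\<^bsub>T\<^esub>. norm (case_prod F p) \<le> norm (B * norm (v (snd p)))"
      using B(1) by (intro AE_I2) (simp add: abs_mult)
  qed
  note Fubini = Fubini_integral[OF this]
  have inner: "(LINT t|\<mu>\<^bsub>T\<^esub>. deriv \<phi> t * indicator {..t} s) = - \<phi> s" if s: "s \<in> {0<..<T}" for s
  proof -
    have \<phi>'i: "integrable \<mu>\<^bsub>T\<^esub> (deriv \<phi>)"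
      by (intro integrable_L2 continuous_imp_L2 test_functionD(2)[OF \<phi>]) (use T in simp)
    have prim: "primitive T (deriv \<phi>) t = \<phi> t" if "t \<in> {0..T}" for t
    proof -
      have "(deriv \<phi> has_integral \<phi> t - \<phi> 0) {0..t}"
        using that test_functionD(1)[OF \<phi>]
        by (intro fundamental_theorem_of_calculus)
           (auto simp: has_real_derivative_iff_has_vector_derivative intro: has_vector_derivative_at_within)
      then show ?thesis
        using primitive_eq[OF \<phi>'i that] test_functionD(4)[OF \<phi>, of 0] by (simp add: integral_unique)
    qed
    have "AE t in lebesgue. t \<noteq> s" by (intro AE_completion AE_lborel_singleton)
    then have "AE t in \<mu>\<^bsub>T\<^esub>. t \<noteq> s" by (subst AE_restrict_space_iff) (auto elim: eventually_mono)
    \<comment> \<open>As a function of \<open>t\<close> the left indicator is that of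
      \<open>{s..}\<close>; it differs from the indicator of the complement of \<open>{..s}\<close>
      only at \<open>t = s\<close>.\<close>
    then have AE: "AE t in \<mu>\<^bsub>T\<^esub>. deriv \<phi> t * indicator {..t} s = deriv \<phi> t - indicator {..s} t *\<^sub>R deriv \<phi> t"
      by eventually_elim (auto simp: indicator_def)
    have "(LINT t|\<mu>\<^bsub>T\<^esub>. deriv \<phi> t * indicator {..t} s) = (LINT t|\<mu>\<^bsub>T\<^esub>. deriv \<phi> t - indicator {..s} t *\<^sub>R deriv \<phi> t)"
    proof (rule integral_cong_AE[OF _ _ AE])
      have "(\<lambda>t. deriv \<phi> t * indicator {..t} s) = (\<lambda>t. deriv \<phi> t * indicator {s..} t)"
        by (auto simp: indicator_def fun_eq_iff)
      also have "\<dots> \<in> borel_measurable \<mu>\<^bsub>T\<^esub>" by measurable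
      finally show "(\<lambda>t. deriv \<phi> t * indicator {..t} s) \<in> borel_measurable \<mu>\<^bsub>T\<^esub>" .
      show "(\<lambda>t. deriv \<phi> t - indicator {..s} t *\<^sub>R deriv \<phi> t) \<in> borel_measurable \<mu>\<^bsub>T\<^esub>"
        by measurable
    qed
    also have "\<dots> = (LINT t|\<mu>\<^bsub>T\<^esub>. deriv \<phi> t) - primitive T (deriv \<phi>) s"
      unfolding primitive_def
      by (intro Bochner_Integration.integral_diff integrable_indicator_scaleR \<phi>'i) auto
    also have "\<dots> = - \<phi> s"
      using prim[of T] prim[of s] s T test_functionD(4)[OF \<phi>, of T] by (simp flip: primitive_at_end)
    finally show ?thesis .
  qed
  have "(LINT t|\<mu>\<^bsub>T\<^esub>. deriv \<phi> t *\<^sub>R primitive T v t) = (LINT t|\<mu>\<^bsub>T\<^esub>. LINT s|\<mu>\<^bsub>T\<^esub>. F t s)"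
    by (simp add: primitive_def F_def flip: integral_scaleR_right)
  also have "\<dots> = (LINT s|\<mu>\<^bsub>T\<^esub>. LINT t|\<mu>\<^bsub>T\<^esub>. F t s)" by (rule Fubini[symmetric])
  also have "\<dots> = (LINT s|\<mu>\<^bsub>T\<^esub>. - (\<phi> s *\<^sub>R v s))"
  proof (rule Bochner_Integration.integral_cong)
    fix s assume "s \<in> space \<mu>\<^bsub>T\<^esub>"
    then have s: "s \<in> {0<..<T}" by simp
    have "integrable \<mu>\<^bsub>T\<^esub> (\<lambda>t. deriv \<phi> t * indicator {..t} s)"
    proof (rule integrable_const_bound[of _ B])
      show "AE t in \<mu>\<^bsub>T\<^esub>. norm (deriv \<phi> t * indicator {..t} s) \<le> B"
        using B by (intro AE_I2) (auto simp: indicator_def)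
      have "(\<lambda>t. deriv \<phi> t * indicator {..t} s) = (\<lambda>t. deriv \<phi> t * indicator {s..} t)"
        by (auto simp: indicator_def fun_eq_iff)
      also have "\<dots> \<in> borel_measurable \<mu>\<^bsub>T\<^esub>" by measurable
      finally show "(\<lambda>t. deriv \<phi> t * indicator {..t} s) \<in> borel_measurable \<mu>\<^bsub>T\<^esub>" .
    qed
    then have "(LINT t|\<mu>\<^bsub>T\<^esub>. F t s) = (LINT t|\<mu>\<^bsub>T\<^esub>. deriv \<phi> t * indicator {..t} s) *\<^sub>R v s"
      unfolding F_def by (intro integral_scaleR_left) auto
    then show "(LINT t|\<mu>\<^bsub>T\<^esub>. F t s) = - (\<phi> s *\<^sub>R v s)" using inner[OF s] by simp
  qed simp
  also have "\<dots> = - (LINT s|\<mu>\<^bsub>T\<^esub>. \<phi> s *\<^sub>R v s)" by simp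
  finally show "(LINT t|\<mu>\<^bsub>T\<^esub>. deriv \<phi> t *\<^sub>R primitive T v t) = - (LINT t|\<mu>\<^bsub>T\<^esub>. \<phi> t *\<^sub>R v t)" .
qed

text \<open>\<open>u - primitive T v\<close> has vanishing weak derivative and is constant by
  \<open>du_Bois_Reymond\<close>. The representative so obtained is continuous, which is what
  Arzela-Ascoli can use in \<open>H1_compact\<close>.\<close>

lemma H1_representative:
  fixes u v :: "real \<Rightarrow> 'a::euclidean_space"
  assumes u: "integrable \<mu>\<^bsub>T\<^esub> u" and v: "integrable \<mu>\<^bsub>T\<^esub> v" and T: "0 < T" and w: "has_weak_derivative T u v"
  shows "\<exists>c. AE t in \<mu>\<^bsub>T\<^esub>. u t = c + primitive T v t"
proof -
  have P: "integrable \<mu>\<^bsub>T\<^esub> (primitive T v)"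
    using T by (intro integrable_L2 continuous_imp_L2 continuous_on_primitive v) simp
  have "\<exists>c. AE t in \<mu>\<^bsub>T\<^esub>. u t - primitive T v t = c"
  proof (rule du_Bois_Reymond[OF _ T])
    show "integrable \<mu>\<^bsub>T\<^esub> (\<lambda>t. u t - primitive T v t)" using u P by simp
    fix \<phi> assume \<phi>: "\<phi> \<in> test_functions T"
    show "(LINT t|\<mu>\<^bsub>T\<^esub>. deriv \<phi> t *\<^sub>R (u t - primitive T v t)) = 0"
      using has_weak_derivativeD[OF w \<phi>] has_weak_derivativeD[OF primitive_weak_derivative[OF v T] \<phi>]
      by (simp add: scaleR_diff_right integrable_test_scaleR[OF \<phi> u] integrable_test_scaleR[OF \<phi> P])
  qed
  then obtain c where "AE t in \<mu>\<^bsub>T\<^esub>. u t - primitive T v t = c" ..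
  then have "AE t in \<mu>\<^bsub>T\<^esub>. u t = c + primitive T v t" by eventually_elim (simp add: diff_eq_eq)
  then show ?thesis ..
qed

section \<open>Compact embedding of H^1 into L^2\<close>

lemma L2_norm_on_cong_AE:
  assumes "u \<in> borel_measurable M" "v \<in> borel_measurable M" "AE t in M. u t = v t"
  shows "L2_norm_on M u = L2_norm_on M v"
  unfolding L2_norm_on_def
  by (intro arg_cong[where f = sqrt] integral_cong_AE) (use assms in \<open>auto elim: eventually_mono\<close>)

lemma L2_norm_on_const: "0 \<le> T \<Longrightarrow> L2_norm_on \<mu>\<^bsub>T\<^esub> (\<lambda>_. c) = norm c * sqrt T"
  by (simp add: L2_norm_on_def measure_restrict_space real_sqrt_mult)

lemma primitive_norm_bound:
  fixes v :: "real \<Rightarrow> 'a::euclidean_space"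
  assumes "v \<in> L2_on \<mu>\<^bsub>T\<^esub>" "L2_norm_on \<mu>\<^bsub>T\<^esub> v \<le> m" "t \<in> {0..T}"
  shows "norm (primitive T v t) \<le> m * sqrt T"
proof -
  have "primitive T v 0 = (LINT s|\<mu>\<^bsub>T\<^esub>. 0)"
    unfolding primitive_def by (rule Bochner_Integration.integral_cong) auto
  then have "norm (primitive T v t) \<le> L2_norm_on \<mu>\<^bsub>T\<^esub> v * sqrt \<bar>t - 0\<bar>"
    using primitive_Holder[OF assms(1), of 0 t] assms(3) by simp
  also have "\<dots> \<le> m * sqrt T"
    using assms order_trans[OF L2_norm_on_nonneg assms(2)] by (intro mult_mono) auto
  finally show ?thesis .
qed

text \<open>The bound on \<open>v n\<close> makes the continuous representatives uniformly Holder of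
  exponent 1/2, so a uniform bound is all that Arzela-Ascoli still requires; uniform convergence on
  a bounded interval then implies L^2 convergence.\<close>

lemma H1_compact:
  fixes u v :: "nat \<Rightarrow> real \<Rightarrow> 'a::euclidean_space"
  assumes T: "0 < T"
    and u: "\<And>n. u n \<in> L2_on \<mu>\<^bsub>T\<^esub>" "\<And>n. L2_norm_on \<mu>\<^bsub>T\<^esub> (u n) \<le> m"
    and v: "\<And>n. v n \<in> L2_on \<mu>\<^bsub>T\<^esub>" "\<And>n. L2_norm_on \<mu>\<^bsub>T\<^esub> (v n) \<le> m"
    and w: "\<And>n. has_weak_derivative T (u n) (v n)"
  obtains r y where "strict_mono (r :: nat \<Rightarrow> nat)" "y \<in> L2_on \<mu>\<^bsub>T\<^esub>"
    "(\<lambda>n. L2_norm_on \<mu>\<^bsub>T\<^esub> (\<lambda>t. u (r n) t - y t)) \<longlonglongrightarrow> 0"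
proof -
  have T0: "0 \<le> T" using T by simp
  have m: "0 \<le> m" using order_trans[OF L2_norm_on_nonneg u(2)[of 0]] .
  have "\<forall>n. \<exists>c. AE t in \<mu>\<^bsub>T\<^esub>. u n t = c + primitive T (v n) t"
    using H1_representative[OF integrable_L2[OF u(1)] integrable_L2[OF v(1)] T w] by blast
  then obtain c where c: "\<And>n. AE t in \<mu>\<^bsub>T\<^esub>. u n t = c n + primitive T (v n) t" by metis
  define x where "x n t = c n + primitive T (v n) t" for n t
  have pc: "continuous_on {0..T} (primitive T (v n))" for n
    by (intro continuous_on_primitive integrable_L2 v)
  have pL: "primitive T (v n) \<in> L2_on \<mu>\<^bsub>T\<^esub>" for n by (rule continuous_imp_L2[OF pc T0])
  have xL: "x n \<in> L2_on \<mu>\<^bsub>T\<^esub>" for n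
    unfolding x_def by (intro continuous_imp_L2 continuous_intros pc T0)
  have pb: "norm (primitive T (v n) t) \<le> m * sqrt T" if "t \<in> {0..T}" for n t
    by (rule primitive_norm_bound[OF v that])
  \<comment> \<open>The integration constant is \<open>x n t - primitive T (v n) t\<close>, and a
    constant function has L^2 norm \<open>norm c * sqrt T\<close>; the triangle inequality and
    division by \<open>sqrt T\<close> produce the bound.\<close>
  have cb: "norm (c n) \<le> (m + m * sqrt T * sqrt T) / sqrt T" for n
  proof -
    have "norm (c n) * sqrt T = L2_norm_on \<mu>\<^bsub>T\<^esub> (\<lambda>t. x n t + (-1) *\<^sub>R primitive T (v n) t)"
      using T0 by (simp add: x_def L2_norm_on_const)
    also have "\<dots> \<le> L2_norm_on \<mu>\<^bsub>T\<^esub> (x n) + L2_norm_on \<mu>\<^bsub>T\<^esub> (\<lambda>t. (-1) *\<^sub>R primitive T (v n) t)"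
      by (intro L2_norm_on_triangle xL L2_on_scaleR pL)
    also have "L2_norm_on \<mu>\<^bsub>T\<^esub> (x n) = L2_norm_on \<mu>\<^bsub>T\<^esub> (u n)"
      by (rule L2_norm_on_cong_AE[OF L2_onD(1)[OF xL] L2_onD(1)[OF u(1)]])
         (use c[of n] in \<open>auto simp: x_def elim: eventually_mono\<close>)
    also have "L2_norm_on \<mu>\<^bsub>T\<^esub> (\<lambda>t. (-1) *\<^sub>R primitive T (v n) t) = L2_norm_on \<mu>\<^bsub>T\<^esub> (primitive T (v n))"
      unfolding L2_norm_on_scaleR by simp
    also have "L2_norm_on \<mu>\<^bsub>T\<^esub> (u n) + L2_norm_on \<mu>\<^bsub>T\<^esub> (primitive T (v n)) \<le> m + m * sqrt T * sqrt T"
      by (intro add_mono u L2_on_bounded(2)[OF L2_onD(1)[OF pL] T0]) (use m T0 pb in auto)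
    finally show ?thesis using T by (simp add: pos_le_divide_eq)
  qed
  obtain r y where r: "strict_mono (r :: nat \<Rightarrow> nat)" and y: "continuous_on {0..T} y"
    and lim: "uniform_limit {0..T} (\<lambda>n. x (r n)) y sequentially"
  proof (rule Holder_family_compact)
    show "norm (x n t) \<le> (m + m * sqrt T * sqrt T) / sqrt T + m * sqrt T" if "t \<in> {0..T}" for n t
      unfolding x_def by (rule order_trans[OF norm_triangle_ineq add_mono[OF cb pb[OF that]]])
    show "norm (x n t - x n s) \<le> m * sqrt \<bar>t - s\<bar>" if "s \<in> {0..T}" "t \<in> {0..T}" for n s t
      using order_trans[OF primitive_Holder[OF v(1) that] mult_right_mono[OF v(2)]] by (simp add: x_def)
  qed (use m in auto)
  have yL: "y \<in> L2_on \<mu>\<^bsub>T\<^esub>" by (rule continuous_imp_L2[OF y T0])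
  have "(\<lambda>n. L2_norm_on \<mu>\<^bsub>T\<^esub> (\<lambda>t. u (r n) t - y t)) \<longlonglongrightarrow> 0"
  proof (rule LIMSEQ_I)
    fix e :: real assume e: "0 < e"
    define e' where "e' = e / (sqrt T + 1)"
    have e': "0 < e'" "e' * sqrt T < e"
      using e T by (auto simp: e'_def divide_less_eq add_pos_nonneg add_nonneg_pos algebra_simps)
    from lim e' obtain N where N: "\<And>n s. n \<ge> N \<Longrightarrow> s \<in> {0..T} \<Longrightarrow> dist (x (r n) s) (y s) < e'"
      unfolding uniform_limit_sequentially_iff by blast
    show "\<exists>N. \<forall>n\<ge>N. norm (L2_norm_on \<mu>\<^bsub>T\<^esub> (\<lambda>t. u (r n) t - y t) - 0) < e"
    proof (intro exI[of _ N] allI impI)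
      fix n assume n: "N \<le> n"
      have "L2_norm_on \<mu>\<^bsub>T\<^esub> (\<lambda>t. u (r n) t - y t) = L2_norm_on \<mu>\<^bsub>T\<^esub> (\<lambda>t. x (r n) t - y t)"
        by (rule L2_norm_on_cong_AE[OF L2_onD(1)[OF L2_on_diff[OF u(1) yL]] L2_onD(1)[OF L2_on_diff[OF xL yL]]])
           (use c[of "r n"] in \<open>auto simp: x_def elim: eventually_mono\<close>)
      also have "\<dots> \<le> e' * sqrt T"
        by (rule L2_on_bounded(2)[OF L2_onD(1)[OF L2_on_diff[OF xL yL]] T0])
           (use e' N[OF n] in \<open>auto simp: dist_norm intro: less_imp_le\<close>)
      finally show "norm (L2_norm_on \<mu>\<^bsub>T\<^esub> (\<lambda>t. u (r n) t - y t) - 0) < e" using e' by simp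
    qed
  qed
  with r yL show ?thesis by (rule that)
qed

section \<open>Rescaling time\<close>

lemma rescale_measurable:
  assumes "f \<in> borel_measurable \<mu>\<^bsub>1\<^esub>" "0 < T"
  shows "(\<lambda>t. f (t / T)) \<in> borel_measurable \<mu>\<^bsub>T\<^esub>"
proof -
  have "(\<lambda>t. (1 / T) *\<^sub>R t) \<in> \<mu>\<^bsub>T\<^esub> \<rightarrow>\<^sub>M \<mu>\<^bsub>1\<^esub>"
    by (rule measurable_restrict_space3[OF lebesgue_measurable_scaling]) (use assms(2) in auto)
  from measurable_compose[OF this assms(1)] show ?thesis by simp
qed

text \<open>Change of variables through \<open>lebesgue_real_scale\<close>, which writes
  \<open>lebesgue\<close> as a density over its own image under scaling. That formula concerns the
  whole line, hence the extension by zero \<open>g\<close> of the rescaled integrand.\<close>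

lemma rescale_integral:
  fixes f :: "real \<Rightarrow> 'a::euclidean_space"
  assumes f: "f \<in> borel_measurable \<mu>\<^bsub>1\<^esub>" and T: "0 < T"
  shows "integrable \<mu>\<^bsub>1\<^esub> f \<Longrightarrow> integrable \<mu>\<^bsub>T\<^esub> (\<lambda>t. f (t / T))"
    and "(LINT t|\<mu>\<^bsub>T\<^esub>. f (t / T)) = T *\<^sub>R (LINT t|\<mu>\<^bsub>1\<^esub>. f t)"
proof -
  define g where "g t = indicator {0<..<T} t *\<^sub>R f (t / T)" for t
  have gm: "g \<in> borel_measurable lebesgue"
    using rescale_measurable[OF f T] unfolding g_def
    by (subst (asm) borel_measurable_restrict_space_iff) auto
  have sc: "(\<lambda>t. T * t) \<in> lebesgue \<rightarrow>\<^sub>M lebesgue"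
    using lebesgue_measurable_scaling[of T, where 'a = real] by (simp add: real_scaleR_def[abs_def])
  have gT: "g (T * t) = indicator {0<..<1} t *\<^sub>R f t" for t
    using T by (auto simp: g_def indicator_def zero_less_mult_iff)
  let ?D = "density (distr lebesgue lebesgue (\<lambda>t. T * t)) (\<lambda>t. ennreal \<bar>T\<bar>)"
  have D: "lebesgue = ?D" by (rule lebesgue_real_scale) (use T in simp)
  have gm': "g \<in> borel_measurable (distr lebesgue lebesgue (\<lambda>t. T * t))" using gm by simp
  have "integrable lebesgue g \<longleftrightarrow> integrable ?D g" using D by simp
  also have "\<dots> \<longleftrightarrow> integrable (distr lebesgue lebesgue (\<lambda>t. T * t)) (\<lambda>t. \<bar>T\<bar> *\<^sub>R g t)"
    by (rule integrable_density[OF gm']) auto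
  also have "\<dots> \<longleftrightarrow> integrable lebesgue (\<lambda>t. \<bar>T\<bar> *\<^sub>R g (T * t))"
    by (rule integrable_distr_eq[OF sc]) (use gm in measurable)
  finally have "integrable lebesgue g" if "integrable lebesgue (\<lambda>t. indicator {0<..<1} t *\<^sub>R f t)"
    using that by (simp add: gT del: scaleR_scaleR)
  then show "integrable \<mu>\<^bsub>1\<^esub> f \<Longrightarrow> integrable \<mu>\<^bsub>T\<^esub> (\<lambda>t. f (t / T))"
    by (simp add: integrable_restrict_space g_def[abs_def])
  have "integral\<^sup>L lebesgue g = integral\<^sup>L ?D g" using D by simp
  also have "\<dots> = integral\<^sup>L (distr lebesgue lebesgue (\<lambda>t. T * t)) (\<lambda>t. \<bar>T\<bar> *\<^sub>R g t)"
    by (rule integral_density[OF gm']) auto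
  also have "\<dots> = (LINT t|lebesgue. \<bar>T\<bar> *\<^sub>R g (T * t))"
    by (rule integral_distr[OF sc]) (use gm in measurable)
  finally have "integral\<^sup>L lebesgue g = T *\<^sub>R (LINT t|lebesgue. indicator {0<..<1} t *\<^sub>R f t)"
    using T by (simp add: gT del: scaleR_scaleR)
  then show "(LINT t|\<mu>\<^bsub>T\<^esub>. f (t / T)) = T *\<^sub>R (LINT t|\<mu>\<^bsub>1\<^esub>. f t)"
    by (simp add: integral_restrict_space g_def[abs_def])
qed

lemma rescale_L2:
  fixes u :: "real \<Rightarrow> 'a::euclidean_space"
  assumes u: "u \<in> L2_on \<mu>\<^bsub>1\<^esub>" and T: "0 < T"
  shows "(\<lambda>t. c *\<^sub>R u (t / T)) \<in> L2_on \<mu>\<^bsub>T\<^esub>"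
proof (rule L2_on_scaleR)
  have "(\<lambda>t. (norm (u t))\<^sup>2) \<in> borel_measurable \<mu>\<^bsub>1\<^esub>" using L2_onD[OF u] by simp
  from rescale_integral(1)[OF this T L2_onD(2)[OF u]] rescale_measurable[OF L2_onD(1)[OF u] T]
  show "(\<lambda>t. u (t / T)) \<in> L2_on \<mu>\<^bsub>T\<^esub>" by (simp add: L2_on_def)
qed

lemma rescale_primitive:
  fixes g :: "real \<Rightarrow> 'a::euclidean_space"
  assumes g: "integrable \<mu>\<^bsub>1\<^esub> g" and T: "0 < T"
  shows "primitive T (\<lambda>s. (1 / T) *\<^sub>R g (s / T)) t = primitive 1 g (t / T)"
proof -
  define f where "f s = (1 / T) *\<^sub>R indicator {..t / T} s *\<^sub>R g s" for s
  have f: "f \<in> borel_measurable \<mu>\<^bsub>1\<^esub>"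
    unfolding f_def
    by (intro borel_measurable_integrable Bochner_Integration.integrable_scaleR_right integrable_indicator_scaleR g) auto
  have "primitive T (\<lambda>s. (1 / T) *\<^sub>R g (s / T)) t = (LINT s|\<mu>\<^bsub>T\<^esub>. f (s / T))"
    unfolding primitive_def f_def
    by (rule Bochner_Integration.integral_cong) (use T in \<open>auto simp: indicator_def divide_le_cancel\<close>)
  also have "\<dots> = T *\<^sub>R (LINT s|\<mu>\<^bsub>1\<^esub>. f s)" by (rule rescale_integral(2)[OF f T])
  also have "\<dots> = primitive 1 g (t / T)"
    using T unfolding f_def integral_scaleR_right by (simp add: primitive_def)
  finally show ?thesis .
qed

text \<open>A test function on \<open>(0,T)\<close> is pulled back to \<open>(0,1)\<close> as
  \<open>\<phi> (T * s)\<close>; the chain rule and the change of variables leave the factor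
  \<open>1 / T\<close> on \<open>v\<close>.\<close>

lemma rescale_weak_derivative:
  fixes u v :: "real \<Rightarrow> 'a::euclidean_space"
  assumes u: "integrable \<mu>\<^bsub>1\<^esub> u" and v: "integrable \<mu>\<^bsub>1\<^esub> v" and w: "has_weak_derivative 1 u v" and T: "0 < T"
  shows "has_weak_derivative T (\<lambda>t. u (t / T)) (\<lambda>t. (1 / T) *\<^sub>R v (t / T))"
  unfolding has_weak_derivative_def
proof
  fix \<phi> assume \<phi>: "\<phi> \<in> test_functions T"
  obtain a b where ab: "0 < a" "b < T" "\<And>t. t \<notin> {a..b} \<Longrightarrow> \<phi> t = 0" using test_function_support[OF \<phi>] by blast
  define \<psi> where "\<psi> s = \<phi> (T * s)" for s
  have der: "(\<psi> has_real_derivative T * deriv \<phi> (T * s)) (at s)" for s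
    unfolding \<psi>_def
    using DERIV_chain2[OF test_functionD(1)[OF \<phi>] DERIV_cmult_Id[of T s UNIV]] by (simp add: mult.commute)
  have cont: "continuous_on UNIV (\<lambda>s. T * deriv \<phi> (T * s))"
    by (intro continuous_intros continuous_on_compose2[OF test_functionD(2)[OF \<phi>, of UNIV]]) auto
  have \<psi>: "\<psi> \<in> test_functions 1" "deriv \<psi> = (\<lambda>s. T * deriv \<phi> (T * s))"
  proof -
    have supp: "\<psi> s = 0" if "s \<notin> {a / T..b / T}" for s
      unfolding \<psi>_def by (rule ab(3)) (use that T in \<open>auto simp: field_simps\<close>)
    have "0 < a / T" "b / T < 1" using ab T by auto
    from test_functionI[OF der cont this supp]
    show "\<psi> \<in> test_functions 1" "deriv \<psi> = (\<lambda>s. T * deriv \<phi> (T * s))" by auto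
  qed
  have i1: "integrable \<mu>\<^bsub>1\<^esub> (\<lambda>s. (1 / T) *\<^sub>R deriv \<psi> s *\<^sub>R u s)"
    by (intro Bochner_Integration.integrable_scaleR_right integrable_test_scaleR \<psi> u)
  have i2: "integrable \<mu>\<^bsub>1\<^esub> (\<lambda>s. (1 / T) *\<^sub>R \<psi> s *\<^sub>R v s)"
    by (intro Bochner_Integration.integrable_scaleR_right integrable_test_scaleR \<psi> v)
  have "(LINT t|\<mu>\<^bsub>T\<^esub>. deriv \<phi> t *\<^sub>R u (t / T)) = (LINT t|\<mu>\<^bsub>T\<^esub>. (1 / T) *\<^sub>R deriv \<psi> (t / T) *\<^sub>R u (t / T))"
    using T by (simp add: \<psi>(2))
  also have "\<dots> = T *\<^sub>R (LINT s|\<mu>\<^bsub>1\<^esub>. (1 / T) *\<^sub>R deriv \<psi> s *\<^sub>R u s)"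
    by (rule rescale_integral(2)[OF borel_measurable_integrable[OF i1] T])
  also have "\<dots> = (LINT s|\<mu>\<^bsub>1\<^esub>. deriv \<psi> s *\<^sub>R u s)"
    using T unfolding integral_scaleR_right by simp
  also have "\<dots> = - (LINT s|\<mu>\<^bsub>1\<^esub>. \<psi> s *\<^sub>R v s)" by (rule has_weak_derivativeD[OF w \<psi>(1)])
  also have "\<dots> = - (T *\<^sub>R (LINT s|\<mu>\<^bsub>1\<^esub>. (1 / T) *\<^sub>R \<psi> s *\<^sub>R v s))"
    using T unfolding integral_scaleR_right by simp
  also have "T *\<^sub>R (LINT s|\<mu>\<^bsub>1\<^esub>. (1 / T) *\<^sub>R \<psi> s *\<^sub>R v s) = (LINT t|\<mu>\<^bsub>T\<^esub>. (1 / T) *\<^sub>R \<psi> (t / T) *\<^sub>R v (t / T))"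
    by (rule rescale_integral(2)[OF borel_measurable_integrable[OF i2] T, symmetric])
  also have "\<dots> = (LINT t|\<mu>\<^bsub>T\<^esub>. \<phi> t *\<^sub>R (1 / T) *\<^sub>R v (t / T))"
    using T by (simp add: \<psi>_def mult.commute)
  finally show "(LINT t|\<mu>\<^bsub>T\<^esub>. deriv \<phi> t *\<^sub>R u (t / T)) = - (LINT t|\<mu>\<^bsub>T\<^esub>. \<phi> t *\<^sub>R (1 / T) *\<^sub>R v (t / T))" .
qed

section \<open>The right-hand sides of the neural equations\<close>

text \<open>Bilinearity in finite dimension supplies a continuity constant, so no explicit norm of
  the block-diagonal matrix has to be computed.\<close>

lemma bounded_bilinear_block_diag_mult:
  "bounded_bilinear (block_diag_mult :: real^'d^'d \<Rightarrow> real^'d^'n \<Rightarrow> real^'d^'n)"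
  unfolding bilinear_conv_bounded_bilinear[symmetric] bilinear_def
  by (auto simp: linear_iff block_diag_mult_def vec_eq_iff algebra_simps
      matrix_vector_right_distrib matrix_vector_mult_add_rdistrib matrix_vector_mult_scaleR
      scaleR_matrix_vector_assoc)

lemma bounded_linear_copies: "bounded_linear (copies :: real^'d \<Rightarrow> real^'d^'n)"
  unfolding linear_conv_bounded_linear[symmetric]
  by (auto simp: linear_iff copies_def vec_eq_iff)

lemma componentwise_lipschitz:
  fixes x y :: "real^'d^'n"
  assumes L: "L-lipschitz_on UNIV \<sigma>"
  shows "norm (componentwise \<sigma> x - componentwise \<sigma> y) \<le> L * norm (x - y)"
proof -
  have L0: "0 \<le> L" by (rule lipschitz_on_nonneg[OF L])
  have s: "\<bar>\<sigma> a - \<sigma> b\<bar> \<le> L * \<bar>a - b\<bar>" for a b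
    using lipschitz_onD[OF L, of a b] by (simp add: dist_real_def)
  have "norm ((componentwise \<sigma> x - componentwise \<sigma> y) $ i) \<le> norm ((L *\<^sub>R (x - y)) $ i)" for i
    by (rule norm_le_componentwise_cart) (use L0 s in \<open>auto simp: componentwise_def abs_mult\<close>)
  then have "norm (componentwise \<sigma> x - componentwise \<sigma> y) \<le> norm (L *\<^sub>R (x - y))"
    by (rule norm_le_componentwise_cart)
  then show ?thesis using L0 by simp
qed

text \<open>A difference of affine expressions is split into a change of state at parameter
  \<open>w\<close> and a change of parameter at state \<open>y\<close>. The factor \<open>L\<close>
  comes from \<open>\<sigma>\<close>, which acts before the matrix in the inside system and after
  the bias in the outside one; the single constant \<open>L * (C + D)\<close> covers both.\<close>

lemma controlled_field_rhs:
  assumes lip: "\<exists>L. L-lipschitz_on UNIV \<sigma>" and zero: "\<sigma> 0 = 0"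
  shows "\<exists>K. controlled_field (rhs sys \<sigma> :: 'd param \<Rightarrow> real^'d^'n \<Rightarrow> real^'d^'n) K"
proof -
  let ?m = "block_diag_mult :: real^'d^'d \<Rightarrow> real^'d^'n \<Rightarrow> real^'d^'n"
  let ?c = "copies :: real^'d \<Rightarrow> real^'d^'n"
  let ?s = "componentwise \<sigma> :: real^'d^'n \<Rightarrow> real^'d^'n"
  interpret m: bounded_bilinear ?m by (rule bounded_bilinear_block_diag_mult)
  interpret c: bounded_linear ?c by (rule bounded_linear_copies)
  obtain L0 where "L0-lipschitz_on UNIV \<sigma>" using lip by blast
  \<comment> \<open>Enlarging the constant to at least 1 lets the inside bias term, which does not
    pass through \<open>\<sigma>\<close>, carry the same factor \<open>L\<close>.\<close>
  then have lipL: "(max 1 L0)-lipschitz_on UNIV \<sigma>" by (rule lipschitz_on_le) simp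
  define L where "L = max 1 L0"
  have L: "1 \<le> L" by (simp add: L_def)
  have s: "norm (?s x - ?s y) \<le> L * norm (x - y)" for x y
    unfolding L_def by (rule componentwise_lipschitz[OF lipL])
  have s0: "?s 0 = 0" by (simp add: componentwise_def vec_eq_iff zero)
  have sn: "norm (?s x) \<le> L * norm x" for x using s[of x 0] by (simp add: s0)
  obtain C where C: "0 < C" "\<And>w x. norm (?m w x) \<le> norm w * norm x * C" using m.pos_bounded by blast
  obtain D where D: "0 < D" "\<And>b. norm (?c b) \<le> norm b * D" using c.pos_bounded by blast
  have diff: "?m w x + ?c b - (?m w' y + ?c b') = ?m w (x - y) + ?m (w - w') y + ?c (b - b')" for w w' x y b b'
    by (simp add: m.diff_left m.diff_right c.diff)
  have Cm: "norm (?m w x) \<le> C * (p * norm x)" if "norm w \<le> p" for w x p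
  proof -
    have "norm w * norm x * C \<le> p * norm x * C" using that C(1) by (intro mult_right_mono) auto
    from order_trans[OF C(2) this] show ?thesis by (simp add: mult_ac)
  qed
  have est: "norm (?m w x + ?c b - (?m w' y + ?c b'))
      \<le> C * (norm (w, b) * norm (x - y)) + C * (norm ((w, b) - (w', b')) * norm y) + D * norm ((w, b) - (w', b'))"
    for w w' x y b b'
  proof -
    have n: "norm w \<le> norm (w, b)" "norm (w - w') \<le> norm ((w, b) - (w', b'))" "norm (b - b') \<le> norm ((w, b) - (w', b'))"
      using norm_fst_le[of w b] norm_fst_le[of "w - w'" "b - b'"] norm_snd_le[of "b - b'" "w - w'"] by auto
    have "norm (?m w (x - y)) \<le> C * (norm (w, b) * norm (x - y))" by (rule Cm[OF n(1)])
    moreover have "norm (?m (w - w') y) \<le> C * (norm ((w, b) - (w', b')) * norm y)" by (rule Cm[OF n(2)])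
    moreover have "norm (?c (b - b')) \<le> D * norm ((w, b) - (w', b'))"
    proof -
      have "norm (b - b') * D \<le> norm ((w, b) - (w', b')) * D" using n(3) D(1) by (intro mult_right_mono) auto
      from order_trans[OF D(2) this] show ?thesis by (simp only: mult.commute)
    qed
    ultimately show ?thesis
      unfolding diff using norm_triangle_ineq[of "?m w (x - y) + ?m (w - w') y" "?c (b - b')"]
        norm_triangle_ineq[of "?m w (x - y)" "?m (w - w') y"] by linarith
  qed
  have combine: "L * (C * p + C * q + D * r) \<le> L * (C + D) * (p + (r + q))"
    if "0 \<le> p" "0 \<le> q" "0 \<le> r" for p q r
  proof -
    have "C * p + C * q + D * r \<le> (C + D) * (p + (r + q))"
      using that C(1) D(1) by (simp add: algebra_simps)
    then show ?thesis using L by (simp add: mult.assoc)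
  qed
  have "controlled_field (rhs sys \<sigma> :: 'd param \<Rightarrow> real^'d^'n \<Rightarrow> real^'d^'n) (L * (C + D))"
  proof
    show "0 \<le> L * (C + D)" using L C(1) D(1) by simp
    show "rhs sys \<sigma> 0 x = 0" for x :: "real^'d^'n"
      by (cases sys) (simp_all add: zero_prod_def m.zero_left c.zero s0)
    fix u v :: "'d param" and x y :: "real^'d^'n"
    obtain w b where u: "u = (w, b)" by (cases u)
    obtain w' b' where v: "v = (w', b')" by (cases v)
    define p where "p = norm u * norm (x - y)"
    define q where "q = norm (u - v) * norm y"
    define r where "r = norm (u - v)"
    have nn: "0 \<le> p" "0 \<le> q" "0 \<le> r" by (simp_all add: p_def q_def r_def)
    have "norm (rhs sys \<sigma> u x - rhs sys \<sigma> v y) \<le> L * (C * p + C * q + D * r)"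
    proof (cases sys)
      case Inside
      have "norm (rhs sys \<sigma> u x - rhs sys \<sigma> v y)
          \<le> C * (norm u * norm (?s x - ?s y)) + C * (norm (u - v) * norm (?s y)) + D * r"
        using est[of w "?s x" b w' "?s y" b'] by (simp add: Inside u v r_def)
      also have "\<dots> \<le> C * (norm u * (L * norm (x - y))) + C * (norm (u - v) * (L * norm y)) + L * (D * r)"
      proof (intro add_mono mult_left_mono s sn)
        show "D * r \<le> L * (D * r)" using mult_right_mono[OF L, of "D * r"] D(1) nn(3) by simp
      qed (use C(1) in auto)
      also have "\<dots> = L * (C * p + C * q + D * r)" by (simp add: p_def q_def algebra_simps)
      finally show ?thesis .
    next
      case Outside
      have "norm (rhs sys \<sigma> u x - rhs sys \<sigma> v y) \<le> L * norm (?m w x + ?c b - (?m w' y + ?c b'))"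
        using s[of "?m w x + ?c b" "?m w' y + ?c b'"] by (simp add: Outside u v)
      also have "\<dots> \<le> L * (C * p + C * q + D * r)"
        using est[of w x b w' y b'] L by (intro mult_left_mono) (auto simp: p_def q_def r_def u v)
      finally show ?thesis .
    qed
    also have "\<dots> \<le> L * (C + D) * (p + (r + q))" by (rule combine[OF nn])
    also have "\<dots> = L * (C + D) * (norm u * norm (x - y) + norm (u - v) * (1 + norm y))"
      by (simp add: p_def q_def r_def algebra_simps)
    finally show "norm (rhs sys \<sigma> u x - rhs sys \<sigma> v y)
        \<le> L * (C + D) * (norm u * norm (x - y) + norm (u - v) * (1 + norm y))" .
  qed
  then show ?thesis ..
qed

text \<open>Linearity in the parameter, in the midpoint form that \<open>parameters_compact\<close>
  requires when \<open>k = 0\<close>.\<close>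

lemma rhs_Inside_midpoint:
  "rhs Inside \<sigma> ((1/2) *\<^sub>R (u + v)) x = (1/2) *\<^sub>R (rhs Inside \<sigma> u x + rhs Inside \<sigma> v x)"
proof -
  interpret m: bounded_bilinear "block_diag_mult :: real^'a^'a \<Rightarrow> real^'a^'b \<Rightarrow> real^'a^'b"
    by (rule bounded_bilinear_block_diag_mult)
  interpret c: bounded_linear "copies :: real^'a \<Rightarrow> real^'a^'b" by (rule bounded_linear_copies)
  show ?thesis
    by (cases u; cases v) (simp add: m.add_left m.scaleR_left c.add c.scaleR scaleR_add_right)
qed

text \<open>Stretching time by \<open>T\<close> divides velocities by \<open>T\<close>, and this
  factor has to be produced by the parameter. Inside this is linearity; outside, 1-homogeneity
  passes the factor through \<open>\<sigma>\<close>.\<close>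

lemma rhs_positively_homogeneous:
  assumes "sys = Inside \<or> one_homogeneous \<sigma>" "0 < a"
  shows "rhs sys \<sigma> (a *\<^sub>R u) x = a *\<^sub>R rhs sys \<sigma> u x"
proof -
  interpret m: bounded_bilinear "block_diag_mult :: real^'a^'a \<Rightarrow> real^'a^'b \<Rightarrow> real^'a^'b"
    by (rule bounded_bilinear_block_diag_mult)
  interpret c: bounded_linear "copies :: real^'a \<Rightarrow> real^'a^'b" by (rule bounded_linear_copies)
  obtain w b where u: "u = (w, b)" by (cases u)
  show ?thesis
  proof (cases sys)
    case Inside
    then show ?thesis by (simp add: u m.scaleR_left c.scaleR scaleR_add_right)
  next
    case Outside
    then have "\<sigma> (a * z) = a * \<sigma> z" for z using assms by (auto simp: one_homogeneous_def)
    then have "componentwise \<sigma> (a *\<^sub>R z) = a *\<^sub>R componentwise \<sigma> z" for z :: "real^'a^'b"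
      by (simp add: componentwise_def vec_eq_iff)
    then show ?thesis by (simp add: Outside u m.scaleR_left c.scaleR flip: scaleR_add_right)
  qed
qed

lemma solves_iff: "solves sys \<sigma> x0 T u x \<longleftrightarrow> caratheodory_solution (rhs sys \<sigma>) x0 T u x"
proof -
  let ?g = "\<lambda>s. rhs sys \<sigma> (u s) (x s)"
  have "integrable (lebesgue_on {0..T}) ?g \<longleftrightarrow> integrable \<mu>\<^bsub>T\<^esub> (\<lambda>s. indicator {..T} s *\<^sub>R ?g s)"
    by (rule initial_segment(1)) simp
  also have "\<dots> \<longleftrightarrow> integrable \<mu>\<^bsub>T\<^esub> ?g"
    by (rule Bochner_Integration.integrable_cong) auto
  finally show ?thesis
    using initial_segment(2)[of _ T ?g] by (auto simp: solves_def caratheodory_solution_def primitive_def)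
qed

text \<open>Uniqueness on \<open>{0..T}\<close> together with extensionality elsewhere makes the
  definite description in \<open>solution\<close> denote the restriction of any solution.\<close>

lemma solution_eqI:
  fixes x :: "real \<Rightarrow> real^'d^'n"
  assumes f: "controlled_field (rhs sys \<sigma> :: 'd param \<Rightarrow> real^'d^'n \<Rightarrow> real^'d^'n) K"
    and u: "u \<in> L2_on \<mu>\<^bsub>T\<^esub>" and x: "caratheodory_solution (rhs sys \<sigma>) x0 T u x" and t: "t \<in> {0..T}"
  shows "solution sys \<sigma> x0 T u t = x t"
proof -
  have cong: "caratheodory_solution (rhs sys \<sigma>) x0 T u (restrict x {0..T})"
  proof -
    have "integrable \<mu>\<^bsub>T\<^esub> (\<lambda>s. rhs sys \<sigma> (u s) (restrict x {0..T} s)) \<longleftrightarrow> integrable \<mu>\<^bsub>T\<^esub> (\<lambda>s. rhs sys \<sigma> (u s) (x s))"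
      by (rule Bochner_Integration.integrable_cong) auto
    moreover have "primitive T (\<lambda>s. rhs sys \<sigma> (u s) (restrict x {0..T} s)) t = primitive T (\<lambda>s. rhs sys \<sigma> (u s) (x s)) t" for t
      unfolding primitive_def by (rule Bochner_Integration.integral_cong) auto
    ultimately show ?thesis using x by (simp add: caratheodory_solution_def)
  qed
  have "solution sys \<sigma> x0 T u = restrict x {0..T}"
    unfolding solution_def
  proof (rule the_equality)
    show "restrict x {0..T} \<in> extensional {0..T} \<and> solves sys \<sigma> x0 T u (restrict x {0..T})"
      using cong by (simp add: solves_iff)
    fix y assume y: "y \<in> extensional {0..T} \<and> solves sys \<sigma> x0 T u y"
    show "y = restrict x {0..T}"
    proof (rule extensionalityI[of _ "{0..T}"])
      show "y t = restrict x {0..T} t" if "t \<in> {0..T}" for t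
        using controlled_field.solution_unique[OF f u _ x that] y that by (simp add: solves_iff)
    qed (use y in auto)
  qed
  then show ?thesis using t by simp
qed

section \<open>Jets\<close>

lemma L2_space_eq: "L2_space T = L2_on \<mu>\<^bsub>T\<^esub>"
  by (simp add: L2_space_def L2_on_def)

lemma L2_norm_eq: "L2_norm T u = L2_norm_on \<mu>\<^bsub>T\<^esub> u"
  by (simp add: L2_norm_def L2_norm_on_def)

lemma norm_Pair_square: "(norm (a, b))\<^sup>2 = (norm a)\<^sup>2 + (norm b)\<^sup>2"
  by (simp add: norm_Pair)

lemma L2_on_Pair:
  assumes "u \<in> L2_on M" "v \<in> L2_on M"
  shows "(\<lambda>t. (u t, v t)) \<in> L2_on M"
    "(L2_norm_on M (\<lambda>t. (u t, v t)))\<^sup>2 = (L2_norm_on M u)\<^sup>2 + (L2_norm_on M v)\<^sup>2"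
  using assms by (auto simp: L2_on_def norm_Pair_square L2_norm_on_square)

lemma L2_on_fst_snd:
  fixes V :: "real \<Rightarrow> 'a::euclidean_space \<times> 'b::euclidean_space"
  assumes "V \<in> L2_on \<mu>\<^bsub>T\<^esub>"
  shows "(\<lambda>t. fst (V t)) \<in> L2_on \<mu>\<^bsub>T\<^esub>" "L2_norm_on \<mu>\<^bsub>T\<^esub> (\<lambda>t. fst (V t)) \<le> L2_norm_on \<mu>\<^bsub>T\<^esub> V"
    "(\<lambda>t. snd (V t)) \<in> L2_on \<mu>\<^bsub>T\<^esub>" "L2_norm_on \<mu>\<^bsub>T\<^esub> (\<lambda>t. snd (V t)) \<le> L2_norm_on \<mu>\<^bsub>T\<^esub> V"
proof -
  have m: "(\<lambda>t. fst (V t)) \<in> borel_measurable \<mu>\<^bsub>T\<^esub>" "(\<lambda>t. snd (V t)) \<in> borel_measurable \<mu>\<^bsub>T\<^esub>"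
    using measurable_compose[OF L2_onD(1)[OF assms] borel_measurable_continuous_onI[OF continuous_on_fst[OF continuous_on_id]]]
      measurable_compose[OF L2_onD(1)[OF assms] borel_measurable_continuous_onI[OF continuous_on_snd[OF continuous_on_id]]]
    by auto
  have n: "norm (fst (V t)) \<le> 1 * norm (V t)" "norm (snd (V t)) \<le> 1 * norm (V t)" for t
    using norm_fst_le[of "fst (V t)" "snd (V t)"] norm_snd_le[of "snd (V t)" "fst (V t)"] by auto
  show "(\<lambda>t. fst (V t)) \<in> L2_on \<mu>\<^bsub>T\<^esub>" "L2_norm_on \<mu>\<^bsub>T\<^esub> (\<lambda>t. fst (V t)) \<le> L2_norm_on \<mu>\<^bsub>T\<^esub> V"
    "(\<lambda>t. snd (V t)) \<in> L2_on \<mu>\<^bsub>T\<^esub>" "L2_norm_on \<mu>\<^bsub>T\<^esub> (\<lambda>t. snd (V t)) \<le> L2_norm_on \<mu>\<^bsub>T\<^esub> V"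
    using L2_on_bounded_mult[OF m(1) assms n(1)] L2_on_bounded_mult[OF m(2) assms n(2)] by auto
qed

text \<open>Elements of \<open>H\<^sup>0\<close> and \<open>H\<^sup>1\<close> are identified with their jets \<open>(u, 0)\<close> and \<open>(u, u')\<close>, so that
  both norms become \<open>L\<^sup>2\<close> norms.\<close>

definition is_jet :: "nat \<Rightarrow> real \<Rightarrow> (real \<Rightarrow> 'a::euclidean_space \<times> 'a) \<Rightarrow> bool" where
  "is_jet k T V \<longleftrightarrow> V \<in> L2_on \<mu>\<^bsub>T\<^esub> \<and>
     (if k = 0 then L2_norm_on \<mu>\<^bsub>T\<^esub> (\<lambda>t. snd (V t)) = 0
      else has_weak_derivative T (\<lambda>t. fst (V t)) (\<lambda>t. snd (V t)))"

definition jet :: "nat \<Rightarrow> real \<Rightarrow> (real \<Rightarrow> 'a::euclidean_space) \<Rightarrow> real \<Rightarrow> 'a \<times> 'a" where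
  "jet k T u t = (u t, if k = 0 then 0 else weak_derivative T u t)"

lemma weak_derivative_someI:
  assumes "u \<in> H_space 1 T"
  shows "u \<in> L2_on \<mu>\<^bsub>T\<^esub>" "weak_derivative T u \<in> L2_on \<mu>\<^bsub>T\<^esub>" "has_weak_derivative T u (weak_derivative T u)"
proof -
  have u: "u \<in> L2_on \<mu>\<^bsub>T\<^esub> \<and> (\<exists>v. v \<in> L2_space T \<and> has_weak_derivative T u v)"
    using assms by (auto simp: L2_space_eq)
  then show "u \<in> L2_on \<mu>\<^bsub>T\<^esub>" by simp
  have "weak_derivative T u \<in> L2_space T \<and> has_weak_derivative T u (weak_derivative T u)"
    unfolding weak_derivative_def by (rule someI_ex[OF conjunct2[OF u]])
  then show "weak_derivative T u \<in> L2_on \<mu>\<^bsub>T\<^esub>" "has_weak_derivative T u (weak_derivative T u)"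
    by (simp_all add: L2_space_eq)
qed

lemma zero_L2: "(\<lambda>_. 0) \<in> L2_on M" "L2_norm_on M (\<lambda>_. 0) = 0"
  by (auto simp: L2_on_def L2_norm_on_def)

lemma H_norm_jet:
  assumes "k \<le> 1" "u \<in> H_space k T"
  shows "is_jet k T (jet k T u)" "H_norm k T u = L2_norm_on \<mu>\<^bsub>T\<^esub> (jet k T u)" "u \<in> L2_on \<mu>\<^bsub>T\<^esub>"
proof -
  consider "k = 0" | "k = 1" using assms(1) by linarith
  then have "is_jet k T (jet k T u) \<and> H_norm k T u = L2_norm_on \<mu>\<^bsub>T\<^esub> (jet k T u) \<and> u \<in> L2_on \<mu>\<^bsub>T\<^esub>"
  proof cases
    case 1
    then have u: "u \<in> L2_on \<mu>\<^bsub>T\<^esub>" using assms by (simp add: L2_space_eq)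
    have j: "jet k T u = (\<lambda>t. (u t, 0))" using 1 by (simp add: jet_def[abs_def])
    have "(L2_norm_on \<mu>\<^bsub>T\<^esub> (\<lambda>t. (u t, 0::'a)))\<^sup>2 = (L2_norm_on \<mu>\<^bsub>T\<^esub> u)\<^sup>2"
      unfolding L2_on_Pair(2)[OF u zero_L2(1)] by (simp add: zero_L2(2))
    then show ?thesis
      unfolding is_jet_def j
      using 1 u L2_on_Pair(1)[OF u zero_L2(1)] by (simp add: L2_norm_eq zero_L2)
  next
    case 2
    then have "u \<in> H_space 1 T" using assms by simp
    note u = weak_derivative_someI[OF this]
    have j: "jet k T u = (\<lambda>t. (u t, weak_derivative T u t))" using 2 by (simp add: jet_def[abs_def])
    have "H_norm k T u = sqrt ((L2_norm_on \<mu>\<^bsub>T\<^esub> (\<lambda>t. (u t, weak_derivative T u t)))\<^sup>2)"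
      unfolding L2_on_Pair(2)[OF u(1,2)] using 2 by (simp add: L2_norm_eq)
    then have "H_norm k T u = L2_norm_on \<mu>\<^bsub>T\<^esub> (\<lambda>t. (u t, weak_derivative T u t))" by simp
    then show ?thesis
      unfolding is_jet_def j using 2 u L2_on_Pair(1)[OF u(1,2)] by simp
  qed
  then show "is_jet k T (jet k T u)" "H_norm k T u = L2_norm_on \<mu>\<^bsub>T\<^esub> (jet k T u)" "u \<in> L2_on \<mu>\<^bsub>T\<^esub>" by auto
qed

text \<open>The second component need not be the function selected by
  \<open>weak_derivative\<close>, but the two agree almost everywhere by uniqueness, so the norm is
  the same.\<close>

lemma jet_of_is_jet:
  assumes k: "k \<le> 1" and T: "0 < T" and V: "is_jet k T V"
  shows "(\<lambda>t. fst (V t)) \<in> H_space k T" "H_norm k T (\<lambda>t. fst (V t)) = L2_norm_on \<mu>\<^bsub>T\<^esub> V"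
proof -
  let ?u = "\<lambda>t. fst (V t)" and ?v = "\<lambda>t. snd (V t)"
  have VL: "V \<in> L2_on \<mu>\<^bsub>T\<^esub>" using V by (simp add: is_jet_def)
  note uv = L2_on_fst_snd(1,3)[OF VL]
  have VV: "(L2_norm_on \<mu>\<^bsub>T\<^esub> V)\<^sup>2 = (L2_norm_on \<mu>\<^bsub>T\<^esub> ?u)\<^sup>2 + (L2_norm_on \<mu>\<^bsub>T\<^esub> ?v)\<^sup>2"
    using L2_on_Pair(2)[OF uv] by simp
  consider "k = 0" | "k = 1" using k by linarith
  then have "?u \<in> H_space k T \<and> H_norm k T ?u = L2_norm_on \<mu>\<^bsub>T\<^esub> V"
  proof cases
    case 1
    then show ?thesis using uv VV V by (simp add: L2_space_eq L2_norm_eq is_jet_def)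
  next
    case 2
    then have w: "has_weak_derivative T ?u ?v" using V by (simp add: is_jet_def)
    have H: "?u \<in> H_space 1 T" using uv w by (auto simp: L2_space_eq)
    note d = weak_derivative_someI(2,3)[OF H]
    have "L2_norm_on \<mu>\<^bsub>T\<^esub> (weak_derivative T ?u) = L2_norm_on \<mu>\<^bsub>T\<^esub> ?v"
      by (intro L2_norm_on_cong_AE L2_onD(1) d uv
          has_weak_derivative_unique[OF T integrable_L2[OF d(1)] integrable_L2[OF uv(2)] d(2) w])
    then have "H_norm 1 T ?u = sqrt ((L2_norm_on \<mu>\<^bsub>T\<^esub> V)\<^sup>2)"
      unfolding VV by (simp add: L2_norm_eq)
    then show ?thesis using H 2 by simp
  qed
  then show "?u \<in> H_space k T" "H_norm k T ?u = L2_norm_on \<mu>\<^bsub>T\<^esub> V" by auto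
qed

lemma is_jet_scaleR:
  assumes "is_jet k T V" shows "is_jet k T (\<lambda>t. c *\<^sub>R V t)"
  using assms has_weak_derivative_scaleR[of T "\<lambda>t. fst (V t)" "\<lambda>t. snd (V t)" c]
  by (auto simp: is_jet_def L2_on_scaleR L2_norm_on_scaleR split: if_splits)

lemma is_jet_add:
  assumes "is_jet k T V" "is_jet k T W" shows "is_jet k T (\<lambda>t. V t + W t)"
proof -
  have VW: "V \<in> L2_on \<mu>\<^bsub>T\<^esub>" "W \<in> L2_on \<mu>\<^bsub>T\<^esub>" using assms by (auto simp: is_jet_def)
  note V = L2_on_fst_snd(1,3)[OF VW(1)] and W = L2_on_fst_snd(1,3)[OF VW(2)]
  show ?thesis
  proof (cases "k = 0")
    case True
    then have "L2_norm_on \<mu>\<^bsub>T\<^esub> (\<lambda>t. snd (V t) + snd (W t)) \<le> 0"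
      using L2_norm_on_triangle[OF V(2) W(2)] assms by (simp add: is_jet_def)
    with True show ?thesis using L2_on_add[OF VW] by (simp add: is_jet_def order_antisym)
  next
    case False
    then show ?thesis
      using L2_on_add[OF VW] assms has_weak_derivative_add[OF V[THEN integrable_L2] W[THEN integrable_L2]]
      by (simp add: is_jet_def)
  qed
qed

lemma is_jet_diff:
  assumes "is_jet k T V" "is_jet k T W" shows "is_jet k T (\<lambda>t. V t - W t)"
  using is_jet_add[OF assms(1) is_jet_scaleR[OF assms(2), of "-1"]] by simp

text \<open>Jets are closed in L^2. For \<open>k = 0\<close> this explains why \<open>is_jet\<close>
  asks for a second component of norm 0 and not for the zero function: an L^2 limit is determined
  only up to a null set.\<close>

lemma is_jet_limit:
  assumes T: "0 \<le> T" and V: "\<And>n. is_jet k T (V n)" and g: "g \<in> L2_on \<mu>\<^bsub>T\<^esub>"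
    and lim: "(\<lambda>n. L2_norm_on \<mu>\<^bsub>T\<^esub> (\<lambda>t. V n t - g t)) \<longlonglongrightarrow> 0"
  shows "is_jet k T g"
proof -
  have VL: "V n \<in> L2_on \<mu>\<^bsub>T\<^esub>" for n using V by (simp add: is_jet_def)
  note f = L2_on_fst_snd[OF L2_on_diff[OF VL g]]
  have lim1: "(\<lambda>n. L2_norm_on \<mu>\<^bsub>T\<^esub> (\<lambda>t. fst (V n t) - fst (g t))) \<longlonglongrightarrow> 0"
    by (rule tendsto_sandwich[OF _ _ tendsto_const lim]) (use f(2) in auto)
  have lim2: "(\<lambda>n. L2_norm_on \<mu>\<^bsub>T\<^esub> (\<lambda>t. snd (V n t) - snd (g t))) \<longlonglongrightarrow> 0"
    by (rule tendsto_sandwich[OF _ _ tendsto_const lim]) (use f(4) in auto)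
  show ?thesis
  proof (cases "k = 0")
    case True
    have "\<bar>L2_norm_on \<mu>\<^bsub>T\<^esub> (\<lambda>t. snd (V n t)) - L2_norm_on \<mu>\<^bsub>T\<^esub> (\<lambda>t. snd (g t))\<bar>
        \<le> L2_norm_on \<mu>\<^bsub>T\<^esub> (\<lambda>t. snd (V n t) - snd (g t))" for n
      by (intro L2_norm_on_triangle_diff L2_on_fst_snd VL g)
    then have "L2_norm_on \<mu>\<^bsub>T\<^esub> (\<lambda>t. snd (g t)) \<le> L2_norm_on \<mu>\<^bsub>T\<^esub> (\<lambda>t. snd (V n t) - snd (g t))" for n
      using V True by (simp add: is_jet_def)
    then have "L2_norm_on \<mu>\<^bsub>T\<^esub> (\<lambda>t. snd (g t)) \<le> 0"
      by (intro LIMSEQ_le_const[OF lim2]) auto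
    with True g show ?thesis by (simp add: is_jet_def order_antisym)
  next
    case False
    then have "has_weak_derivative T (\<lambda>t. fst (V n t)) (\<lambda>t. snd (V n t))" for n
      using V by (simp add: is_jet_def)
    from has_weak_derivative_limit[OF T L2_on_fst_snd(1)[OF VL] L2_on_fst_snd(1)[OF g] lim1
        L2_on_fst_snd(3)[OF VL] L2_on_fst_snd(3)[OF g] lim2 this]
    show ?thesis using False g by (simp add: is_jet_def)
  qed
qed

section \<open>Compactness of bounded families of parameters\<close>

text \<open>Subsequences are extracted before hulls are formed, first for the states and then, if
  \<open>k = 1\<close>, for the parameters in L^2. In both cases an estimate valid on a tail of the
  sequence extends to its hull because it is preserved under midpoints. The last conclusion is
  conditional since norm may be lost in the limit; its premise holds when \<open>m\<close> is the
  infimum over a set that contains the limit.\<close>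

lemma (in controlled_field) parameters_compact:
  fixes u :: "nat \<Rightarrow> real \<Rightarrow> 'p"
  assumes T: "0 < T"
    and k: "k = 1 \<or> k = 0 \<and> (\<forall>u v x. f ((1/2) *\<^sub>R (u + v)) x = (1/2) *\<^sub>R (f u x + f v x))"
    and u: "\<And>n. u n \<in> H_space k T" and m: "\<And>n. (H_norm k T (u n))\<^sup>2 \<le> m"
    and x: "\<And>n. caratheodory_solution f x0 T (u n) (x n)"
  obtains r v y where "strict_mono (r :: nat \<Rightarrow> nat)" "v \<in> H_space k T" "caratheodory_solution f x0 T v y"
    "(\<lambda>n. x (r n) T) \<longlonglongrightarrow> y T" "(H_norm k T v)\<^sup>2 \<le> m"
    "m \<le> (H_norm k T v)\<^sup>2 \<longrightarrow> (\<lambda>n. H_norm k T (\<lambda>t. u (r n) t - v t)) \<longlonglongrightarrow> 0"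
proof -
  interpret fm: finite_measure "\<mu>\<^bsub>T\<^esub>" by (rule finite_open_interval_measure)
  have T0: "0 \<le> T" using T by simp
  have k1: "k \<le> 1" using k by auto
  note jet = H_norm_jet[OF k1 u]
  have jL: "jet k T (u n) \<in> L2_on \<mu>\<^bsub>T\<^esub>" for n using jet(1)[of n] by (simp add: is_jet_def)
  have jm: "L2_norm_on \<mu>\<^bsub>T\<^esub> (jet k T (u n)) \<le> sqrt m" for n
    using m[of n] by (simp add: jet(2) real_le_rsqrt)
  have um: "L2_norm_on \<mu>\<^bsub>T\<^esub> (u n) \<le> sqrt m" for n
    using order_trans[OF L2_on_fst_snd(2)[OF jL] jm, of n] by (simp add: jet_def[abs_def])
  obtain r1 y where r1: "strict_mono (r1 :: nat \<Rightarrow> nat)" and y: "continuous_on {0..T} y"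
    and lim1: "uniform_limit {0..T} (\<lambda>n. x (r1 n)) y sequentially"
    by (rule solutions_compact[OF jet(3) um x])
  \<comment> \<open>For \<open>k = 0\<close> no further extraction is made and \<open>r2\<close> is
    the identity.\<close>
  obtain r2 where r2: "strict_mono (r2 :: nat \<Rightarrow> nat)"
    and H1: "k = 1 \<Longrightarrow> \<exists>z \<in> L2_on \<mu>\<^bsub>T\<^esub>. (\<lambda>n. L2_norm_on \<mu>\<^bsub>T\<^esub> (\<lambda>t. u (r1 (r2 n)) t - z t)) \<longlonglongrightarrow> 0"
  proof (cases "k = 1")
    case True
    have "has_weak_derivative T (u n) (\<lambda>t. snd (jet k T (u n) t))" for n
      using jet(1)[of n] True by (simp add: is_jet_def jet_def)
    from H1_compact[OF T jet(3) um L2_on_fst_snd(3)[OF jL] order_trans[OF L2_on_fst_snd(4)[OF jL] jm] this, of r1]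
    obtain r2 z where "strict_mono (r2 :: nat \<Rightarrow> nat)" "z \<in> L2_on \<mu>\<^bsub>T\<^esub>"
      "(\<lambda>n. L2_norm_on \<mu>\<^bsub>T\<^esub> (\<lambda>t. u (r1 (r2 n)) t - z t)) \<longlonglongrightarrow> 0" .
    then show ?thesis by (intro that) auto
  qed (use that[of id] in \<open>simp add: strict_mono_id\<close>)
  define r where "r n = r1 (r2 n)" for n
  have r: "strict_mono r" using strict_mono_o[OF r1 r2] by (simp add: r_def[abs_def] o_def)
  have lim: "uniform_limit {0..T} (\<lambda>n. x (r n)) y sequentially"
    using filterlim_compose[OF lim1 filterlim_subseq[OF r2]] by (simp add: r_def)
  define G where "G n = jet k T (u (r n))" for n
  have "\<exists>V g. (\<forall>n. V n \<in> midpoint_hull (G ` {n..})) \<and> g \<in> L2_on \<mu>\<^bsub>T\<^esub> \<and>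
      (\<lambda>n. L2_norm_on \<mu>\<^bsub>T\<^esub> (\<lambda>t. V n t - g t)) \<longlonglongrightarrow> 0 \<and> (L2_norm_on \<mu>\<^bsub>T\<^esub> g)\<^sup>2 \<le> m \<and>
      (m \<le> (L2_norm_on \<mu>\<^bsub>T\<^esub> g)\<^sup>2 \<longrightarrow> (\<lambda>n. L2_norm_on \<mu>\<^bsub>T\<^esub> (\<lambda>t. G n t - g t)) \<longlonglongrightarrow> 0)"
    by (rule fm.Mazur_L2[of G m, OF jL[of "r _", folded G_def] m[of "r _", unfolded jet(2), folded G_def]]) blast
  then obtain V g where V: "\<And>n. V n \<in> midpoint_hull (G ` {n..})" and g: "g \<in> L2_on \<mu>\<^bsub>T\<^esub>"
    and Vg: "(\<lambda>n. L2_norm_on \<mu>\<^bsub>T\<^esub> (\<lambda>t. V n t - g t)) \<longlonglongrightarrow> 0" and gm: "(L2_norm_on \<mu>\<^bsub>T\<^esub> g)\<^sup>2 \<le> m"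
    and strong: "m \<le> (L2_norm_on \<mu>\<^bsub>T\<^esub> g)\<^sup>2 \<longrightarrow> (\<lambda>n. L2_norm_on \<mu>\<^bsub>T\<^esub> (\<lambda>t. G n t - g t)) \<longlonglongrightarrow> 0"
    by blast
  have hull_jet: "is_jet k T W" if "W \<in> midpoint_hull (G ` A)" for W A
    using that by induction (auto simp: G_def jet(1) intro: is_jet_scaleR is_jet_add)
  have VL: "V n \<in> L2_on \<mu>\<^bsub>T\<^esub>" for n using hull_jet[OF V] by (simp add: is_jet_def)
  have gj: "is_jet k T g" by (rule is_jet_limit[OF T0 hull_jet[OF V] g Vg])
  define v where "v t = fst (g t)" for t
  note v = jet_of_is_jet[OF k1 T gj, folded v_def]
  have vL: "v \<in> L2_on \<mu>\<^bsub>T\<^esub>" unfolding v_def by (rule L2_on_fst_snd(1)[OF g])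
  have fV: "(\<lambda>t. fst (V n t)) \<in> L2_on \<mu>\<^bsub>T\<^esub>" for n by (rule L2_on_fst_snd(1)[OF VL])
  have fVv: "(\<lambda>n. L2_norm_on \<mu>\<^bsub>T\<^esub> (\<lambda>t. fst (V n t) - v t)) \<longlonglongrightarrow> 0"
    by (rule tendsto_sandwich[OF _ _ tendsto_const Vg])
       (use L2_on_fst_snd(2)[OF L2_on_diff[OF VL g]] in \<open>auto simp: v_def\<close>)
  have res: "(\<lambda>n. x0 + primitive T (\<lambda>s. f (u (r n) s) (y s)) t) \<longlonglongrightarrow> y t" if "t \<in> {0..T}" for t
    by (rule limit_residual[OF jet(3) um x y lim that])
  have y_eq: "y t = x0 + primitive T (\<lambda>s. f (v s) (y s)) t" if t: "t \<in> {0..T}" for t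
  proof (rule LIMSEQ_unique)
    show "(\<lambda>n. x0 + primitive T (\<lambda>s. f (fst (V n s)) (y s)) t) \<longlonglongrightarrow> x0 + primitive T (\<lambda>s. f (v s) (y s)) t"
      by (intro tendsto_intros primitive_tendsto_L2[OF fV vL fVv y t])
    show "(\<lambda>n. x0 + primitive T (\<lambda>s. f (fst (V n s)) (y s)) t) \<longlonglongrightarrow> y t"
      using k
    proof
      assume "k = 1"
      then obtain z where z: "z \<in> L2_on \<mu>\<^bsub>T\<^esub>" and uz: "(\<lambda>n. L2_norm_on \<mu>\<^bsub>T\<^esub> (\<lambda>t. u (r n) t - z t)) \<longlonglongrightarrow> 0"
        using H1 by (auto simp: r_def)
      \<comment> \<open>Closed balls around \<open>z\<close> are stable under midpoints, so the hull
        of a tail stays as close to \<open>z\<close> as the tail does.\<close>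
      have Wz: "L2_norm_on \<mu>\<^bsub>T\<^esub> (\<lambda>t. fst (W t) - z t) \<le> e"
        if "W \<in> midpoint_hull (G ` A)" "\<And>n. n \<in> A \<Longrightarrow> L2_norm_on \<mu>\<^bsub>T\<^esub> (\<lambda>t. u (r n) t - z t) \<le> e" for W A e
        using that(1)
      proof induction
        case (base W)
        then show ?case using that(2) by (auto simp: G_def jet_def)
      next
        case (mid W W')
        have L: "(\<lambda>t. fst (W t) - z t) \<in> L2_on \<mu>\<^bsub>T\<^esub>" "(\<lambda>t. fst (W' t) - z t) \<in> L2_on \<mu>\<^bsub>T\<^esub>"
          using hull_jet[OF mid(1)] hull_jet[OF mid(2)] by (auto simp: is_jet_def intro!: L2_on_diff L2_on_fst_snd z)
        have eq: "fst ((1/2) *\<^sub>R (W t + W' t)) - z t = (1/2) *\<^sub>R ((fst (W t) - z t) + (fst (W' t) - z t))" for t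
          by (simp add: algebra_simps flip: scaleR_add_left)
        have "L2_norm_on \<mu>\<^bsub>T\<^esub> (\<lambda>t. fst ((1/2) *\<^sub>R (W t + W' t)) - z t)
            = (1/2) * L2_norm_on \<mu>\<^bsub>T\<^esub> (\<lambda>t. (fst (W t) - z t) + (fst (W' t) - z t))"
          unfolding eq L2_norm_on_scaleR by simp
        also have "\<dots> \<le> (1/2) * (e + e)"
          using L2_norm_on_triangle[OF L] mid.IH by simp
        finally show ?case by simp
      qed
      have "(\<lambda>n. L2_norm_on \<mu>\<^bsub>T\<^esub> (\<lambda>t. fst (V n t) - z t)) \<longlonglongrightarrow> 0"
      proof (rule LIMSEQ_I)
        fix e :: real assume "0 < e"
        then have "\<forall>\<^sub>F n in sequentially. L2_norm_on \<mu>\<^bsub>T\<^esub> (\<lambda>t. u (r n) t - z t) < e / 2"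
          using order_tendstoD(2)[OF uz, of "e / 2"] by simp
        then obtain N where N: "\<And>n. n \<ge> N \<Longrightarrow> L2_norm_on \<mu>\<^bsub>T\<^esub> (\<lambda>t. u (r n) t - z t) < e / 2"
          by (auto simp: eventually_sequentially)
        have "L2_norm_on \<mu>\<^bsub>T\<^esub> (\<lambda>t. fst (V n t) - z t) \<le> e / 2" if "n \<ge> N" for n
          by (rule Wz[OF V]) (use N that in \<open>auto intro: less_imp_le\<close>)
        then show "\<exists>N. \<forall>n\<ge>N. norm (L2_norm_on \<mu>\<^bsub>T\<^esub> (\<lambda>t. fst (V n t) - z t) - 0) < e"
          using \<open>0 < e\<close> by (intro exI[of _ N]) fastforce
      qed
      from primitive_tendsto_L2[OF fV z this y t]
      have "(\<lambda>n. x0 + primitive T (\<lambda>s. f (fst (V n s)) (y s)) t) \<longlonglongrightarrow> x0 + primitive T (\<lambda>s. f (z s) (y s)) t"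
        by (intro tendsto_intros)
      moreover have "(\<lambda>n. x0 + primitive T (\<lambda>s. f (u (r n) s) (y s)) t) \<longlonglongrightarrow> x0 + primitive T (\<lambda>s. f (z s) (y s)) t"
        by (intro tendsto_intros primitive_tendsto_L2[OF jet(3) z uz y t])
      \<comment> \<open>The integrals along \<open>V\<close> and along \<open>u\<close> have the
        same limit, the one computed with \<open>z\<close>, and \<open>res\<close> identifies it as
        \<open>y t\<close>.\<close>
      ultimately show ?thesis using LIMSEQ_unique[OF res[OF t]] by simp
    next
      assume lin: "k = 0 \<and> (\<forall>u v x. f ((1/2) *\<^sub>R (u + v)) x = (1/2) *\<^sub>R (f u x + f v x))"
      \<comment> \<open>The defect of \<open>y\<close> as a solution for the parameter
        \<open>fst (W s)\<close>. By \<open>lin\<close> the defect of a midpoint is the average of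
        the defects, so small defects on a tail stay small on its hull.\<close>
      define R where "R W = x0 + primitive T (\<lambda>s. f (fst (W s)) (y s)) t - y t" for W :: "real \<Rightarrow> 'p \<times> 'p"
      have R: "norm (R W) \<le> e"
        if "W \<in> midpoint_hull (G ` A)" "\<And>n. n \<in> A \<Longrightarrow> norm (R (G n)) \<le> e" for W A e
        using that(1)
      proof induction
        case (base W)
        then show ?case using that(2) by auto
      next
        case (mid W W')
        have i: "integrable \<mu>\<^bsub>T\<^esub> (\<lambda>s. f (fst (W s)) (y s))" "integrable \<mu>\<^bsub>T\<^esub> (\<lambda>s. f (fst (W' s)) (y s))"
          using hull_jet[OF mid(1)] hull_jet[OF mid(2)] by (auto simp: is_jet_def intro!: f_integrable L2_on_fst_snd y)
        have "(\<lambda>s. f (fst ((1/2) *\<^sub>R (W s + W' s))) (y s)) = (\<lambda>s. (1/2) *\<^sub>R (f (fst (W s)) (y s) + f (fst (W' s)) (y s)))"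
          unfolding fst_scaleR fst_add using lin by blast
        then have "R (\<lambda>s. (1/2) *\<^sub>R (W s + W' s)) = x0 + (1/2) *\<^sub>R (primitive T (\<lambda>s. f (fst (W s)) (y s)) t
            + primitive T (\<lambda>s. f (fst (W' s)) (y s)) t) - y t"
          unfolding R_def by (simp only: primitive_scaleR primitive_add[OF i])
        also have "\<dots> = (1/2) *\<^sub>R (R W + R W')"
          unfolding R_def by (simp add: algebra_simps flip: scaleR_add_left)
        finally have "norm (R (\<lambda>s. (1/2) *\<^sub>R (W s + W' s))) = (1/2) * norm (R W + R W')" by simp
        also have "\<dots> \<le> (1/2) * (e + e)"
          using norm_triangle_ineq[of "R W" "R W'"] mid.IH by simp
        finally show ?case by simp
      qed
      have "(\<lambda>n. R (V n)) \<longlonglongrightarrow> 0"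
      proof (rule LIMSEQ_I)
        fix e :: real assume "0 < e"
        have "(\<lambda>n. R (G n)) \<longlonglongrightarrow> 0"
          using LIM_zero[OF res[OF t]] by (simp add: R_def G_def jet_def)
        from LIMSEQ_D[OF this, of "e / 2"] obtain N where N: "\<And>n. n \<ge> N \<Longrightarrow> norm (R (G n)) < e / 2"
          using \<open>0 < e\<close> by auto
        have "norm (R (V n)) \<le> e / 2" if "n \<ge> N" for n
          by (rule R[OF V]) (use N that in \<open>auto intro: less_imp_le\<close>)
        then show "\<exists>N. \<forall>n\<ge>N. norm (R (V n) - 0) < e"
          using \<open>0 < e\<close> by (intro exI[of _ N]) fastforce
      qed
      then show ?thesis unfolding R_def by (rule LIM_zero_cancel)
    qed
  qed
  show ?thesis
  proof (rule that[OF r v(1)])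
    show "caratheodory_solution f x0 T v y"
      using f_integrable[OF vL y] y_eq by (simp add: caratheodory_solution_def)
    show "(\<lambda>n. x (r n) T) \<longlonglongrightarrow> y T" by (rule tendsto_uniform_limitI[OF lim]) (use T0 in simp)
    show "(H_norm k T v)\<^sup>2 \<le> m" using gm v(2) by simp
    \<comment> \<open>The difference of the jets is a jet of the difference, so the H^k distance is
      the L^2 distance that \<open>strong\<close> controls.\<close>
    have "H_norm k T (\<lambda>t. u (r n) t - v t) = L2_norm_on \<mu>\<^bsub>T\<^esub> (\<lambda>t. G n t - g t)" for n
      using jet_of_is_jet(2)[OF k1 T is_jet_diff[OF jet(1)[of "r n"] gj]] by (simp add: G_def jet_def v_def)
    then show "m \<le> (H_norm k T v)\<^sup>2 \<longrightarrow> (\<lambda>n. H_norm k T (\<lambda>t. u (r n) t - v t)) \<longlonglongrightarrow> 0"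
      using strong v(2) by simp
  qed
qed

section \<open>Interpolating parameters\<close>

lemma interpolating_params_rescale:
  fixes x0 :: "real^'d^'n"
  assumes sys: "(sys = Inside \<and> k = 0) \<or> (sys = Outside \<and> one_homogeneous \<sigma> \<and> k = 1)"
    and u: "interpolating_params E sys \<sigma> x0 k 1 u" and T: "0 < T"
  shows "interpolating_params E sys \<sigma> x0 k T (\<lambda>t. (1 / T) *\<^sub>R u (t / T))"
proof -
  have k: "k = 0 \<or> k = 1" using sys by auto
  obtain x where x: "caratheodory_solution (rhs sys \<sigma>) x0 1 u x" and E: "E (x 1) = 0" and uH: "u \<in> H_space k 1"
    using u by (auto simp: interpolating_params_def solves_iff)
  have uL: "u \<in> L2_on \<mu>\<^bsub>1\<^esub>" by (rule H_norm_jet(3)[OF _ uH]) (use k in auto)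
  have "(\<lambda>t. (1 / T) *\<^sub>R u (t / T)) \<in> H_space k T"
    using k
  proof
    assume "k = 0"
    then show ?thesis using rescale_L2[OF uL T] by (simp add: L2_space_eq)
  next
    assume "k = 1"
    then obtain v where v: "v \<in> L2_on \<mu>\<^bsub>1\<^esub>" "has_weak_derivative 1 u v" using uH by (auto simp: L2_space_eq)
    \<comment> \<open>One factor \<open>1 / T\<close> is the amplitude of the rescaled parameter,
      the other comes from the chain rule.\<close>
    have "has_weak_derivative T (\<lambda>t. (1 / T) *\<^sub>R u (t / T)) (\<lambda>t. (1 / T) *\<^sub>R (1 / T) *\<^sub>R v (t / T))"
      by (intro has_weak_derivative_scaleR rescale_weak_derivative integrable_L2 uL v T)
    then show ?thesis
      using \<open>k = 1\<close> rescale_L2[OF uL T] rescale_L2[OF v(1) T, of "(1 / T) * (1 / T)"]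
      by (auto simp: L2_space_eq)
  qed
  moreover have "caratheodory_solution (rhs sys \<sigma>) x0 T (\<lambda>t. (1 / T) *\<^sub>R u (t / T)) (\<lambda>t. x (t / T))"
  proof -
    define g where "g s = rhs sys \<sigma> (u s) (x s)" for s
    have g: "integrable \<mu>\<^bsub>1\<^esub> g" using x by (simp add: caratheodory_solution_def g_def[abs_def])
    have eq: "rhs sys \<sigma> ((1 / T) *\<^sub>R u (s / T)) (x (s / T)) = (1 / T) *\<^sub>R g (s / T)" for s
      unfolding g_def by (rule rhs_positively_homogeneous) (use sys T in auto)
    have "integrable \<mu>\<^bsub>T\<^esub> (\<lambda>s. (1 / T) *\<^sub>R g (s / T))"
      by (intro Bochner_Integration.integrable_scaleR_right rescale_integral(1)[OF borel_measurable_integrable[OF g] T g])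
    moreover have "x (t / T) = x0 + primitive 1 g (t / T)" if "t \<in> {0..T}" for t
      using x that T by (auto simp: caratheodory_solution_def g_def[abs_def])
    ultimately show ?thesis
      unfolding caratheodory_solution_def eq rescale_primitive[OF g T] by blast
  qed
  moreover have "x (T / T) = x 1" using T by simp
  ultimately show ?thesis
    using E unfolding interpolating_params_def solves_iff by metis
qed

section \<open>Continuity and sign of the empirical risk\<close>

lemma continuous_on_empirical_risk:
  assumes P: "affine_map P" and Y: "range ydat \<subseteq> Y" and loss: "continuous_on (UNIV \<times> Y) loss"
  shows "continuous_on UNIV (empirical_risk loss P ydat)"
proof -
  obtain A p where "\<forall>x. P x = A *v x + p" using P unfolding affine_map_def by blast
  then have P_eq: "P = (\<lambda>x. A *v x + p)" by (intro ext) simp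
  have P: "continuous_on UNIV P"
    unfolding P_eq by (intro continuous_intros matrix_vector_mult_linear_continuous_on)
  have "continuous_on UNIV (\<lambda>x. loss (P (x $ i), ydat i))" for i
  proof (rule continuous_on_compose2[OF loss])
    have "continuous_on UNIV (\<lambda>x. P (x $ i))"
      by (rule continuous_on_compose2[OF P]) (intro continuous_intros, simp)
    then show "continuous_on UNIV (\<lambda>x. (P (x $ i), ydat i))"
      by (intro continuous_on_Pair continuous_on_const)
  qed (use Y in auto)
  then show ?thesis
    unfolding empirical_risk_def[abs_def] by (intro continuous_intros)
qed

lemma empirical_risk_nonneg:
  assumes "range ydat \<subseteq> Y" "\<forall>p \<in> UNIV \<times> Y. 0 \<le> loss p"
  shows "0 \<le> empirical_risk loss P ydat x"
  unfolding empirical_risk_def using assms by (intro mult_nonneg_nonneg sum_nonneg) auto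

theorem theorem3p2:
  fixes xdat :: "'n::finite \<Rightarrow> real^'d"
    and ydat :: "'n \<Rightarrow> 'y::topological_space"
    and X :: "(real^'d) set" and Y :: "'y set"
    and P :: "real^'d \<Rightarrow> real^'m"
    and loss :: "(real^'m) \<times> 'y \<Rightarrow> real"
    and \<sigma> :: "real \<Rightarrow> real"
    and E :: "real^'d^'n \<Rightarrow> real" and x0 :: "real^'d^'n"
    and sys :: nde and k :: nat and T :: real
  defines "E \<equiv> empirical_risk loss P ydat"
    and "x0 \<equiv> initial_stack xdat"
  assumes dataset: "inj xdat" "range xdat \<subseteq> X" "range ydat \<subseteq> Y"
    and activation: "\<exists>L. L-lipschitz_on UNIV \<sigma>" "\<sigma> 0 = 0"
    and P: "affine_map P" "P \<noteq> (\<lambda>_. 0)"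
    and loss: "continuous_on (UNIV \<times> Y) loss" "\<forall>p \<in> UNIV \<times> Y. 0 \<le> loss p"
    and attains: "\<exists>\<xi>. is_arg_min E (\<lambda>_. True) \<xi> \<and> E \<xi> = 0"
    and sys: "(sys = Inside \<and> k = 0) \<or> (sys = Outside \<and> one_homogeneous \<sigma> \<and> k = 1)"
    and interp: "\<exists>u. interpolating_params E sys \<sigma> x0 k 1 u"
    and T: "0 < T"
  shows "\<exists>C>0. \<forall>u :: real \<Rightarrow> real \<Rightarrow> 'd param.
    (\<forall>l>0. is_arg_min (cost E sys \<sigma> x0 k T l) (\<lambda>v. v \<in> H_space k T) (u l)) \<longrightarrow>
      (\<forall>l>0. E (solution sys \<sigma> x0 T (u l) T) \<le> C * l) \<and>
      (\<exists>ls :: nat \<Rightarrow> real. (\<forall>n. 0 < ls n) \<and> ls \<longlonglongrightarrow> 0 \<and>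
        (\<exists>xo r. E xo = 0 \<and> strict_mono r \<and>
          (\<lambda>n. solution sys \<sigma> x0 T (u (ls (r n))) T) \<longlonglongrightarrow> xo \<and>
          (\<exists>ustar s.
            is_arg_min (\<lambda>v. (H_norm k T v)\<^sup>2) (interpolating_params E sys \<sigma> x0 k T) ustar \<and>
            strict_mono s \<and>
            (\<lambda>n. H_norm k T (\<lambda>t. u (ls (r (s n))) t - ustar t)) \<longlonglongrightarrow> 0)))"
proof -
  have k1: "k \<le> 1" using sys by auto
  have T0: "T \<in> {0..T}" using T by simp
  obtain K where f: "controlled_field (rhs sys \<sigma> :: 'd param \<Rightarrow> real^'d^'n \<Rightarrow> real^'d^'n) K"
    using controlled_field_rhs[OF activation] by blast
  interpret controlled_field "rhs sys \<sigma> :: 'd param \<Rightarrow> real^'d^'n \<Rightarrow> real^'d^'n" K by (rule f)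
  have E0: "0 \<le> E x" for x unfolding E_def by (rule empirical_risk_nonneg[OF dataset(3) loss(2)])
  have Ec: "continuous_on UNIV E" unfolding E_def by (rule continuous_on_empirical_risk[OF P(1) dataset(3) loss(1)])
  let ?I = "interpolating_params E sys \<sigma> x0 k T"
  obtain u0 where u0: "?I u0" using interp interpolating_params_rescale[OF sys _ T] by blast
  \<comment> \<open>\<open>u0\<close> is fixed before the family of minimizers, so the constant is
    independent of that family and of \<open>l\<close>; the \<open>+ 1\<close> makes it positive
    even when \<open>u0\<close> has norm 0.\<close>
  define C where "C = (H_norm k T u0)\<^sup>2 + 1"
  show ?thesis
  proof (intro exI[of _ C] conjI allI impI)
    show "0 < C" by (simp add: C_def add_nonneg_pos)
    fix u :: "real \<Rightarrow> real \<Rightarrow> 'd param"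
    assume "\<forall>l>0. is_arg_min (cost E sys \<sigma> x0 k T l) (\<lambda>v. v \<in> H_space k T) (u l)"
    then have uH: "\<And>l. 0 < l \<Longrightarrow> u l \<in> H_space k T"
      and umin: "\<And>l v. 0 < l \<Longrightarrow> v \<in> H_space k T \<Longrightarrow> cost E sys \<sigma> x0 k T l (u l) \<le> cost E sys \<sigma> x0 k T l v"
      by (auto simp: is_arg_min_def not_less)
    \<comment> \<open>The risk of an interpolating competitor vanishes; uniqueness of trajectories
      identifies its witness with \<open>solution\<close>, which is what \<open>cost\<close>
      evaluates.\<close>
    have key: "E (solution sys \<sigma> x0 T (u l) T) + l * (H_norm k T (u l))\<^sup>2 \<le> l * (H_norm k T v)\<^sup>2"
      if l: "0 < l" and v: "?I v" for l v
    proof -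
      obtain x where x: "caratheodory_solution (rhs sys \<sigma>) x0 T v x" "E (x T) = 0" and vH: "v \<in> H_space k T"
        using v by (auto simp: interpolating_params_def solves_iff)
      have "E (solution sys \<sigma> x0 T v T) = 0"
        using solution_eqI[OF f H_norm_jet(3)[OF k1 vH] x(1) T0] x(2) by simp
      then show ?thesis using umin[OF l vH] by (simp add: cost_def)
    qed
    have risk: "E (solution sys \<sigma> x0 T (u l) T) \<le> C * l" if l: "0 < l" for l
    proof -
      have "E (solution sys \<sigma> x0 T (u l) T) \<le> l * (H_norm k T u0)\<^sup>2"
        using key[OF l u0] mult_nonneg_nonneg[OF less_imp_le[OF l] zero_le_power2[of "H_norm k T (u l)"]] by linarith
      also have "\<dots> \<le> C * l" using l by (simp add: C_def algebra_simps)
      finally show ?thesis .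
    qed
    then show "E (solution sys \<sigma> x0 T (u l) T) \<le> C * l" if "0 < l" for l using that .
    \<comment> \<open>That this infimum is attained is not known at this point; the limit
      \<open>v\<close> below attains it.\<close>
    define m where "m = (INF v\<in>Collect ?I. (H_norm k T v)\<^sup>2)"
    have m_le: "m \<le> (H_norm k T v)\<^sup>2" if "?I v" for v
      unfolding m_def by (rule cINF_lower) (use that in \<open>auto intro: bdd_belowI[of _ 0]\<close>)
    have u_le: "(H_norm k T (u l))\<^sup>2 \<le> m" if l: "0 < l" for l
      unfolding m_def
    proof (rule cINF_greatest)
      fix v assume "v \<in> Collect ?I"
      then have "l * (H_norm k T (u l))\<^sup>2 \<le> l * (H_norm k T v)\<^sup>2"
        using key[OF l, of v] E0[of "solution sys \<sigma> x0 T (u l) T"] by simp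
      then show "(H_norm k T (u l))\<^sup>2 \<le> (H_norm k T v)\<^sup>2" using l by simp
    qed (use u0 in auto)
    \<comment> \<open>Any positive sequence tending to 0 would do.\<close>
    define ls where "ls n = 1 / real (Suc n)" for n
    have ls: "0 < ls n" for n by (simp add: ls_def)
    have ls0: "ls \<longlonglongrightarrow> 0" unfolding ls_def using LIMSEQ_inverse_real_of_nat by (simp add: inverse_eq_divide)
    have uL: "u (ls n) \<in> L2_on \<mu>\<^bsub>T\<^esub>" for n by (rule H_norm_jet(3)[OF k1 uH[OF ls]])
    have "\<forall>n. \<exists>x. caratheodory_solution (rhs sys \<sigma>) x0 T (u (ls n)) x"
      using solution_exists[OF uL] T by simp
    then obtain x where x: "\<And>n. caratheodory_solution (rhs sys \<sigma>) x0 T (u (ls n)) (x n)" by metis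
    have sol: "solution sys \<sigma> x0 T (u (ls n)) T = x n T" for n by (rule solution_eqI[OF f uL x T0])
    have lin: "k = 1 \<or> k = 0 \<and> (\<forall>u v x. rhs sys \<sigma> ((1/2) *\<^sub>R (u + v)) x
        = (1/2) *\<^sub>R (rhs sys \<sigma> u x + rhs sys \<sigma> v (x :: real^'d^'n)))"
      using sys rhs_Inside_midpoint by blast
    obtain r v y where r: "strict_mono (r :: nat \<Rightarrow> nat)" and v: "v \<in> H_space k T"
      and y: "caratheodory_solution (rhs sys \<sigma>) x0 T v y" and lim: "(\<lambda>n. x (r n) T) \<longlonglongrightarrow> y T"
      and vm: "(H_norm k T v)\<^sup>2 \<le> m"
      and strong: "m \<le> (H_norm k T v)\<^sup>2 \<longrightarrow> (\<lambda>n. H_norm k T (\<lambda>t. u (ls (r n)) t - v t)) \<longlonglongrightarrow> 0"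
      by (rule parameters_compact[OF T lin uH[OF ls] u_le[OF ls] x])
    \<comment> \<open>The risk is at most \<open>C * ls (r n)\<close> along the subsequence, so
      continuity of \<open>E\<close> forces risk 0 at the limit.\<close>
    have Ey: "E (y T) = 0"
    proof (rule LIMSEQ_unique)
      show "(\<lambda>n. E (x (r n) T)) \<longlonglongrightarrow> E (y T)"
        using continuous_on_tendsto_compose[OF Ec lim] by simp
      have "(\<lambda>n. C * ls (r n)) \<longlonglongrightarrow> C * 0"
        by (intro tendsto_intros LIMSEQ_subseq_LIMSEQ[OF ls0 r, unfolded o_def])
      then have up: "(\<lambda>n. C * ls (r n)) \<longlonglongrightarrow> 0" by simp
      show "(\<lambda>n. E (x (r n) T)) \<longlonglongrightarrow> 0"
        by (rule tendsto_sandwich[OF _ _ tendsto_const up]) (use E0 risk[OF ls] sol in auto)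
    qed
    have vI: "?I v" using v y Ey by (auto simp: interpolating_params_def solves_iff)
    \<comment> \<open>Since \<open>v\<close> interpolates, \<open>m_le\<close> turns
      \<open>vm\<close> into an equality with the infimum; the same inequality discharges the
      premise of \<open>strong\<close>.\<close>
    have arg: "is_arg_min (\<lambda>v. (H_norm k T v)\<^sup>2) ?I v"
      using vI order_trans[OF vm m_le] by (auto simp: is_arg_min_def not_less)
    show "\<exists>ls :: nat \<Rightarrow> real. (\<forall>n. 0 < ls n) \<and> ls \<longlonglongrightarrow> 0 \<and>
        (\<exists>xo r. E xo = 0 \<and> strict_mono r \<and>
          (\<lambda>n. solution sys \<sigma> x0 T (u (ls (r n))) T) \<longlonglongrightarrow> xo \<and>
          (\<exists>ustar s.
            is_arg_min (\<lambda>v. (H_norm k T v)\<^sup>2) ?I ustar \<and>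
            strict_mono s \<and>
            (\<lambda>n. H_norm k T (\<lambda>t. u (ls (r (s n))) t - ustar t)) \<longlonglongrightarrow> 0))"
      \<comment> \<open>The second subsequence is the identity, because the parameters already
        converge along \<open>r\<close>.\<close>
      by (rule exI[of _ ls], intro conjI allI ls ls0, rule exI[of _ "y T"], rule exI[of _ r],
          intro conjI Ey r, use lim in \<open>simp add: sol\<close>, rule exI[of _ v], rule exI[of _ id],
          use arg mp[OF strong m_le[OF vI]] strict_mono_id in simp)
  qed
qed

end
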